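(* Let $S(q)=S_0+\varphi^i q_i+S^{ij}q_iq_j+S^{ijk}q_iq_jq_k+\cdots$ be a formal power series in $q=(q_1,\dots,q_d)$ with symmetric coefficients, and let $G:\mathbb{R}^d\to\mathbb{R}$ be a smooth function. Let $$R(S,G)=S(\overline q)+G(\overline y)-\overline y^{\alpha}\overline q_{\alpha},$$ where $\overline y=(\overline y^\alpha)$ and $\overline q=(\overline q_\alpha)$ are the unique functional power series in $G$ determined by the system $$\overline q_\alpha=\frac{\partial G}{\partial y^\alpha}(\overline y),\qquad \overline y^\alpha=\frac{\partial S}{\partial q_\alpha}(\overline q).$$ Then $R(S,G)$ has the following expansion as a functional power series in $G$: $$R(S,G)=\sum_{t\in T^\circ}\frac{1}{|t|_\circ!\,|t|_\bullet!}\,\langle S,G;t\rangle=\sum_{t\in[T^\circ]}\frac{1}{|\mathrm{sym}(t)|}\,\langle S,G;t\rangle .$$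
   Context: Repeated indices are summed from $1$ to $d$. Write $S^{a_1\dots a_m}$ for the coefficient of $q_{a_1}\cdots q_{a_m}$ in $S$, symmetric in its indices; $S^i=\varphi^i$, and the coefficient with no indices is $S_0$. Let $\varphi=(\varphi^1,\dots,\varphi^d)\in\mathbb{R}^d$. The coefficients of $S$ and the function $G$ may depend on further parameters, which are suppressed. Functional power series in $G$: replace $G$ by $\epsilon G$ and work with formal power series in $\epsilon$; the order in $G$ is the power of $\epsilon$. To zeroth order $\overline q=0$ and $\overline y=\varphi$; $G(\overline y)$ and its derivatives are understood through the Taylor expansion of $G$ at $\varphi$. A bipartite graph is $t=(B_t,W_t,E_t)$ with black vertices $B_t=\{1,\dots,n\}$, white vertices $W_t=\{-1,\dots,-m\}$ and a finite multiset $E_t$ of elements of $B_t\times W_t$ (edges). A bipartite tree is a (nonempty) connected bipartite graph without cycles. Put $|t|_\bullet=|B_t|$, $|t|_\circ=|W_t|$. An isomorphism $t\to t'$ is a pair of permutations of the black and of the white vertices carrying the edges of $t$ to those of $t'$; $\mathrm{sym}(t)$ is the group of automorphisms of $t$. $T^\circ$ is the set of bipartite trees all of whose leaves (vertices of degree exactly one) are white; it contains the one-vertex tree $\bullet$ and the one-vertex tree $\circ$. $[T^\circ]$ is the set of isomorphism classes in $T^\circ$. For a vertex $v$ let $e^v_1,\dots,e^v_{m_v}$ be the edges attached to $v$. Using edges as dummy summation indices (each edge is an index appearing once at its black end and once at its white end), define $$\langle S,G;t\rangle:=\Big(\prod_{v\in B_t}m_v!\,S^{e^v_1\dots e^v_{m_v}}\Big)\Big(\prod_{w\in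 W_t}\frac{\partial}{\partial y^{e^w_1}}\cdots\frac{\partial}{\partial y^{e^w_{m_w}}}G(\varphi)\Big),$$ so that $\langle S,G;\bullet\rangle=S_0$ and $\langle S,G;\circ\rangle=G(\varphi)$. The order in $G$ of $\langle S,G;t\rangle$ is $|t|_\circ$. *)

theory Defs
  imports "HOL-Analysis.Analysis" "HOL-Combinatorics.Permutations"
begin

section \<open>Power series and smooth functions\<close>

text \<open>
  The finite type \<open>'d\<close> is the index set \<open>{1,\<dots>,d}\<close>. A formal power series \<open>S(q)\<close> is given by its
  coefficient tensors: \<open>S [a1,\<dots>,am]\<close> is \<open>S^{a1 \<dots> am}\<close>, so \<open>S []\<close> is \<open>S_0\<close> and \<open>S [i]\<close> is \<open>\<phi>^i\<close>.
  The sum \<open>S(q)\<close> runs over all \<^emph>\<open>ordered\<close> index tuples.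
\<close>

definition symmetric_coeffs :: "('d list \<Rightarrow> real) \<Rightarrow> bool" where
  "symmetric_coeffs S \<longleftrightarrow> (\<forall>as bs. mset as = mset bs \<longrightarrow> S as = S bs)"

definition base_point :: "('d list \<Rightarrow> real) \<Rightarrow> real ^ 'd" where
  "base_point S = (\<chi> i. S [i])"

text \<open>
  Functional power series in \<open>G\<close> are elements of \<open>real fps\<close>: \<open>G\<close> is replaced by \<open>\<epsilon> G\<close>, where
  \<open>fps_X\<close> is \<open>\<epsilon>\<close>. Infinite sums are unordered sums in the \<open>\<epsilon>\<close>-adic topology that the library
  puts on \<open>real fps\<close>. The two sums below converge whenever all \<open>q \<alpha>\<close> have zero constant
  coefficient.
\<close>

definition eval_series :: "('d list \<Rightarrow> real) \<Rightarrow> ('d \<Rightarrow> real fps) \<Rightarrow> real fps" where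
  "eval_series S q = (\<Sum>\<^sub>\<infinity>as. fps_const (S as) * (\<Prod>i<length as. q (as ! i)))"

text \<open>The partial derivative of \<open>S\<close> with respect to \<open>q_\<alpha>\<close>, by the product rule in each monomial.\<close>

definition eval_series_deriv ::
  "'d \<Rightarrow> ('d list \<Rightarrow> real) \<Rightarrow> ('d \<Rightarrow> real fps) \<Rightarrow> real fps" where
  "eval_series_deriv \<alpha> S q =
     (\<Sum>\<^sub>\<infinity>as. fps_const (S as) *
        (\<Sum>k | k < length as \<and> as ! k = \<alpha>. \<Prod>i\<in>{..<length as} - {k}. q (as ! i)))"

definition partial_deriv ::
  "'d::finite \<Rightarrow> (real ^ 'd \<Rightarrow> real) \<Rightarrow> real ^ 'd \<Rightarrow> real" where
  "partial_deriv \<alpha> f x = deriv (\<lambda>t. f (x + t *\<^sub>R axis \<alpha> 1)) 0"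

fun partial_derivs ::
  "'d::finite list \<Rightarrow> (real ^ 'd \<Rightarrow> real) \<Rightarrow> real ^ 'd \<Rightarrow> real" where
  "partial_derivs [] f = f"
| "partial_derivs (\<alpha> # as) f = partial_deriv \<alpha> (partial_derivs as f)"

definition smooth :: "(real ^ 'd::finite \<Rightarrow> real) \<Rightarrow> bool" where
  "smooth f \<longleftrightarrow> (\<forall>as x. partial_derivs as f differentiable (at x))"

text \<open>
  \<open>f(y)\<close> for formal \<open>y\<close> with zeroth order \<open>\<phi>\<close>, through the Taylor expansion of \<open>f\<close> at \<open>\<phi>\<close>; the
  sum over ordered index tuples makes \<open>1/m!\<close> the right normalization.
\<close>

definition taylor_eval ::
  "(real ^ 'd::finite \<Rightarrow> real) \<Rightarrow> real ^ 'd \<Rightarrow> ('d \<Rightarrow> real fps) \<Rightarrow> real fps" where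
  "taylor_eval f \<phi> y =
     eval_series (\<lambda>as. partial_derivs as f \<phi> / fact (length as)) (\<lambda>\<alpha>. y \<alpha> - fps_const (\<phi> $ \<alpha>))"

definition solves_system ::
  "('d::finite list \<Rightarrow> real) \<Rightarrow> (real ^ 'd \<Rightarrow> real) \<Rightarrow>
   ('d \<Rightarrow> real fps) \<Rightarrow> ('d \<Rightarrow> real fps) \<Rightarrow> bool" where
  "solves_system S G q y \<longleftrightarrow>
     (\<forall>\<alpha>. fps_nth (q \<alpha>) 0 = 0 \<and> fps_nth (y \<alpha>) 0 = base_point S $ \<alpha>) \<and>
     (\<forall>\<alpha>. q \<alpha> = fps_X * taylor_eval (partial_deriv \<alpha> G) (base_point S) y) \<and>
     (\<forall>\<alpha>. y \<alpha> = eval_series_deriv \<alpha> S q)"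

definition R_value ::
  "('d::finite list \<Rightarrow> real) \<Rightarrow> (real ^ 'd \<Rightarrow> real) \<Rightarrow>
   ('d \<Rightarrow> real fps) \<Rightarrow> ('d \<Rightarrow> real fps) \<Rightarrow> real fps" where
  "R_value S G q y =
     eval_series S q + fps_X * taylor_eval G (base_point S) y - (\<Sum>\<alpha>\<in>UNIV. y \<alpha> * q \<alpha>)"


section \<open>Bipartite trees\<close>

datatype bgraph = BGraph (nblack: nat) (nwhite: nat) (bedges: "(int \<times> int) multiset")

definition blacks :: "bgraph \<Rightarrow> int set" where
  "blacks t = {1..int (nblack t)}"

definition whites :: "bgraph \<Rightarrow> int set" where
  "whites t = {- int (nwhite t)..-1}"

abbreviation verts :: "bgraph \<Rightarrow> int set" where
  "verts t \<equiv> blacks t \<union> whites t"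

definition bipartite_graph :: "bgraph \<Rightarrow> bool" where
  "bipartite_graph t \<longleftrightarrow> set_mset (bedges t) \<subseteq> blacks t \<times> whites t"

definition joins :: "int \<times> int \<Rightarrow> int \<Rightarrow> int \<Rightarrow> bool" where
  "joins e u v \<longleftrightarrow> e = (u, v) \<or> e = (v, u)"

definition connected_graph :: "bgraph \<Rightarrow> bool" where
  "connected_graph t \<longleftrightarrow>
     (\<forall>u\<in>verts t. \<forall>v\<in>verts t. (u, v) \<in> {(x, y). \<exists>e\<in>#bedges t. joins e x y}\<^sup>*)"

text \<open>
  A cycle consists of distinct vertices and distinct occurrences of edges, so that a repeated
  edge is a cycle of length two.
\<close>

definition is_cycle :: "bgraph \<Rightarrow> int list \<Rightarrow> (int \<times> int) list \<Rightarrow> bool" where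
  "is_cycle t vs es \<longleftrightarrow>
     vs \<noteq> [] \<and> distinct vs \<and> set vs \<subseteq> verts t \<and> length es = length vs \<and> mset es \<subseteq># bedges t \<and>
     (\<forall>i<length vs. joins (es ! i) (vs ! i) (vs ! (Suc i mod length vs)))"

definition bipartite_tree :: "bgraph \<Rightarrow> bool" where
  "bipartite_tree t \<longleftrightarrow>
     bipartite_graph t \<and> verts t \<noteq> {} \<and> connected_graph t \<and> (\<nexists>vs es. is_cycle t vs es)"

text \<open>Edges counted with multiplicity: the pair \<open>(e, k)\<close> is the \<open>k\<close>-th copy of \<open>e\<close>.\<close>

definition edge_occs :: "bgraph \<Rightarrow> ((int \<times> int) \<times> nat) set" where
  "edge_occs t = {(e, k). k < count (bedges t) e}"

definition edges_at :: "bgraph \<Rightarrow> int \<Rightarrow> ((int \<times> int) \<times> nat) set" where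
  "edges_at t v = {(e, k) \<in> edge_occs t. fst e = v \<or> snd e = v}"

definition vdegree :: "bgraph \<Rightarrow> int \<Rightarrow> nat" where
  "vdegree t v = card (edges_at t v)"

definition T_white :: "bgraph set" where
  "T_white = {t. bipartite_tree t \<and> (\<forall>v\<in>verts t. vdegree t v = 1 \<longrightarrow> v \<in> whites t)}"

definition is_iso :: "bgraph \<Rightarrow> bgraph \<Rightarrow> (int \<Rightarrow> int) \<times> (int \<Rightarrow> int) \<Rightarrow> bool" where
  "is_iso t t' = (\<lambda>(\<beta>, \<omega>).
     nblack t = nblack t' \<and> nwhite t = nwhite t' \<and>
     \<beta> permutes blacks t \<and> \<omega> permutes whites t \<and>
     image_mset (map_prod \<beta> \<omega>) (bedges t) = bedges t')"

definition sym_group :: "bgraph \<Rightarrow> ((int \<Rightarrow> int) \<times> (int \<Rightarrow> int)) set" where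
  "sym_group t = {p. is_iso t t p}"

definition iso_rel :: "(bgraph \<times> bgraph) set" where
  "iso_rel = {(t, t'). t \<in> T_white \<and> t' \<in> T_white \<and> (\<exists>p. is_iso t t' p)}"


section \<open>The tree amplitude\<close>

text \<open>
  An enumeration of the edges at \<open>v\<close>. Its order is irrelevant, as the coefficients of \<open>S\<close> are
  symmetric and the partial derivatives of a smooth function commute.
\<close>

definition edge_list :: "bgraph \<Rightarrow> int \<Rightarrow> ((int \<times> int) \<times> nat) list" where
  "edge_list t v = (SOME es. distinct es \<and> set es = edges_at t v)"

definition amplitude ::
  "('d::finite list \<Rightarrow> real) \<Rightarrow> (real ^ 'd \<Rightarrow> real) \<Rightarrow> bgraph \<Rightarrow> real" where
  "amplitude S G t =
     (\<Sum>a\<in>edge_occs t \<rightarrow>\<^sub>E UNIV.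
        (\<Prod>v\<in>blacks t. fact (vdegree t v) * S (map a (edge_list t v))) *
        (\<Prod>w\<in>whites t. partial_derivs (map a (edge_list t w)) G (base_point S)))"

text \<open>The same with \<open>\<epsilon> G\<close> in place of \<open>G\<close>: every white vertex contributes one factor \<open>\<epsilon>\<close>.\<close>

definition amplitude_fps ::
  "('d::finite list \<Rightarrow> real) \<Rightarrow> (real ^ 'd \<Rightarrow> real) \<Rightarrow> bgraph \<Rightarrow> real fps" where
  "amplitude_fps S G t = fps_const (amplitude S G t) * fps_X ^ nwhite t"

end

theory Submission
  imports Defs
begin

text \<open>
  Write \<open>y = \<phi> + u\<close> and let \<open>\<sigma>\<close> be the family of tensors \<open>m! S^{a1 \<dots> am}\<close> with the linear one replaced
  by zero, \<open>\<delta>\<close> the family of derivatives of \<open>G\<close> at \<open>\<phi>\<close>. The linear part of \<open>S\<close> only moves the expansion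
  point to \<open>\<phi>\<close>, and a zero linear tensor gives weight zero to every tree with a black leaf. So the
  sum over \<open>T_white\<close> is the sum over all bipartite trees with vertex weights \<open>\<sigma>\<close> and \<open>\<delta>\<close>.

  The proof works with rooted trees that carry a multiset \<open>M\<close> of external legs at the root. Let \<open>A^M\<close>
  and \<open>B^M\<close> be the generating series in \<open>\<epsilon>\<close> of trees with a white and with a black root
  (\<open>white_series\<close>, \<open>black_series\<close>); the exponent of \<open>\<epsilon>\<close> counts the white vertices other than the
  root. Differentiating in \<open>\<epsilon>\<close> marks one such vertex \<open>v\<close>. The first edge on the path from the root to
  \<open>v\<close> cuts the tree into two rooted trees, in a unique way (\<open>tree_cut_unique\<close>), and the amplitude
  factorises up to the sum over the index \<open>\<alpha>\<close> of the cut edge (\<open>tree_sum_cut\<close>). Counting labels gives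
  \<open>(A^M)' = \<Sum>\<^sub>\<alpha> (B^\<alpha>)' A^{M+\<alpha>}\<close> and \<open>(B^M)' = \<Sum>\<^sub>\<alpha> (\<epsilon> A^\<alpha>)' B^{M+\<alpha>}\<close>.
  By the chain rule the Taylor series of the tensors \<open>\<delta>\<close> at \<open>u = B\<close>, and of \<open>\<sigma>\<close> at \<open>q = \<epsilon> A\<close>, satisfy the
  same equations with the same constant terms, and such equations determine all coefficients
  recursively (\<open>tensor_ode_unique\<close>). For a single leg the resulting identities say that
  \<open>q_\<alpha> = \<epsilon> A^\<alpha>\<close>, \<open>y^\<alpha> = \<phi>^\<alpha> + B^\<alpha>\<close> solves the system.

  Since \<open>R\<close> is stationary in \<open>q\<close> and \<open>y\<close>, its \<open>\<epsilon>\<close>-derivative is \<open>G(y)\<close>, which is \<open>A\<close> without legs. Hence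
  the coefficient of \<open>\<epsilon>^(m+1)\<close> in \<open>R\<close> is \<open>1/(m+1)\<close> times the sum over trees rooted at a fixed white vertex
  with \<open>m\<close> other white vertices, each tree weighted by \<open>1/(m! n!)\<close>: this is the sum over labelled trees with
  weight \<open>1/((m+1)! n!)\<close> (\<open>R_value_nth\<close>). The tree with one black vertex supplies the constant
  term. The second expansion follows from the first by the
  orbit-stabiliser theorem (\<open>card_iso_class\<close>).
\<close>

section \<open>Formal power series\<close>

text \<open>
  Congruence modulo \<open>\<epsilon>^(n+1)\<close>. It respects sums and products and turns statements
  on infinite sums into statements on finite ones.
\<close>

definition agree :: "nat \<Rightarrow> real fps \<Rightarrow> real fps \<Rightarrow> bool" where
  "agree n a b \<longleftrightarrow> (\<forall>k\<le>n. fps_nth a k = fps_nth b k)"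

lemma agree_refl [simp]: "agree n a a"
  by (simp add: agree_def)

lemma agree_mult: "agree n a b \<Longrightarrow> agree n c d \<Longrightarrow> agree n (a * c) (b * d)"
  by (auto simp: agree_def fps_mult_nth intro!: sum.cong)

lemma agree_sum: "(\<And>x. x \<in> A \<Longrightarrow> agree n (f x) (g x)) \<Longrightarrow> agree n (sum f A) (sum g A)"
  by (auto simp: agree_def fps_sum_nth intro!: sum.cong)

lemma agree_prod_list:
  "(\<And>x. agree n (p x) (q x)) \<Longrightarrow> agree n (prod_list (map p xs)) (prod_list (map q xs))"
  by (induction xs) (auto intro: agree_mult)

lemma fps_eqI_agree: "(\<And>n. agree n a b) \<Longrightarrow> a = b"
  by (auto simp: agree_def fps_eq_iff)

lemma dist_fps_less_of_agree:
  assumes "agree n a b"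
  shows "dist a b < inverse (2 ^ n)"
proof (cases "a = b")
  case False
  have "n < subdegree (a - b)"
    using False assms by (intro subdegree_greaterI) (auto simp: agree_def)
  then show ?thesis using False
    by (simp add: dist_fps_def field_simps)
qed simp

text \<open>
  If each coefficient receives finitely many nonzero contributions, the finitely many indices that
  contribute to the orders up to \<open>n\<close> bring every larger partial sum within \<open>2^(-n)\<close> of the limit.
\<close>

lemma fps_has_sumI:
  fixes f :: "'a \<Rightarrow> real fps"
  assumes fin: "\<And>n. finite {a \<in> A. fps_nth (f a) n \<noteq> 0}"
    and val: "\<And>n. fps_nth s n = (\<Sum>a | a \<in> A \<and> fps_nth (f a) n \<noteq> 0. fps_nth (f a) n)"
  shows "(f has_sum s) A"
  unfolding has_sum_def tendsto_iff
proof (intro allI impI)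
  fix e :: real assume "e > 0"
  then obtain n where n: "inverse (2 ^ n) < e"
    using reals_power_lt_ex[of e 2] by (auto simp: power_one_over inverse_eq_divide)
  define X0 where "X0 = (\<Union>k\<le>n. {a \<in> A. fps_nth (f a) k \<noteq> 0})"
  have "finite X0" "X0 \<subseteq> A" using fin by (auto simp: X0_def)
  then show "\<forall>\<^sub>F X in finite_subsets_at_top A. dist (sum f X) s < e"
    unfolding eventually_finite_subsets_at_top
  proof (intro exI[of _ X0] conjI allI impI)
    fix X assume X: "finite X \<and> X0 \<subseteq> X \<and> X \<subseteq> A"
    have "agree n (sum f X) s"
      unfolding agree_def
    proof (intro allI impI)
      fix k assume "k \<le> n"
      have "(\<Sum>a | a \<in> A \<and> fps_nth (f a) k \<noteq> 0. fps_nth (f a) k) = (\<Sum>a\<in>X. fps_nth (f a) k)"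
        using X \<open>k \<le> n\<close> by (intro sum.mono_neutral_left) (auto simp: X0_def)
      then show "fps_nth (sum f X) k = fps_nth s k"
        by (simp add: fps_sum_nth val)
    qed
    then show "dist (sum f X) s < e"
      using dist_fps_less_of_agree n by force
  qed auto
qed

lemma finite_short_lists: "finite {as :: 'd::finite list. length as \<le> N}"
  using finite_lists_length_le[of "UNIV :: 'd set" N] by simp

text \<open>
  A monomial of degree \<open>m\<close> in series without constant term has order at least \<open>m\<close> in \<open>\<epsilon>\<close>; its partial
  derivatives may lose one order. The slack \<open>c\<close> covers both cases.
\<close>

lemma agree_infsum_lists:
  fixes f :: "'d::finite list \<Rightarrow> real fps"
  assumes "\<And>n as. length as > n + c \<Longrightarrow> fps_nth (f as) n = 0" and "n + c \<le> N"
  shows "agree n (\<Sum>\<^sub>\<infinity>as. f as) (\<Sum>as | length as \<le> N. f as)"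
proof -
  define s where "s = Abs_fps (\<lambda>k. \<Sum>as | length as \<le> k + c. fps_nth (f as) k)"
  have restr: "(\<Sum>as | as \<in> UNIV \<and> fps_nth (f as) k \<noteq> 0. fps_nth (f as) k) =
      (\<Sum>as | length as \<le> M. fps_nth (f as) k)" if "k + c \<le> M" for k M
    using that assms(1)[of k] finite_short_lists[of M]
    by (intro sum.mono_neutral_left) (auto simp: not_less[symmetric])
  have "(f has_sum s) UNIV"
  proof (rule fps_has_sumI)
    fix k
    show "finite {a \<in> UNIV. fps_nth (f a) k \<noteq> 0}"
      by (rule finite_subset[OF _ finite_short_lists[of "k + c"]])
        (use assms(1)[of k] in \<open>auto simp: not_less[symmetric]\<close>)
    show "fps_nth s k = (\<Sum>as | as \<in> UNIV \<and> fps_nth (f as) k \<noteq> 0. fps_nth (f as) k)"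
      by (subst restr[of k "k + c"]) (auto simp: s_def)
  qed
  then have "(\<Sum>\<^sub>\<infinity>as. f as) = s" by (rule infsumI)
  moreover have "fps_nth s k = fps_nth (\<Sum>as | length as \<le> N. f as) k" if "k \<le> n" for k
    using restr[of k "k + c"] restr[of k N] that assms(2) by (simp add: s_def fps_sum_nth)
  ultimately show ?thesis by (simp add: agree_def)
qed

abbreviation monom_of :: "('d \<Rightarrow> real fps) \<Rightarrow> 'd list \<Rightarrow> real fps" where
  "monom_of q as \<equiv> prod_list (map q as)"

lemma monom_of_conv: "(\<Prod>i<length as. q (as ! i)) = monom_of q as"
  by (induction as) (simp_all add: prod.lessThan_Suc_shift del: prod.lessThan_Suc)

lemma monom_of_nth_eq_0:
  assumes "\<And>\<alpha>. fps_nth (q \<alpha>) 0 = 0" and "n < length as"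
  shows "fps_nth (monom_of q as) n = 0"
  using assms(2)
proof (induction as arbitrary: n)
  case (Cons a as)
  have "fps_nth (q a) i * fps_nth (monom_of q as) (n - i) = 0" if "i \<le> n" for i
    using that Cons assms(1)[of a] by (cases i) auto
  then show ?case by (auto simp: fps_mult_nth intro!: sum.neutral)
qed simp

abbreviation remove_at :: "nat \<Rightarrow> 'd list \<Rightarrow> 'd list" where
  "remove_at k as \<equiv> take k as @ drop (Suc k) as"

lemma monom_of_remove_at:
  "k < length as \<Longrightarrow> (\<Prod>i\<in>{..<length as} - {k}. q (as ! i)) = monom_of q (remove_at k as)"
proof (induction as arbitrary: k)
  case (Cons a as)
  have *: "{..<length (a # as)} - {Suc j} = insert 0 (Suc ` ({..<length as} - {j}))" for j
    by (auto simp: lessThan_Suc_eq_insert_0)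
  have **: "{..<length (a # as)} - {0} = Suc ` {..<length as}"
    by (auto simp: lessThan_Suc_eq_insert_0)
  show ?case
  proof (cases k)
    case 0
    show ?thesis unfolding 0 ** by (subst prod.reindex) (auto simp: monom_of_conv)
  next
    case (Suc j)
    then show ?thesis using Cons unfolding Suc *
      by (subst prod.insert) (auto simp: prod.reindex)
  qed
qed simp

lemma fps_deriv_monom_of:
  "fps_deriv (monom_of q as) =
     (\<Sum>k<length as. fps_deriv (q (as ! k)) * monom_of q (remove_at k as))"
proof (induction as)
  case (Cons a as)
  have "fps_deriv (monom_of q (a # as)) = q a * fps_deriv (monom_of q as) + fps_deriv (q a) * monom_of q as"
    by simp
  also have "\<dots> = (\<Sum>k<length (a # as). fps_deriv (q ((a # as) ! k)) * monom_of q (remove_at k (a # as)))"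
    unfolding Cons by (simp add: sum.lessThan_Suc_shift sum_distrib_left mult_ac del: sum.lessThan_Suc)
  finally show ?case .
qed simp

abbreviation monom_deriv :: "'d \<Rightarrow> ('d \<Rightarrow> real fps) \<Rightarrow> 'd list \<Rightarrow> real fps" where
  "monom_deriv \<alpha> q as \<equiv> (\<Sum>k | k < length as \<and> as ! k = \<alpha>. monom_of q (remove_at k as))"

lemma fps_deriv_monom_of_grad:
  fixes q :: "'d::finite \<Rightarrow> real fps"
  shows "fps_deriv (monom_of q as) = (\<Sum>\<alpha>\<in>UNIV. fps_deriv (q \<alpha>) * monom_deriv \<alpha> q as)"
proof -
  have "fps_deriv (monom_of q as) = (\<Sum>\<alpha>\<in>UNIV. \<Sum>k | k \<in> {..<length as} \<and> as ! k = \<alpha>.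
      fps_deriv (q (as ! k)) * monom_of q (remove_at k as))"
    unfolding fps_deriv_monom_of by (rule sum.group[symmetric]) auto
  also have "\<dots> = (\<Sum>\<alpha>\<in>UNIV. fps_deriv (q \<alpha>) * monom_deriv \<alpha> q as)"
    by (auto simp: sum_distrib_left intro!: sum.cong)
  finally show ?thesis .
qed

lemma monom_deriv_nth_eq_0:
  assumes "\<And>\<alpha>. fps_nth (q \<alpha>) 0 = 0" and "n + 1 < length as"
  shows "fps_nth (monom_deriv \<alpha> q as) n = 0"
  unfolding fps_sum_nth
proof (rule sum.neutral, rule ballI)
  fix k assume "k \<in> {k. k < length as \<and> as ! k = \<alpha>}"
  then show "fps_nth (monom_of q (remove_at k as)) n = 0"
    using assms by (intro monom_of_nth_eq_0) auto
qed

lemma eval_series_agree: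
  fixes q :: "'d::finite \<Rightarrow> real fps"
  assumes "\<And>\<alpha>. fps_nth (q \<alpha>) 0 = 0" and "n \<le> N"
  shows "agree n (eval_series S q) (\<Sum>as | length as \<le> N. fps_const (S as) * monom_of q as)"
  unfolding eval_series_def monom_of_conv
  using assms by (intro agree_infsum_lists[where c = 0]) (auto simp: monom_of_nth_eq_0)

lemma eval_series_deriv_agree:
  fixes q :: "'d::finite \<Rightarrow> real fps"
  assumes "\<And>\<alpha>. fps_nth (q \<alpha>) 0 = 0" and "n + 1 \<le> N"
  shows "agree n (eval_series_deriv \<alpha> S q)
           (\<Sum>as | length as \<le> N. fps_const (S as) * monom_deriv \<alpha> q as)"
proof -
  have eq: "(\<Sum>k | k < length as \<and> as ! k = \<alpha>. \<Prod>i\<in>{..<length as} - {k}. q (as ! i)) =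
      monom_deriv \<alpha> q as" for as
    by (intro sum.cong refl monom_of_remove_at) simp
  show ?thesis unfolding eval_series_deriv_def eq
    using assms(2) monom_deriv_nth_eq_0[of q, OF assms(1)]
    by (intro agree_infsum_lists[where c = 1])
      (auto simp del: map_append prod_list.append)
qed

lemma eval_series_nth_0:
  fixes q :: "'d::finite \<Rightarrow> real fps"
  assumes "\<And>\<alpha>. fps_nth (q \<alpha>) 0 = 0"
  shows "fps_nth (eval_series S q) 0 = S []"
  using eval_series_agree[of q 0 0 S, OF assms] by (simp add: agree_def)

lemma eval_series_cong_agree:
  fixes q :: "'d::finite \<Rightarrow> real fps"
  assumes "\<And>\<alpha>. fps_nth (q \<alpha>) 0 = 0" "\<And>\<alpha>. fps_nth (p \<alpha>) 0 = 0" "\<And>\<alpha>. agree n (p \<alpha>) (q \<alpha>)"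
  shows "agree n (eval_series S p) (eval_series S q)"
proof -
  have "agree n (\<Sum>as | length as \<le> n. fps_const (S as) * monom_of p as)
     (\<Sum>as | length as \<le> n. fps_const (S as) * monom_of q as)"
    by (intro agree_sum agree_mult agree_prod_list assms) simp
  then show ?thesis
    using eval_series_agree[of q n n S, OF assms(1)] eval_series_agree[of p n n S, OF assms(2)]
    by (simp add: agree_def)
qed

text \<open>
  The partial derivatives of \<open>S\<close> are defined monomial by monomial, so the product rule for one
  monomial gives the rule for every truncation of \<open>S\<close>. Since differentiation in \<open>\<epsilon>\<close> costs one order,
  the truncation at degree \<open>n + 1\<close> is exact modulo \<open>\<epsilon>^(n+1)\<close>.
\<close>

theorem eval_series_chain_rule:
  fixes q :: "'d::finite \<Rightarrow> real fps"
  assumes "\<And>\<alpha>. fps_nth (q \<alpha>) 0 = 0"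
  shows "fps_deriv (eval_series S q) = (\<Sum>\<alpha>\<in>UNIV. fps_deriv (q \<alpha>) * eval_series_deriv \<alpha> S q)"
proof (rule fps_eqI_agree)
  fix n
  let ?L = "{as :: 'd list. length as \<le> Suc n}"
  have "agree (Suc n) (eval_series S q) (\<Sum>as\<in>?L. fps_const (S as) * monom_of q as)"
    by (rule eval_series_agree) (use assms in auto)
  then have 1: "agree n (fps_deriv (eval_series S q))
      (fps_deriv (\<Sum>as\<in>?L. fps_const (S as) * monom_of q as))"
    by (simp add: agree_def)
  have 2: "fps_deriv (\<Sum>as\<in>?L. fps_const (S as) * monom_of q as) =
     (\<Sum>\<alpha>\<in>UNIV. fps_deriv (q \<alpha>) * (\<Sum>as\<in>?L. fps_const (S as) * monom_deriv \<alpha> q as))"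
  proof -
    have "fps_deriv (\<Sum>as\<in>?L. fps_const (S as) * monom_of q as) =
      (\<Sum>as\<in>?L. \<Sum>\<alpha>\<in>UNIV. fps_const (S as) * (fps_deriv (q \<alpha>) * monom_deriv \<alpha> q as))"
      by (simp add: fps_deriv_sum fps_deriv_monom_of_grad sum_distrib_left)
    also have "\<dots> = (\<Sum>\<alpha>\<in>UNIV. \<Sum>as\<in>?L. fps_const (S as) * (fps_deriv (q \<alpha>) * monom_deriv \<alpha> q as))"
      by (rule sum.swap)
    also have "\<dots> = (\<Sum>\<alpha>\<in>UNIV. fps_deriv (q \<alpha>) * (\<Sum>as\<in>?L. fps_const (S as) * monom_deriv \<alpha> q as))"
      by (intro sum.cong refl) (simp only: sum_distrib_left mult_ac)
    finally show ?thesis .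
  qed
  have 3: "agree n (\<Sum>\<alpha>\<in>UNIV. fps_deriv (q \<alpha>) * eval_series_deriv \<alpha> S q)
     (\<Sum>\<alpha>\<in>UNIV. fps_deriv (q \<alpha>) * (\<Sum>as\<in>?L. fps_const (S as) * monom_deriv \<alpha> q as))"
    by (intro agree_sum agree_mult agree_refl eval_series_deriv_agree) (use assms in auto)
  show "agree n (fps_deriv (eval_series S q)) (\<Sum>\<alpha>\<in>UNIV. fps_deriv (q \<alpha>) * eval_series_deriv \<alpha> S q)"
    using 1 2 3 by (simp add: agree_def)
qed

text \<open>
  Deleting the entry \<open>\<alpha>\<close> at position \<open>k\<close> is inverse to inserting \<open>\<alpha>\<close> at position \<open>k\<close>. By symmetry the
  coefficient does not depend on the position, and a tuple of length \<open>n\<close> has \<open>n + 1\<close> positions for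
  the insertion.
\<close>

lemma eval_series_deriv_symmetric:
  fixes q :: "'d::finite \<Rightarrow> real fps"
  assumes S: "symmetric_coeffs S" and q: "\<And>\<alpha>. fps_nth (q \<alpha>) 0 = 0"
  shows "eval_series_deriv \<alpha> S q = eval_series (\<lambda>as. real (Suc (length as)) * S (\<alpha> # as)) q"
proof (rule fps_eqI_agree)
  fix n
  let ?ins = "\<lambda>(bs, k). (take k bs @ \<alpha> # drop k bs, k)"
  let ?I = "SIGMA as:{as. length as \<le> Suc n}. {k. k < length as \<and> as ! k = \<alpha>}"
  let ?J = "SIGMA bs:{bs :: 'd list. length bs \<le> n}. {..length bs}"
  have "(\<Sum>as | length as \<le> Suc n. fps_const (S as) * monom_deriv \<alpha> q as) =
      (\<Sum>(as, k)\<in>?I. fps_const (S as) * monom_of q (remove_at k as))"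
    by (subst sum.Sigma[symmetric]) (auto simp: finite_short_lists sum_distrib_left)
  also have "\<dots> = (\<Sum>(bs, k)\<in>?J. fps_const (S (\<alpha> # bs)) * monom_of q bs)"
  proof (rule sum.reindex_bij_witness[where i = ?ins and j = "\<lambda>(as, k). (remove_at k as, k)"])
    fix x assume "x \<in> ?I"
    then obtain as k where x: "x = (as, k)" "length as \<le> Suc n" "k < length as" "as ! k = \<alpha>"
      by auto
    then show "?ins ((\<lambda>(as, k). (remove_at k as, k)) x) = x"
      using id_take_nth_drop[of k as] by (simp add: min_def)
    show "(\<lambda>(as, k). (remove_at k as, k)) x \<in> ?J" using x by auto
    have "mset as = mset (take k as @ as ! k # drop (Suc k) as)"
      using x by (subst id_take_nth_drop[of k as]) auto
    then have "S (\<alpha> # remove_at k as) = S as"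
      using S x by (auto simp: symmetric_coeffs_def)
    then show "(case (\<lambda>(as, k). (remove_at k as, k)) x of (bs, k) \<Rightarrow> fps_const (S (\<alpha> # bs)) * monom_of q bs) =
        (case x of (as, k) \<Rightarrow> fps_const (S as) * monom_of q (remove_at k as))"
      by (simp add: x)
  next
    fix y assume "y \<in> ?J"
    then show "(\<lambda>(as, k). (remove_at k as, k)) (?ins y) = y" "?ins y \<in> ?I"
      by (auto simp: min_def nth_append)
  qed
  also have "\<dots> = (\<Sum>bs | length bs \<le> n. fps_const (real (Suc (length bs)) * S (\<alpha> # bs)) * monom_of q bs)"
    by (subst sum.Sigma[symmetric])
      (auto simp: finite_short_lists fps_of_nat fps_const_mult[symmetric] mult_ac 
        simp del: fps_const_mult of_nat_Suc intro!: sum.cong)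
  finally show "agree n (eval_series_deriv \<alpha> S q) (eval_series (\<lambda>as. real (Suc (length as)) * S (\<alpha> # as)) q)"
    using eval_series_deriv_agree[of q n "Suc n" \<alpha> S, OF q]
      eval_series_agree[of q n n "\<lambda>as. real (Suc (length as)) * S (\<alpha> # as)", OF q]
    by (simp add: agree_def)
qed

section \<open>Commuting partial derivatives\<close>

lemma smooth_partial_deriv:
  assumes "smooth f"
  shows "((\<lambda>t. partial_derivs as f (x + t *\<^sub>R axis \<alpha> 1)) has_real_derivative
     partial_derivs (\<alpha> # as) f (x + t *\<^sub>R axis \<alpha> 1)) (at t)"
proof -
  let ?g = "partial_derivs as f"
  let ?h = "\<lambda>z s. ?g (z + s *\<^sub>R axis \<alpha> 1)"
  have d: "(?h z) differentiable (at s)" for z s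
  proof -
    have "?g differentiable (at (z + s *\<^sub>R axis \<alpha> 1))"
      using assms by (simp add: smooth_def)
    then have "(?g \<circ> (\<lambda>s. z + s *\<^sub>R axis \<alpha> 1)) differentiable (at s)"
      by (intro differentiable_chain_at) auto
    then show ?thesis by (simp add: o_def)
  qed
  have "DERIV (?h z) s :> deriv (?h z) s" for z s
    using d[of z s] by (simp add: DERIV_deriv_iff_real_differentiable)
  from this[of "x + t *\<^sub>R axis \<alpha> 1" 0]
  have "(?h (x + t *\<^sub>R axis \<alpha> 1) has_real_derivative partial_derivs (\<alpha> # as) f (x + t *\<^sub>R axis \<alpha> 1)) (at 0)"
    by (simp add: partial_deriv_def)
  then have "((\<lambda>s. ?h x (s + t)) has_real_derivative partial_derivs (\<alpha> # as) f (x + t *\<^sub>R axis \<alpha> 1)) (at 0)"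
    by (simp add: algebra_simps scaleR_add_left)
  then show ?thesis
    using DERIV_shift[of "?h x" _ 0 t] by simp
qed

text \<open>
  The mean value theorem in direction \<open>\<alpha>\<close> for the difference in direction \<open>\<beta>\<close>, then in direction \<open>\<beta>\<close>. The
  left side of the equation is symmetric in the two directions.
\<close>

lemma smooth_second_difference:
  fixes f :: "real ^ 'd::finite \<Rightarrow> real" and \<alpha> \<beta> :: 'd
  assumes "smooth f" "h > 0"
  defines "a \<equiv> axis \<alpha> (1::real)" and "b \<equiv> axis \<beta> (1::real)"
  obtains s t where "0 < s" "s < h" "0 < t" "t < h"
    "partial_derivs as f (x + h *\<^sub>R a + h *\<^sub>R b) - partial_derivs as f (x + h *\<^sub>R a)
      - partial_derivs as f (x + h *\<^sub>R b) + partial_derivs as f x =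
     h * h * partial_derivs (\<beta> # \<alpha> # as) f (x + s *\<^sub>R a + t *\<^sub>R b)"
proof -
  let ?g = "partial_derivs as f" and ?g1 = "partial_derivs (\<alpha> # as) f"
  define k where "k = (\<lambda>s. ?g (x + h *\<^sub>R b + s *\<^sub>R a) - ?g (x + s *\<^sub>R a))"
  have "DERIV k s :> ?g1 (x + h *\<^sub>R b + s *\<^sub>R a) - ?g1 (x + s *\<^sub>R a)" for s
    unfolding k_def a_def by (intro DERIV_diff smooth_partial_deriv assms)
  from MVT2[OF \<open>h > 0\<close> this] obtain s where s: "0 < s" "s < h"
    "k h - k 0 = h * (?g1 (x + h *\<^sub>R b + s *\<^sub>R a) - ?g1 (x + s *\<^sub>R a))" by auto
  have "DERIV (\<lambda>t. ?g1 (x + s *\<^sub>R a + t *\<^sub>R b)) t :>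
      partial_derivs (\<beta> # \<alpha> # as) f (x + s *\<^sub>R a + t *\<^sub>R b)" for t
    unfolding b_def by (rule smooth_partial_deriv[OF assms(1)])
  from MVT2[OF \<open>h > 0\<close> this] obtain t where t: "0 < t" "t < h"
    "?g1 (x + s *\<^sub>R a + h *\<^sub>R b) - ?g1 (x + s *\<^sub>R a) =
      h * partial_derivs (\<beta> # \<alpha> # as) f (x + s *\<^sub>R a + t *\<^sub>R b)"
    by auto
  show ?thesis
    by (rule that[OF s(1,2) t(1,2)]) (use s(3) t(3) in \<open>simp add: k_def algebra_simps\<close>)
qed

text \<open>
  Both mixed partial derivatives, each evaluated at some point at distance less than \<open>2 h\<close> from \<open>x\<close>,
  are the second difference divided by \<open>h * h\<close>. They are continuous, because all partial derivatives
  are differentiable, so they agree at \<open>x\<close>.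
\<close>

theorem smooth_partial_derivs_swap:
  fixes f :: "real ^ 'd::finite \<Rightarrow> real"
  assumes f: "smooth f"
  shows "partial_derivs (\<alpha> # \<beta> # as) f x = partial_derivs (\<beta> # \<alpha> # as) f x"
proof (rule ccontr)
  let ?p = "partial_derivs (\<alpha> # \<beta> # as) f" and ?q = "partial_derivs (\<beta> # \<alpha> # as) f"
  assume ne: "?p x \<noteq> ?q x"
  define e where "e = dist (?p x) (?q x) / 2"
  have "e > 0" using ne by (simp add: e_def)
  have cont: "isCont (partial_derivs bs f) x" for bs
    using f by (auto simp: smooth_def intro!: differentiable_imp_continuous_within)
  obtain d1 where d1: "d1 > 0" "\<And>z. dist z x < d1 \<Longrightarrow> dist (?p z) (?p x) < e"
    using cont[of "\<alpha> # \<beta> # as"] \<open>e > 0\<close> unfolding continuous_at_eps_delta by blast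
  obtain d2 where d2: "d2 > 0" "\<And>z. dist z x < d2 \<Longrightarrow> dist (?q z) (?q x) < e"
    using cont[of "\<beta> # \<alpha> # as"] \<open>e > 0\<close> unfolding continuous_at_eps_delta by blast
  \<comment> \<open>the points supplied by the second difference lie within \<open>2 * h\<close> of \<open>x\<close>, in both balls\<close>
  define h where "h = min d1 d2 / 2"
  have h: "h > 0" "2 * h \<le> d1" "2 * h \<le> d2" using d1 d2 by (auto simp: h_def)
  have near: "dist (x + s *\<^sub>R axis \<gamma> 1 + t *\<^sub>R axis \<delta> 1) x < 2 * h"
    if "0 < s" "s < h" "0 < t" "t < h" for s t and \<gamma> \<delta> :: 'd
  proof -
    have "dist (x + s *\<^sub>R axis \<gamma> 1 + t *\<^sub>R axis \<delta> 1) x = norm (s *\<^sub>R axis \<gamma> (1::real) + t *\<^sub>R axis \<delta> 1)"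
      by (simp add: dist_norm)
    also have "\<dots> \<le> s + t"
      using norm_triangle_ineq[of "s *\<^sub>R axis \<gamma> (1::real)" "t *\<^sub>R axis \<delta> 1"] that by (simp add: norm_axis_1)
    finally show ?thesis using that by simp
  qed
  obtain s t where st: "0 < s" "s < h" "0 < t" "t < h"
    "partial_derivs as f (x + h *\<^sub>R axis \<alpha> 1 + h *\<^sub>R axis \<beta> 1) - partial_derivs as f (x + h *\<^sub>R axis \<alpha> 1)
      - partial_derivs as f (x + h *\<^sub>R axis \<beta> 1) + partial_derivs as f x =
     h * h * ?q (x + s *\<^sub>R axis \<alpha> 1 + t *\<^sub>R axis \<beta> 1)"
    using smooth_second_difference[OF f h(1)] by metis
  obtain s' t' where st': "0 < s'" "s' < h" "0 < t'" "t' < h"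
    "partial_derivs as f (x + h *\<^sub>R axis \<beta> 1 + h *\<^sub>R axis \<alpha> 1) - partial_derivs as f (x + h *\<^sub>R axis \<beta> 1)
      - partial_derivs as f (x + h *\<^sub>R axis \<alpha> 1) + partial_derivs as f x =
     h * h * ?p (x + s' *\<^sub>R axis \<beta> 1 + t' *\<^sub>R axis \<alpha> 1)"
    using smooth_second_difference[OF f h(1)] by metis
  have comm: "x + h *\<^sub>R axis \<beta> 1 + h *\<^sub>R axis \<alpha> 1 = x + h *\<^sub>R axis \<alpha> 1 + h *\<^sub>R axis \<beta> 1"
    by (simp add: add_ac)
  have "h * h * ?q (x + s *\<^sub>R axis \<alpha> 1 + t *\<^sub>R axis \<beta> 1) =
      h * h * ?p (x + s' *\<^sub>R axis \<beta> 1 + t' *\<^sub>R axis \<alpha> 1)"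
    using st(5) st'(5)[unfolded comm] by linarith
  then have eq: "?q (x + s *\<^sub>R axis \<alpha> 1 + t *\<^sub>R axis \<beta> 1) = ?p (x + s' *\<^sub>R axis \<beta> 1 + t' *\<^sub>R axis \<alpha> 1)"
    using h(1) by simp
  have "dist (?q (x + s *\<^sub>R axis \<alpha> 1 + t *\<^sub>R axis \<beta> 1)) (?q x) < e"
    using near[OF st(1-4), of \<alpha> \<beta>] h by (intro d2) auto
  moreover have "dist (?p (x + s' *\<^sub>R axis \<beta> 1 + t' *\<^sub>R axis \<alpha> 1)) (?p x) < e"
    using near[OF st'(1-4), of \<beta> \<alpha>] h by (intro d1) auto
  ultimately have "dist (?p x) (?q x) < 2 * e"
    using eq dist_triangle3[of "?p x" "?q x" "?q (x + s *\<^sub>R axis \<alpha> 1 + t *\<^sub>R axis \<beta> 1)"] by simp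
  then show False by (simp add: e_def)
qed

lemma smooth_partial_derivs_insert:
  assumes "smooth f"
  shows "partial_derivs (xs @ \<alpha> # ys) f x = partial_derivs (\<alpha> # xs @ ys) f x"
proof (induction xs arbitrary: x)
  case (Cons b xs)
  have "partial_derivs ((b # xs) @ \<alpha> # ys) f x = partial_deriv b (partial_derivs (\<alpha> # xs @ ys) f) x"
    using Cons by (simp add: partial_deriv_def)
  then show ?case
    using smooth_partial_derivs_swap[OF assms, of b \<alpha> "xs @ ys" x] by simp
qed simp

corollary smooth_partial_derivs_mset:
  assumes "smooth f" "mset as = mset bs"
  shows "partial_derivs as f x = partial_derivs bs f x"
  using assms(2)
proof (induction as arbitrary: bs x)
  case (Cons a as)
  then have "a \<in> set bs" by (metis list.set_intros(1) set_mset_mset)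
  then obtain xs ys where bs: "bs = xs @ a # ys" by (meson split_list)
  then have "mset as = mset (xs @ ys)" using Cons.prems by simp
  with Cons.IH have "partial_derivs as f = partial_derivs (xs @ ys) f" by blast
  then show ?case
    using smooth_partial_derivs_insert[OF assms(1), of xs a ys x] by (simp add: bs)
qed simp

section \<open>Bipartite trees\<close>

text \<open>
  Black vertices are positive and white vertices negative, and an edge is the pair of its black and
  its white end. Building trees by joining two trees with an edge, instead of attaching
  leaves, makes the construction the inverse of cutting a tree at an arbitrary edge.
\<close>

inductive tree :: "int set \<Rightarrow> (int \<times> int) set \<Rightarrow> bool" where
  single: "tree {v} {}"
| join: "tree V1 E1 \<Longrightarrow> tree V2 E2 \<Longrightarrow> V1 \<inter> V2 = {} \<Longrightarrow> b \<in> V1 \<Longrightarrow> w \<in> V2 \<Longrightarrow> b > 0 \<Longrightarrow> w < 0 \<Longrightarrow>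
    tree (V1 \<union> V2) (insert (b, w) (E1 \<union> E2))"

text \<open>
  The edge between \<open>u\<close> and \<open>v\<close> when exactly one of them is black: the larger number is the black end.
\<close>

definition link :: "int \<Rightarrow> int \<Rightarrow> int \<times> int" where
  "link u v = (max u v, min u v)"

lemma link_commute: "link u v = link v u"
  by (simp add: link_def max.commute min.commute)

lemma link_inject: "u * v < 0 \<Longrightarrow> u * v' < 0 \<Longrightarrow> link u v = link u v' \<longleftrightarrow> v = v'"
  by (auto simp: link_def mult_less_0_iff max_def min_def split: if_splits)

lemma tree_join:
  assumes "tree V1 E1" "tree V2 E2" "V1 \<inter> V2 = {}" "u \<in> V1" "v \<in> V2" "u * v < 0"
  shows "tree (V1 \<union> V2) (insert (link u v) (E1 \<union> E2))"
proof (cases "u > 0")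
  case True
  then have "v < 0" using assms by (simp add: mult_less_0_iff)
  then show ?thesis using True join[OF assms(1-5)] by (simp add: link_def max_def min_def)
next
  case False
  then have "u < 0" "v > 0" using assms by (auto simp: mult_less_0_iff)
  moreover have "V2 \<inter> V1 = {}" using assms by blast
  ultimately show ?thesis using join[OF assms(2,1) _ assms(5,4)]
    by (simp add: link_def max_def min_def Un_commute)
qed

lemma tree_finite: "tree V E \<Longrightarrow> finite V \<and> finite E"
  by (induction rule: tree.induct) auto

lemma tree_nonempty: "tree V E \<Longrightarrow> V \<noteq> {}"
  by (induction rule: tree.induct) auto

lemma tree_edges: "tree V E \<Longrightarrow> e \<in> E \<Longrightarrow> fst e \<in> V \<and> snd e \<in> V \<and> fst e > 0 \<and> snd e < 0"
  by (induction rule: tree.induct) auto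

lemma tree_edges': "tree V E \<Longrightarrow> (b, w) \<in> E \<Longrightarrow> b \<in> V \<and> w \<in> V \<and> b > 0 \<and> w < 0"
  using tree_edges[of V E "(b, w)"] by simp

lemma tree_card: "tree V E \<Longrightarrow> card E + 1 = card V"
proof (induction rule: tree.induct)
  case (join V1 E1 V2 E2 b w)
  have "E1 \<inter> E2 = {}" "(b, w) \<notin> E1 \<union> E2"
    using join.hyps(3-5) tree_edges[OF join(1)] tree_edges[OF join(2)] by fastforce+
  then show ?case
    using join tree_finite[OF join(1)] tree_finite[OF join(2)] by (simp add: card_Un_disjoint)
qed simp

lemma tree_incident: "tree V E \<Longrightarrow> v \<in> V \<Longrightarrow> V = {v} \<or> (\<exists>e\<in>E. fst e = v \<or> snd e = v)"
proof (induction arbitrary: v rule: tree.induct)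
  case (join V1 E1 V2 E2 b w)
  then have "(v = b \<or> (\<exists>e\<in>E1. fst e = v \<or> snd e = v)) \<or> (v = w \<or> (\<exists>e\<in>E2. fst e = v \<or> snd e = v))"
    by blast
  then show ?case by auto
qed simp

text \<open>
  Acyclicity in the form of an edge count, which passes through the join of two trees without any
  argument on paths: the joining edge lies inside \<open>X\<close> only if \<open>X\<close> meets both parts. A cycle
  would span as many edges as vertices.
\<close>

lemma tree_span:
  assumes "tree V E" "X \<noteq> {}" "X \<subseteq> V"
  shows "card {e \<in> E. fst e \<in> X \<and> snd e \<in> X} < card X"
  using assms
proof (induction arbitrary: X rule: tree.induct)
  case (single v)
  then show ?case using finite_subset[OF single(2)] by (simp add: card_gt_0_iff)
next
  case (join V1 E1 V2 E2 b w)
  let ?s = "\<lambda>E X. {e \<in> E. fst e \<in> X \<and> snd e \<in> X}"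
  let ?X1 = "X \<inter> V1" and ?X2 = "X \<inter> V2"
  have fin: "finite V1" "finite V2" "finite E1" "finite E2"
    using tree_finite join(1,2) by auto
  have X: "card X = card ?X1 + card ?X2"
    using join fin by (subst card_Un_disjoint[symmetric]) (auto intro: arg_cong[where f = card])
  have sub: "?s (E1 \<union> E2) X \<subseteq> ?s E1 ?X1 \<union> ?s E2 ?X2"
    using tree_edges[OF join(1)] tree_edges[OF join(2)] by auto
  have le: "card (?s (E1 \<union> E2) X) \<le> card (?s E1 ?X1) + card (?s E2 ?X2)"
    using card_mono[OF _ sub] card_Un_le[of "?s E1 ?X1" "?s E2 ?X2"] fin by simp
  have ins: "card (?s (insert (b, w) (E1 \<union> E2)) X) \<le> card (?s (E1 \<union> E2) X) + 1"
  proof -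
    have "card (?s (insert (b, w) (E1 \<union> E2)) X) \<le> card (insert (b, w) (?s (E1 \<union> E2) X))"
      using fin by (intro card_mono) auto
    also have "\<dots> \<le> card (?s (E1 \<union> E2) X) + 1"
      using fin by (simp add: card_insert_if)
    finally show ?thesis .
  qed
  have e: "card (?s F {}) = 0" for F :: "(int \<times> int) set" by simp
  consider "?X1 \<noteq> {}" "?X2 \<noteq> {}" | "?X1 = {}" "?X2 \<noteq> {}" | "?X1 \<noteq> {}" "?X2 = {}"
    using join.prems by blast
  then show ?case
  proof cases
    case 1
    with join.IH(1)[of ?X1] join.IH(2)[of ?X2] X le ins show ?thesis by simp
  next
    case 2
    then have "b \<notin> X" using join by auto
    then have "?s (insert (b, w) (E1 \<union> E2)) X = ?s (E1 \<union> E2) X" by auto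
    with 2 join.IH(2)[of ?X2] X le show ?thesis by simp
  next
    case 3
    then have "w \<notin> X" using join by auto
    then have "?s (insert (b, w) (E1 \<union> E2)) X = ?s (E1 \<union> E2) X" by auto
    with 3 join.IH(1)[of ?X1] X le show ?thesis by simp
  qed
qed

abbreviation adj :: "(int \<times> int) set \<Rightarrow> (int \<times> int) set" where
  "adj E \<equiv> {(x, y). \<exists>e\<in>E. joins e x y}"

lemma joins_commute: "joins e x y \<longleftrightarrow> joins e y x"
  by (auto simp: joins_def)

lemma adj_rtrancl_sym: "(x, y) \<in> (adj E)\<^sup>* \<Longrightarrow> (y, x) \<in> (adj E)\<^sup>*"
  by (rule symD[OF sym_rtrancl]) (auto simp: sym_def joins_commute)

lemma adj_rtrancl_mono: "E \<subseteq> F \<Longrightarrow> (x, y) \<in> (adj E)\<^sup>* \<Longrightarrow> (x, y) \<in> (adj F)\<^sup>*"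
  by (rule subsetD[OF rtrancl_mono]) auto

lemma tree_connected: "tree V E \<Longrightarrow> u \<in> V \<Longrightarrow> v \<in> V \<Longrightarrow> (u, v) \<in> (adj E)\<^sup>*"
proof (induction arbitrary: u v rule: tree.induct)
  case (join V1 E1 V2 E2 b w)
  let ?R = "(adj (insert (b, w) (E1 \<union> E2)))\<^sup>*"
  have 1: "(u, v) \<in> ?R" if "u \<in> V1" "v \<in> V1" for u v
    using join.IH(1)[OF that] by (rule adj_rtrancl_mono[rotated]) auto
  have 2: "(u, v) \<in> ?R" if "u \<in> V2" "v \<in> V2" for u v
    using join.IH(2)[OF that] by (rule adj_rtrancl_mono[rotated]) auto
  have bw: "(b, w) \<in> ?R"
    by (rule r_into_rtrancl) (auto simp: joins_def)
  have 3: "(u, v) \<in> ?R" if "u \<in> V1" "v \<in> V2" for u v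
    using 1[OF that(1) join(4)] bw 2[OF join(5) that(2)] by (meson rtrancl_trans)
  show ?case using 1 2 3 adj_rtrancl_sym[OF 3] join.prems by blast
qed simp

text \<open>
  The edge between \<open>r\<close> and \<open>c\<close> is the first one on the path from \<open>r\<close> to \<open>v\<close>, and \<open>U\<close> is the part
  of the tree behind it.
\<close>

definition tree_cut ::
  "int set \<Rightarrow> (int \<times> int) set \<Rightarrow> int \<Rightarrow> int \<Rightarrow> int set \<Rightarrow> int \<Rightarrow> (int \<times> int) set \<Rightarrow> (int \<times> int) set \<Rightarrow> bool" where
  "tree_cut V E r v U c E1 E2 \<longleftrightarrow> U \<subseteq> V - {r} \<and> v \<in> U \<and> c \<in> U \<and> r * c < 0 \<and>
     tree U E1 \<and> tree (V - U) E2 \<and> E = insert (link r c) (E1 \<union> E2)"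

text \<open>
  The separating edge is either the joining edge, namely when \<open>r\<close> is its end and \<open>v\<close> lies in the other
  part, or an edge of \<open>V1\<close> that separates \<open>r\<close> from \<open>v\<close> or, for \<open>v\<close> in \<open>V2\<close>, from \<open>a\<close>.
\<close>

lemma tree_cut_step:
  assumes t: "tree V1 E1" "tree V2 E2" "V1 \<inter> V2 = {}" "a \<in> V1" "b \<in> V2" "a * b < 0"
    and IH: "\<And>v. v \<in> V1 \<Longrightarrow> v \<noteq> r \<Longrightarrow> \<exists>U c F1 F2. tree_cut V1 E1 r v U c F1 F2"
    and rv: "r \<in> V1" "v \<in> V1 \<union> V2" "v \<noteq> r"
  shows "\<exists>U c F1 F2. tree_cut (V1 \<union> V2) (insert (link a b) (E1 \<union> E2)) r v U c F1 F2"
proof -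
  let ?V = "V1 \<union> V2" and ?E = "insert (link a b) (E1 \<union> E2)"
  \<comment> \<open>If \<open>a\<close> falls into the part of \<open>V1\<close> that is cut off, all of \<open>V2\<close> goes with it.\<close>
  have with_V2: "tree_cut ?V ?E r v (U \<union> V2) c (insert (link a b) (F1 \<union> E2)) F2"
    if "tree_cut V1 E1 r v' U c F1 F2" "a \<in> U" "v \<in> U \<union> V2" for v' U c F1 F2
  proof -
    have "tree (U \<union> V2) (insert (link a b) (F1 \<union> E2))"
      using that t by (intro tree_join) (auto simp: tree_cut_def)
    moreover have "?V - (U \<union> V2) = V1 - U" using t by blast
    ultimately show ?thesis using that t rv by (auto simp: tree_cut_def)
  qed
  show ?thesis
  proof (cases "v \<in> V2")
    case True
    show ?thesis
    proof (cases "r = a")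
      case True
      have "?V - V2 = V1" using t by blast
      then have "tree_cut ?V ?E r v V2 b E2 E1"
        using t rv True \<open>v \<in> V2\<close> by (auto simp: tree_cut_def)
      then show ?thesis by blast
    next
      case False
      then obtain U c F1 F2 where cut: "tree_cut V1 E1 r a U c F1 F2"
        using IH[of a] t by blast
      then have "a \<in> U" by (simp add: tree_cut_def)
      then show ?thesis using with_V2[OF cut] True by blast
    qed
  next
    case False
    then obtain U c F1 F2 where cut: "tree_cut V1 E1 r v U c F1 F2"
      using IH[of v] rv False by auto
    then have "v \<in> U" by (simp add: tree_cut_def)
    show ?thesis
    proof (cases "a \<in> U")
      case True
      then show ?thesis using with_V2[OF cut True] \<open>v \<in> U\<close> by blast
    next
      case False
      have "tree ((V1 - U) \<union> V2) (insert (link a b) (F2 \<union> E2))"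
        using False cut t by (intro tree_join) (auto simp: tree_cut_def)
      moreover have "?V - U = (V1 - U) \<union> V2" using t cut by (auto simp: tree_cut_def)
      ultimately have "tree_cut ?V ?E r v U c F1 (insert (link a b) (F2 \<union> E2))"
        using cut by (auto simp: tree_cut_def)
      then show ?thesis by blast
    qed
  qed
qed

lemma tree_cut_exists:
  "tree V E \<Longrightarrow> r \<in> V \<Longrightarrow> v \<in> V \<Longrightarrow> v \<noteq> r \<Longrightarrow> \<exists>U c E1 E2. tree_cut V E r v U c E1 E2"
proof (induction arbitrary: r v rule: tree.induct)
  case (join V1 E1 V2 E2 b w)
  have bw: "b * w < 0" "w * b < 0" "link b w = (b, w)" "link w b = (b, w)"
    using join by (auto simp: mult_less_0_iff link_def)
  show ?case
  proof (cases "r \<in> V1")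
    case True
    then show ?thesis
      using tree_cut_step[OF join(1-5) bw(1) join.IH(1), of r v] join.prems
      by (simp add: bw)
  next
    case False
    then have "r \<in> V2" "V2 \<inter> V1 = {}" using join by auto
    then show ?thesis
      using tree_cut_step[OF join(2,1) _ join(5,4) bw(2) join.IH(2), of r v] join.prems
      by (simp add: bw Un_commute)
  qed
qed simp

text \<open>
  A path from \<open>v\<close> inside \<open>U\<close> avoids \<open>r\<close>, and the only edge that leaves \<open>U'\<close> ends in \<open>r\<close>.
\<close>

lemma tree_cut_subset:
  assumes "tree_cut V E r v U c E1 E2" "tree_cut V E r v U' c' E1' E2'"
  shows "U \<subseteq> U'"
proof
  fix u assume "u \<in> U"
  have U: "tree U E1" "v \<in> U" "r \<notin> U" and U': "tree U' E1'" "tree (V - U') E2'" "v \<in> U'" "r \<notin> U'"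
    using assms by (auto simp: tree_cut_def)
  have "(v, u) \<in> (adj E1)\<^sup>*" using tree_connected[OF U(1,2) \<open>u \<in> U\<close>] .
  then show "u \<in> U'"
  proof induction
    case (step y z)
    then obtain e where e: "e \<in> E1" "joins e y z" by auto
    then have "y \<in> U" "z \<in> U" using tree_edges[OF U(1) e(1)] by (auto simp: joins_def)
    then have "e \<noteq> link r c'" using e U by (auto simp: joins_def link_def max_def min_def split: if_splits)
    moreover have "e \<in> E" using e assms(1) by (simp add: tree_cut_def)
    moreover have "E = insert (link r c') (E1' \<union> E2')" using assms(2) by (simp add: tree_cut_def)
    ultimately have "e \<in> E1' \<or> e \<in> E2'" by blast
    then have "e \<in> E1'"
      using step e tree_edges[OF U'(2), of e] by (auto simp: joins_def)
    then show ?case using tree_edges[OF U'(1)] e by (auto simp: joins_def)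
  qed (rule U')
qed

text \<open>
  Once \<open>U\<close> is known, the two parts are the edges inside \<open>U\<close> and those disjoint from \<open>U\<close>, and the cut
  edge is the one that is left.
\<close>

lemma tree_cut_unique:
  assumes cut: "tree_cut V E r v U c E1 E2" and cut': "tree_cut V E r v U' c' E1' E2'"
  shows "U = U' \<and> c = c' \<and> E1 = E1' \<and> E2 = E2'"
proof -
  have U: "U = U'" using tree_cut_subset[OF cut cut'] tree_cut_subset[OF cut' cut] by blast
  have parts: "c \<in> U" "r \<notin> U" "r * c < 0" "E = insert (link r c) (E1 \<union> E2)"
      "E1 = {e \<in> E. fst e \<in> U \<and> snd e \<in> U}" "E2 = {e \<in> E. fst e \<notin> U \<and> snd e \<notin> U}"
      "link r c \<notin> E1 \<union> E2"
    if "tree_cut V E r v U c E1 E2" for c E1 E2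
  proof -
    show 1: "c \<in> U" "r \<notin> U" "r * c < 0" "E = insert (link r c) (E1 \<union> E2)"
      using that by (auto simp: tree_cut_def)
    have t: "tree U E1" "tree (V - U) E2" using that by (auto simp: tree_cut_def)
    have 2: "fst (link r c) \<in> U \<longleftrightarrow> snd (link r c) \<notin> U"
      using 1(1,2) by (auto simp: link_def max_def min_def)
    show "E1 = {e \<in> E. fst e \<in> U \<and> snd e \<in> U}" "E2 = {e \<in> E. fst e \<notin> U \<and> snd e \<notin> U}"
      "link r c \<notin> E1 \<union> E2"
      using 1 2 tree_edges[OF t(1)] tree_edges[OF t(2)] by blast+
  qed
  note p = parts[OF cut] and p' = parts[OF cut'[folded U]]
  have E12: "E1 = E1'" "E2 = E2'"
    using p(5,6) p'(5,6) by (simp_all only:)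
  have "link r c \<in> insert (link r c') (E1' \<union> E2')"
    using p(4) p'(4) by (metis insertI1)
  then have "link r c = link r c'" using p(7) E12 by simp
  then have "c = c'" using link_inject[OF p(3) p'(3)] by simp
  then show ?thesis using U E12 by simp
qed

section \<open>Acyclic connected multigraphs\<close>

text \<open>
  Loop erasure: when a step returns to a vertex of the path, the path is cut back to that vertex.
\<close>

lemma rtrancl_distinct_path:
  assumes "(a, z) \<in> (adj E)\<^sup>*"
  shows "\<exists>vs es. vs \<noteq> [] \<and> hd vs = a \<and> last vs = z \<and> distinct vs \<and> length vs = Suc (length es) \<and>
    set es \<subseteq> E \<and> (\<forall>i<length es. joins (es ! i) (vs ! i) (vs ! Suc i))"
  using assms
proof induction
  case base
  show ?case by (rule exI[of _ "[a]"], rule exI[of _ "[]"]) simp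
next
  case (step y z)
  then obtain vs es where p: "vs \<noteq> []" "hd vs = a" "last vs = y" "distinct vs"
    "length vs = Suc (length es)" "set es \<subseteq> E"
    "\<And>i. i < length es \<Longrightarrow> joins (es ! i) (vs ! i) (vs ! Suc i)" by blast
  from step obtain e where e: "e \<in> E" "joins e y z" by auto
  show ?case
  proof (cases "z \<in> set vs")
    case True
    then obtain k where k: "k < length vs" "vs ! k = z" by (auto simp: in_set_conv_nth)
    then have "last (take (Suc k) vs) = z" by (simp add: take_Suc_conv_app_nth)
    then show ?thesis using p k
      by (intro exI[of _ "take (Suc k) vs"] exI[of _ "take k es"])
        (auto simp: hd_take dest: in_set_takeD)
  next
    case False
    have "joins ((es @ [e]) ! i) ((vs @ [z]) ! i) ((vs @ [z]) ! Suc i)" if "i < Suc (length es)" for i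
      using that p e by (cases "i < length es") (auto simp: nth_append last_conv_nth less_Suc_eq)
    then show ?thesis using p e False
      by (intro exI[of _ "vs @ [z]"] exI[of _ "es @ [e]"]) auto
  qed
qed

lemma path_edges_distinct:
  assumes "distinct vs" "length vs = Suc (length es)"
    "\<And>i. i < length es \<Longrightarrow> joins (es ! i) (vs ! i) (vs ! Suc i)"
  shows "distinct es"
  unfolding distinct_conv_nth
proof (intro allI impI notI)
  fix i j assume ij: "i < length es" "j < length es" "i \<noteq> j" "es ! i = es ! j"
  have "{vs ! i, vs ! Suc i} = {vs ! j, vs ! Suc j}"
    using assms(3)[of i] assms(3)[of j] ij by (auto simp: joins_def)
  then show False
    using ij assms(1,2) by (auto simp: doubleton_eq_iff nth_eq_iff_index_eq)
qed

definition cyclic :: "int set \<Rightarrow> (int \<times> int) multiset \<Rightarrow> bool" where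
  "cyclic V M \<longleftrightarrow> (\<exists>vs es. vs \<noteq> [] \<and> distinct vs \<and> set vs \<subseteq> V \<and> length es = length vs \<and> mset es \<subseteq># M \<and>
     (\<forall>i<length vs. joins (es ! i) (vs ! i) (vs ! (Suc i mod length vs))))"

lemma cyclic_mono: "cyclic V M \<Longrightarrow> V \<subseteq> V' \<Longrightarrow> M \<subseteq># M' \<Longrightarrow> cyclic V' M'"
  unfolding cyclic_def by (meson subset_mset.trans subset_trans)

lemma tree_not_cyclic:
  assumes "tree V E"
  shows "\<not> cyclic V (mset_set E)"
proof
  assume "cyclic V (mset_set E)"
  then obtain vs es where c: "vs \<noteq> []" "distinct vs" "set vs \<subseteq> V" "length es = length vs"
    "mset es \<subseteq># mset_set E" "\<And>i. i < length vs \<Longrightarrow> joins (es ! i) (vs ! i) (vs ! (Suc i mod length vs))"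
    unfolding cyclic_def by blast
  have "finite E" using tree_finite[OF assms] by simp
  have "count (mset es) e = (if e \<in> set es then 1 else 0)" for e
  proof -
    have "count (mset es) e \<le> 1"
      using mset_subset_eq_count[OF c(5), of e] \<open>finite E\<close> count_mset_set(1)[of E e]
        count_mset_set(3)[of e E]
      by linarith
    moreover have "count (mset es) e = 0 \<longleftrightarrow> e \<notin> set es"
      by (rule count_mset_0_iff)
    ultimately show ?thesis by (metis One_nat_def le_Suc_eq le_zero_eq)
  qed
  then have "distinct es" by (simp add: distinct_count_atmost_1)
  have "set es \<subseteq> E"
    using set_mset_mono[OF c(5)] \<open>finite E\<close> by simp
  moreover have "fst e \<in> set vs \<and> snd e \<in> set vs" if e: "e \<in> set es" for e
  proof -
    obtain i where i: "i < length vs" "e = es ! i" using e c(4) by (metis in_set_conv_nth)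
    have "Suc i mod length vs < length vs" using c(1) by simp
    then show ?thesis using c(6)[OF i(1)] i by (auto simp: joins_def)
  qed
  ultimately have "set es \<subseteq> {e \<in> E. fst e \<in> set vs \<and> snd e \<in> set vs}" by auto
  then have "card (set es) \<le> card {e \<in> E. fst e \<in> set vs \<and> snd e \<in> set vs}"
    using \<open>finite E\<close> by (intro card_mono) auto
  then have "length es \<le> card {e \<in> E. fst e \<in> set vs \<and> snd e \<in> set vs}"
    using \<open>distinct es\<close> by (simp add: distinct_card)
  also have "\<dots> < length vs"
    using tree_span[OF assms, of "set vs"] c by (simp add: distinct_card)
  finally show False using c(4) by simp
qed

text \<open>
  After the removal of one occurrence of an edge its ends are no longer connected, since a simple path
  between them would close to a cycle; if the edge occurred twice, the second occurrence would
  be such a path. So the component \<open>U\<close> of the black end and its complement, in which every vertex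
  is connected to the white end, are smaller connected graphs without cycles, and the edge
  joins them.
\<close>

lemma acyclic_connected_imp_tree:
  assumes "finite V" "V \<noteq> {}" "\<And>e. e \<in># M \<Longrightarrow> fst e \<in> V \<and> snd e \<in> V \<and> fst e > 0 \<and> snd e < 0"
    "\<And>u v. u \<in> V \<Longrightarrow> v \<in> V \<Longrightarrow> (u, v) \<in> (adj (set_mset M))\<^sup>*" "\<not> cyclic V M"
  shows "\<exists>E. tree V E \<and> M = mset_set E"
  using assms
proof (induction "card V" arbitrary: V M rule: less_induct)
  case less
  note edges = less.prems(3) and conn = less.prems(4)
  show ?case
  proof (cases "M = {#}")
    case True
    from less.prems(2) obtain v where "v \<in> V" by blast
    have "adj {} = {}" by auto
    then have "u = v" if "u \<in> V" for u
      using conn[OF that \<open>v \<in> V\<close>] True by simp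
    then have "V = {v}" using \<open>v \<in> V\<close> by blast
    then show ?thesis using True single by (intro exI[of _ "{}"]) auto
  next
    case False
    then obtain b w where bw: "(b, w) \<in># M" by (metis multiset_nonemptyE surj_pair)
    then have bwV: "b \<in> V" "w \<in> V" "b > 0" "w < 0" using edges[of "(b, w)"] by auto
    define M' where "M' = M - {#(b, w)#}"
    have M: "M = add_mset (b, w) M'" using bw by (simp add: M'_def)
    have not_conn: "(b, w) \<notin> (adj (set_mset M'))\<^sup>*"
    proof
      assume "(b, w) \<in> (adj (set_mset M'))\<^sup>*"
      from rtrancl_distinct_path[OF this] obtain vs es where p: "vs \<noteq> []" "hd vs = b" "last vs = w"
        "distinct vs" "length vs = Suc (length es)" "set es \<subseteq> set_mset M'"
        "\<And>i. i < length es \<Longrightarrow> joins (es ! i) (vs ! i) (vs ! Suc i)" by blast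
      have "distinct es" using path_edges_distinct p(4,5,7) by blast
      have "mset es \<subseteq># M'"
      proof (rule mset_subset_eqI)
        fix e
        show "count (mset es) e \<le> count M' e"
        proof (cases "e \<in> set es")
          case True
          then have "count (mset es) e = 1"
            using \<open>distinct es\<close> unfolding distinct_count_atmost_1 by metis
          moreover have "count M' e > 0" using True p(6) by auto
          ultimately show ?thesis by simp
        qed (simp add: count_mset_0_iff[THEN iffD2])
      qed
      then have "mset (es @ [(b, w)]) \<subseteq># M" by (simp add: M)
      moreover have "joins ((es @ [(b, w)]) ! i) (vs ! i) (vs ! (Suc i mod length vs))"
        if "i < length vs" for i
      proof (cases "i < length es")
        case True
        then show ?thesis using p by (simp add: nth_append)
      next
        case False
        then have "i = length es" using that p by simp
        then show ?thesis using p
          by (simp add: nth_append joins_def) (metis diff_Suc_1 hd_conv_nth last_conv_nth)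
      qed
      moreover have "set vs \<subseteq> V"
      proof
        fix v assume "v \<in> set vs"
        then obtain i where i: "i < length vs" "v = vs ! i" by (auto simp: in_set_conv_nth)
        show "v \<in> V"
        proof (cases "i < length es")
          case True
          then have "es ! i \<in># M" using subsetD[OF p(6) nth_mem[OF True]] by (simp add: M)
          then show ?thesis using p(7)[OF True] i edges[of "es ! i"] by (auto simp: joins_def)
        next
          case False
          then have "v = last vs" using i p by (simp add: last_conv_nth less_Suc_eq)
          then show ?thesis using p bwV by simp
        qed
      qed
      ultimately have "cyclic V M"
        unfolding cyclic_def using p by (intro exI[of _ vs] exI[of _ "es @ [(b, w)]"]) auto
      then show False using less.prems by simp
    qed
    define U where "U = {v \<in> V. (b, v) \<in> (adj (set_mset M'))\<^sup>*}"
    have UV: "b \<in> U" "w \<notin> U" "U \<subseteq> V" using bwV not_conn by (auto simp: U_def)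
    have closed: "fst e \<in> U \<longleftrightarrow> snd e \<in> U" if "e \<in># M'" for e
    proof -
      have "(fst e, snd e) \<in> adj (set_mset M')" "(snd e, fst e) \<in> adj (set_mset M')"
        using that by (auto simp: joins_def intro!: bexI[of _ e])
      moreover have "fst e \<in> V" "snd e \<in> V" using edges[of e] that by (auto simp: M)
      moreover from calculation(1,2) have "(b, fst e) \<in> (adj (set_mset M'))\<^sup>* \<longleftrightarrow> (b, snd e) \<in> (adj (set_mset M'))\<^sup>*"
        by (meson rtrancl_into_rtrancl)
      ultimately show ?thesis by (simp add: U_def)
    qed
    define M1 where "M1 = filter_mset (\<lambda>e. fst e \<in> U) M'"
    define M2 where "M2 = filter_mset (\<lambda>e. fst e \<notin> U) M'"
    have M12: "M' = M1 + M2" by (simp add: M1_def M2_def)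
    have reach1: "(b, u) \<in> (adj (set_mset M1))\<^sup>*" if "u \<in> U" for u
    proof -
      have "(b, u) \<in> (adj (set_mset M'))\<^sup>*" using that by (simp add: U_def)
      then have "(b, u) \<in> (adj (set_mset M1))\<^sup>* \<and> u \<in> U"
      proof induction
        case base
        then show ?case using UV by simp
      next
        case (step y z)
        then obtain e where e: "e \<in># M'" "joins e y z" by auto
        then have "e \<in># M1" "z \<in> U"
          using step closed[OF e(1)] by (auto simp: M1_def joins_def)
        then show ?case using step e by (auto intro!: rtrancl_into_rtrancl[of b y])
      qed
      then show ?thesis by simp
    qed
    have reach2: "(w, v) \<in> (adj (set_mset M2))\<^sup>*" if "v \<in> V - U" for v
    proof -
      have "(w, v) \<in> (adj (set_mset M))\<^sup>*" using that conn bwV by blast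
      then have "v \<in> U \<or> (w, v) \<in> (adj (set_mset M2))\<^sup>*"
      proof induction
        case (step y z)
        then obtain e where e: "e \<in># M" "joins e y z" by auto
        show ?case
        proof (cases "e \<in># M'")
          case True
          show ?thesis
          proof (cases "z \<in> U")
            case False
            then have "y \<notin> U" "fst e \<notin> U" using closed[OF True] e by (auto simp: joins_def)
            then have "e \<in># M2" "(w, y) \<in> (adj (set_mset M2))\<^sup>*"
              using True step by (auto simp: M2_def)
            then show ?thesis using e by (auto intro!: rtrancl_into_rtrancl[of w y])
          qed simp
        next
          case False
          then have "e = (b, w)" using e by (simp add: M)
          then show ?thesis using e UV by (auto simp: joins_def)
        qed
      qed simp
      then show ?thesis using that by simp
    qed
    have sub: "M1 \<subseteq># M" "M2 \<subseteq># M" by (auto simp: M M12 intro!: mset_subset_eqI)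
    have "card U < card V" "card (V - U) < card V"
      using UV bwV less.prems(1) by (auto intro!: psubset_card_mono)
    moreover have "\<exists>E1. tree U E1 \<and> M1 = mset_set E1"
    proof (rule less.hyps[OF \<open>card U < card V\<close>])
      show "finite U" "U \<noteq> {}" using UV less.prems(1) finite_subset by auto
      show "fst e \<in> U \<and> snd e \<in> U \<and> fst e > 0 \<and> snd e < 0" if "e \<in># M1" for e
        using that closed[of e] edges[of e] by (auto simp: M1_def M)
      show "(u, v) \<in> (adj (set_mset M1))\<^sup>*" if "u \<in> U" "v \<in> U" for u v
        using adj_rtrancl_sym[OF reach1[OF that(1)]] reach1[OF that(2)] by (rule rtrancl_trans)
      show "\<not> cyclic U M1" using less.prems(5) cyclic_mono sub UV by blast
    qed
    moreover have "\<exists>E2. tree (V - U) E2 \<and> M2 = mset_set E2"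
    proof (rule less.hyps[OF \<open>card (V - U) < card V\<close>])
      show "finite (V - U)" "V - U \<noteq> {}" using UV bwV less.prems(1) by auto
      show "fst e \<in> V - U \<and> snd e \<in> V - U \<and> fst e > 0 \<and> snd e < 0" if "e \<in># M2" for e
        using that closed[of e] edges[of e] by (auto simp: M2_def M)
      show "(u, v) \<in> (adj (set_mset M2))\<^sup>*" if "u \<in> V - U" "v \<in> V - U" for u v
        using adj_rtrancl_sym[OF reach2[OF that(1)]] reach2[OF that(2)] by (rule rtrancl_trans)
      show "\<not> cyclic (V - U) M2" using less.prems(5) cyclic_mono sub by blast
    qed
    ultimately obtain E1 E2 where E: "tree U E1" "M1 = mset_set E1" "tree (V - U) E2" "M2 = mset_set E2"
      by blast
    have "tree (U \<union> (V - U)) (insert (b, w) (E1 \<union> E2))"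
      using E UV bwV by (intro join) auto
    moreover have "U \<union> (V - U) = V" using UV by blast
    moreover have "M = mset_set (insert (b, w) (E1 \<union> E2))"
    proof -
      have "(b, w) \<notin> E1 \<union> E2" "E1 \<inter> E2 = {}"
        using tree_edges'[OF E(1)] tree_edges'[OF E(3)] UV by auto
      then show ?thesis using tree_finite[OF E(1)] tree_finite[OF E(3)]
        by (simp add: M M12 E mset_set_Union)
    qed
    ultimately show ?thesis by auto
  qed
qed

theorem bipartite_tree_iff:
  "bipartite_tree t \<longleftrightarrow> (\<exists>E. tree (verts t) E \<and> bedges t = mset_set E)"
proof
  assume t: "bipartite_tree t"
  show "\<exists>E. tree (verts t) E \<and> bedges t = mset_set E"
  proof (rule acyclic_connected_imp_tree)
    show "finite (verts t)" by (simp add: blacks_def whites_def)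
    show "verts t \<noteq> {}" using t by (simp add: bipartite_tree_def)
    show "\<not> cyclic (verts t) (bedges t)"
      using t by (auto simp: bipartite_tree_def is_cycle_def cyclic_def)
    show "(u, v) \<in> (adj (set_mset (bedges t)))\<^sup>*" if "u \<in> verts t" "v \<in> verts t" for u v
      using t that by (auto simp: bipartite_tree_def connected_graph_def)
    show "fst e \<in> verts t \<and> snd e \<in> verts t \<and> fst e > 0 \<and> snd e < 0" if "e \<in># bedges t" for e
      using t that by (fastforce simp: bipartite_tree_def bipartite_graph_def blacks_def whites_def)
  qed
next
  assume "\<exists>E. tree (verts t) E \<and> bedges t = mset_set E"
  then obtain E where E: "tree (verts t) E" "bedges t = mset_set E" by blast
  have set: "set_mset (bedges t) = E" using E tree_finite by (metis finite_set_mset_mset_set)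
  have "bipartite_graph t"
    using tree_edges[OF E(1)] unfolding bipartite_graph_def set
    by (fastforce simp: blacks_def whites_def)
  moreover have "connected_graph t"
    unfolding connected_graph_def set using tree_connected[OF E(1)] by blast
  moreover have "\<not> is_cycle t vs es" for vs es
    using tree_not_cyclic[OF E(1)] unfolding cyclic_def is_cycle_def E(2) by blast
  ultimately show "bipartite_tree t"
    using tree_nonempty[OF E(1)] by (simp add: bipartite_tree_def)
qed

section \<open>Tree amplitudes with external legs\<close>

definition edges_touching :: "(int \<times> int) set \<Rightarrow> int \<Rightarrow> (int \<times> int) set" where
  "edges_touching E v = {e \<in> E. fst e = v \<or> snd e = v}"

definition legs :: "(int \<times> int \<Rightarrow> 'd) \<Rightarrow> (int \<times> int) set \<Rightarrow> int \<Rightarrow> 'd multiset" where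
  "legs a E v = image_mset a (mset_set (edges_touching E v))"

text \<open>
  The amplitude of a tree, where \<open>x v\<close> lists the indices of external legs at \<open>v\<close>. Legs arise from cut
  edges. Weights take multisets because only symmetric tensors occur.
\<close>

definition amp ::
  "(int \<Rightarrow> 'd multiset \<Rightarrow> real) \<Rightarrow> int set \<Rightarrow> (int \<times> int) set \<Rightarrow> (int \<Rightarrow> 'd multiset) \<Rightarrow> real" where
  "amp \<tau> V E x = (\<Sum>a\<in>E \<rightarrow>\<^sub>E UNIV. \<Prod>v\<in>V. \<tau> v (x v + legs a E v))"

definition tree_sum ::
  "(int \<Rightarrow> 'd multiset \<Rightarrow> real) \<Rightarrow> int set \<Rightarrow> (int \<Rightarrow> 'd multiset) \<Rightarrow> real" where
  "tree_sum \<tau> V x = (\<Sum>E | tree V E. amp \<tau> V E x)"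

abbreviation add_leg :: "int \<Rightarrow> 'd \<Rightarrow> (int \<Rightarrow> 'd multiset) \<Rightarrow> int \<Rightarrow> 'd multiset" where
  "add_leg v \<alpha> x \<equiv> x(v := add_mset \<alpha> (x v))"

lemma legs_cong: "(\<And>e. e \<in> E \<Longrightarrow> a e = a' e) \<Longrightarrow> legs a E v = legs a' E v"
  unfolding legs_def edges_touching_def
  by (rule image_mset_cong) (metis (mono_tags, lifting) elem_mset_set empty_iff mem_Collect_eq mset_set.infinite set_mset_empty)

lemma amp_cong:
  assumes "\<And>v. v \<in> V \<Longrightarrow> x v = x' v"
  shows "amp \<tau> V E x = amp \<tau> V E x'"
  unfolding amp_def using assms by (intro sum.cong prod.cong refl) simp

lemma tree_sum_cong:
  assumes "\<And>v. v \<in> V \<Longrightarrow> x v = x' v"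
  shows "tree_sum \<tau> V x = tree_sum \<tau> V x'"
  unfolding tree_sum_def using assms by (intro sum.cong refl amp_cong) auto

lemma finite_trees: "finite {E. tree V E}"
proof (cases "finite V")
  case True
  have "{E. tree V E} \<subseteq> Pow (V \<times> V)"
    using tree_edges' by fastforce
  then show ?thesis by (rule finite_subset) (use True in simp)
next
  case False
  then have "{E. tree V E} = {}" using tree_finite by auto
  then show ?thesis by simp
qed

lemma sum_PiE_insert_Un:
  fixes f :: "('e \<Rightarrow> 'd::finite) \<Rightarrow> real"
  assumes "finite E1" "finite E2" "E1 \<inter> E2 = {}" "e \<notin> E1 \<union> E2"
  shows "(\<Sum>a\<in>insert e (E1 \<union> E2) \<rightarrow>\<^sub>E UNIV. f a) =
    (\<Sum>\<alpha>\<in>UNIV. \<Sum>a1\<in>E1 \<rightarrow>\<^sub>E UNIV. \<Sum>a2\<in>E2 \<rightarrow>\<^sub>E UNIV.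
       f (\<lambda>x. if x = e then \<alpha> else if x \<in> E1 then a1 x else a2 x))"
proof -
  let ?glue = "\<lambda>(\<alpha> :: 'd, a1, a2) x. if x = e then \<alpha> else if x \<in> E1 then a1 x else a2 x"
  let ?T = "(UNIV :: 'd set) \<times> (E1 \<rightarrow>\<^sub>E (UNIV :: 'd set)) \<times> (E2 \<rightarrow>\<^sub>E (UNIV :: 'd set))"
  have "(\<Sum>a\<in>insert e (E1 \<union> E2) \<rightarrow>\<^sub>E UNIV. f a) = (\<Sum>p\<in>?T. f (?glue p))"
  proof (rule sum.reindex_bij_witness[where i = ?glue and
        j = "\<lambda>a. (a e, restrict a E1, restrict a E2)"])
    fix a assume a: "a \<in> insert e (E1 \<union> E2) \<rightarrow>\<^sub>E (UNIV :: 'd set)"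
    have "a z = undefined" if "z \<notin> insert e (E1 \<union> E2)" for z
      using a that by (rule PiE_arb)
    then show glue: "?glue (a e, restrict a E1, restrict a E2) = a"
      by (intro ext) auto
    show "(a e, restrict a E1, restrict a E2) \<in> ?T" by auto
    show "f (?glue (a e, restrict a E1, restrict a E2)) = f a" using glue by simp
  next
    fix p assume "p \<in> ?T"
    then obtain \<alpha> a1 a2 where p: "p = (\<alpha>, a1, a2)" "a1 \<in> E1 \<rightarrow>\<^sub>E UNIV" "a2 \<in> E2 \<rightarrow>\<^sub>E UNIV" by auto
    have "restrict (?glue p) E1 = a1"
      by (rule extensionalityI[of _ E1]) (use p assms(3,4) in \<open>auto simp: PiE_iff\<close>)
    moreover have "restrict (?glue p) E2 = a2"
      by (rule extensionalityI[of _ E2]) (use p assms(3,4) in \<open>auto simp: PiE_iff\<close>)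
    ultimately show "(?glue p e, restrict (?glue p) E1, restrict (?glue p) E2) = p"
      using p by simp
    show "?glue p \<in> insert e (E1 \<union> E2) \<rightarrow>\<^sub>E UNIV"
      using p assms by (auto simp: PiE_iff extensional_def)
  qed
  also have "\<dots> = (\<Sum>\<alpha>\<in>UNIV. \<Sum>a1\<in>E1 \<rightarrow>\<^sub>E UNIV. \<Sum>a2\<in>E2 \<rightarrow>\<^sub>E UNIV. f (?glue (\<alpha>, a1, a2)))"
    by (auto simp: sum.cartesian_product intro!: sum.cong)
  finally show ?thesis by simp
qed

lemma edges_touching_join:
  assumes "tree V1 E1" "tree V2 E2" "V1 \<inter> V2 = {}" "u \<in> V1" "v \<in> V2" "u * v < 0" "z \<in> V1"
  shows "edges_touching (insert (link u v) (E1 \<union> E2)) z =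
     (if z = u then insert (link u v) (edges_touching E1 z) else edges_touching E1 z)"
proof -
  have 1: "fst (link u v) = z \<or> snd (link u v) = z \<longleftrightarrow> z = u"
    using assms by (auto simp: link_def max_def min_def)
  have 2: "fst e \<noteq> z \<and> snd e \<noteq> z" if "e \<in> E2" for e
    using tree_edges[OF assms(2) that] assms by auto
  show ?thesis using 1 2 by (auto simp: edges_touching_def)
qed

lemma link_notin: "tree V E \<Longrightarrow> u \<notin> V \<or> v \<notin> V \<Longrightarrow> link u v \<notin> E"
  using tree_edges[of V E "link u v"] by (auto simp: link_def max_def min_def split: if_splits)

lemma legs_join:
  assumes "tree V1 E1" "tree V2 E2" "V1 \<inter> V2 = {}" "u \<in> V1" "v \<in> V2" "u * v < 0" "z \<in> V1"
    and a: "a (link u v) = \<alpha>" "\<And>e. e \<in> E1 \<Longrightarrow> a e = a1 e"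
  shows "x z + legs a (insert (link u v) (E1 \<union> E2)) z = add_leg u \<alpha> x z + legs a1 E1 z"
proof -
  have "link u v \<notin> E1" using link_notin[OF assms(1)] assms by blast
  then have "link u v \<notin> edges_touching E1 z" by (simp add: edges_touching_def)
  moreover have "finite (edges_touching E1 z)"
    using tree_finite[OF assms(1)] by (simp add: edges_touching_def)
  moreover have "legs a E1 z = legs a1 E1 z" by (rule legs_cong) (use a in auto)
  ultimately show ?thesis
    unfolding legs_def edges_touching_join[OF assms(1-7)] by (auto simp: a)
qed

text \<open>
  The index of the joining edge is split off from the assignment of indices; for fixed \<open>\<alpha>\<close>
  it acts on each side like an external leg, and the rest of the sum factorises.
\<close>

lemma amp_join:
  fixes \<tau> :: "int \<Rightarrow> 'd::finite multiset \<Rightarrow> real"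
  assumes t: "tree V1 E1" "tree V2 E2" "V1 \<inter> V2 = {}" "u \<in> V1" "v \<in> V2" "u * v < 0"
  shows "amp \<tau> (V1 \<union> V2) (insert (link u v) (E1 \<union> E2)) x =
    (\<Sum>\<alpha>\<in>UNIV. amp \<tau> V1 E1 (add_leg u \<alpha> x) * amp \<tau> V2 E2 (add_leg v \<alpha> x))"
proof -
  let ?E = "insert (link u v) (E1 \<union> E2)"
  let ?a = "\<lambda>\<alpha> a1 a2 e. if e = link u v then \<alpha> else if e \<in> E1 then a1 e else a2 e"
  have fin: "finite V1" "finite V2" "finite E1" "finite E2" using tree_finite t(1,2) by auto
  have disj: "E1 \<inter> E2 = {}" using tree_edges[OF t(1)] tree_edges[OF t(2)] t(3) by blast
  have notin: "link u v \<notin> E1 \<union> E2" using link_notin[OF t(1)] link_notin[OF t(2)] t by blast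
  have E2: "insert (link v u) (E2 \<union> E1) = ?E" by (simp add: link_commute Un_commute)
  have split: "(\<Prod>z\<in>V1 \<union> V2. \<tau> z (x z + legs (?a \<alpha> a1 a2) ?E z)) =
      (\<Prod>z\<in>V1. \<tau> z (add_leg u \<alpha> x z + legs a1 E1 z)) *
      (\<Prod>z\<in>V2. \<tau> z (add_leg v \<alpha> x z + legs a2 E2 z))" for \<alpha> a1 a2
  proof -
    have 1: "x z + legs (?a \<alpha> a1 a2) ?E z = add_leg u \<alpha> x z + legs a1 E1 z" if "z \<in> V1" for z
      by (rule legs_join[OF t that]) (use notin in auto)
    have 2: "x z + legs (?a \<alpha> a1 a2) ?E z = add_leg v \<alpha> x z + legs a2 E2 z" if "z \<in> V2" for z
      unfolding E2[symmetric]
      by (rule legs_join[OF t(2,1) _ t(5,4) _ that])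
        (use notin disj t in \<open>auto simp: link_commute mult.commute\<close>)
    show ?thesis unfolding prod.union_disjoint[OF fin(1,2) t(3)]
      by (intro arg_cong2[where f = times] prod.cong refl) (simp_all only: 1 2)
  qed
  have "amp \<tau> (V1 \<union> V2) ?E x = (\<Sum>\<alpha>\<in>UNIV. \<Sum>a1\<in>E1 \<rightarrow>\<^sub>E UNIV. \<Sum>a2\<in>E2 \<rightarrow>\<^sub>E UNIV.
      \<Prod>z\<in>V1 \<union> V2. \<tau> z (x z + legs (?a \<alpha> a1 a2) ?E z))"
    unfolding amp_def by (rule sum_PiE_insert_Un[OF fin(3,4) disj notin])
  also have "\<dots> = (\<Sum>\<alpha>\<in>UNIV. amp \<tau> V1 E1 (add_leg u \<alpha> x) * amp \<tau> V2 E2 (add_leg v \<alpha> x))"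
    unfolding amp_def sum_product by (intro sum.cong refl split)
  finally show ?thesis .
qed

text \<open>
  Each tree on \<open>V\<close> arises exactly once by joining a tree on a set \<open>U\<close> that contains \<open>v\<close> but not \<open>r\<close> and a tree
  on the complement with an edge from \<open>r\<close> to some \<open>c\<close> in \<open>U\<close>.
\<close>

theorem tree_sum_cut:
  fixes \<tau> :: "int \<Rightarrow> 'd::finite multiset \<Rightarrow> real"
  assumes "finite V" "r \<in> V" "v \<in> V" "v \<noteq> r"
  shows "tree_sum \<tau> V x = (\<Sum>U | U \<subseteq> V - {r} \<and> v \<in> U. \<Sum>c | c \<in> U \<and> r * c < 0. \<Sum>\<alpha>\<in>UNIV.
    tree_sum \<tau> U (add_leg c \<alpha> x) * tree_sum \<tau> (V - U) (add_leg r \<alpha> x))"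
proof -
  let ?US = "{U. U \<subseteq> V - {r} \<and> v \<in> U}" and ?CS = "\<lambda>U. {c. c \<in> U \<and> r * c < 0}"
  let ?D = "SIGMA U:?US. SIGMA c:?CS U. {E1. tree U E1} \<times> {E2. tree (V - U) E2}"
  let ?glue = "\<lambda>(U, c, E1, E2). insert (link r c) (E1 \<union> E2)"
  define A where "A U c E1 E2 = (\<Sum>\<alpha>\<in>UNIV. amp \<tau> U E1 (add_leg c \<alpha> x) * amp \<tau> (V - U) E2 (add_leg r \<alpha> x))" for U c E1 E2
  have D_cut: "tree_cut V (?glue (U, c, E1, E2)) r v U c E1 E2"
    if "(U, c, E1, E2) \<in> ?D" for U c E1 E2
    using that unfolding tree_cut_def by simp
  have inj: "inj_on ?glue ?D"
  proof (rule inj_onI)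
    fix p p' assume p: "p \<in> ?D" "p' \<in> ?D" "?glue p = ?glue p'"
    obtain U c E1 E2 where 1: "p = (U, c, E1, E2)" by (cases p)
    obtain U' c' E1' E2' where 2: "p' = (U', c', E1', E2')" by (cases p')
    have "tree_cut V (?glue p) r v U c E1 E2" using p(1) unfolding 1 by (rule D_cut)
    moreover have "tree_cut V (?glue p) r v U' c' E1' E2'"
      using p(2) unfolding p(3) unfolding 2 by (rule D_cut)
    ultimately show "p = p'" using tree_cut_unique unfolding 1 2 by blast
  qed
  have img: "?glue ` ?D = {E. tree V E}"
  proof (intro equalityI subsetI)
    fix E assume "E \<in> ?glue ` ?D"
    then obtain p where p: "p \<in> ?D" "E = ?glue p" by blast
    obtain U c E1 E2 where "p = (U, c, E1, E2)" by (cases p)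
    with p have E: "E = insert (link r c) (E1 \<union> E2)" "U \<subseteq> V - {r}" "c \<in> U" "r * c < 0"
      "tree U E1" "tree (V - U) E2" by simp_all
    have "tree ((V - U) \<union> U) (insert (link r c) (E2 \<union> E1))"
      using E assms by (intro tree_join) auto
    then have "tree ((V - U) \<union> U) E" by (simp add: E(1) Un_commute)
    moreover have "(V - U) \<union> U = V" using E by auto
    ultimately show "E \<in> {E. tree V E}" by simp
  next
    fix E assume "E \<in> {E. tree V E}"
    then obtain U c E1 E2 where cut: "tree_cut V E r v U c E1 E2"
      using tree_cut_exists assms by blast
    then have "(U, c, E1, E2) \<in> ?D" "E = ?glue (U, c, E1, E2)"
      unfolding tree_cut_def by simp_all
    then show "E \<in> ?glue ` ?D" by (rule rev_image_eqI)
  qed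
  have finU: "finite U" if "U \<in> ?US" for U
    using that finite_subset[of U V] assms(1) by blast
  have fin: "finite ?US" "\<And>U. U \<in> ?US \<Longrightarrow> finite (?CS U)"
    using finite_subset[of ?US "Pow V"] finU assms(1) by auto
  have "tree_sum \<tau> V x = (\<Sum>p\<in>?D. amp \<tau> V (?glue p) x)"
    unfolding tree_sum_def img[symmetric] by (rule sum.reindex[OF inj, unfolded o_def])
  also have "\<dots> = (\<Sum>(U, c, E1, E2)\<in>?D. A U c E1 E2)"
  proof (rule sum.cong[OF refl])
    fix p assume "p \<in> ?D"
    then obtain U c E1 E2 where p: "p = (U, c, E1, E2)" "U \<subseteq> V - {r}" "c \<in> U" "r * c < 0"
      "tree U E1" "tree (V - U) E2" by (elim SigmaE) simp
    have "amp \<tau> (U \<union> (V - U)) (insert (link c r) (E1 \<union> E2)) x = A U c E1 E2"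
      unfolding A_def using p assms by (intro amp_join) (auto simp: mult.commute)
    moreover have "U \<union> (V - U) = V" using p by auto
    ultimately show "amp \<tau> V (?glue p) x = (case p of (U, c, E1, E2) \<Rightarrow> A U c E1 E2)"
      by (simp add: p(1) link_commute)
  qed
  also have "\<dots> = (\<Sum>U\<in>?US. \<Sum>c\<in>?CS U. \<Sum>E1 | tree U E1. \<Sum>E2 | tree (V - U) E2. A U c E1 E2)"
    (is "_ = ?R")
  proof -
    let ?T = "\<lambda>U. {E1. tree U E1} \<times> {E2. tree (V - U) E2}"
    have "?R = (\<Sum>U\<in>?US. \<Sum>c\<in>?CS U. \<Sum>(E1, E2)\<in>?T U. A U c E1 E2)"
      by (simp only: sum.cartesian_product)
    also have "\<dots> = (\<Sum>U\<in>?US. \<Sum>(c, E1, E2)\<in>Sigma (?CS U) (\<lambda>_. ?T U). A U c E1 E2)"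
      by (intro sum.cong refl sum.Sigma fin ballI finite_cartesian_product finite_trees)
    also have "\<dots> = (\<Sum>(U, c, E1, E2)\<in>?D. A U c E1 E2)"
      by (intro sum.Sigma fin ballI finite_SigmaI finite_cartesian_product finite_trees)
    finally show ?thesis by (rule sym)
  qed
  also have "\<dots> = (\<Sum>U\<in>?US. \<Sum>c\<in>?CS U. \<Sum>\<alpha>\<in>UNIV.
      tree_sum \<tau> U (add_leg c \<alpha> x) * tree_sum \<tau> (V - U) (add_leg r \<alpha> x))"
  proof (intro sum.cong refl)
    fix U c
    have "(\<Sum>E1 | tree U E1. \<Sum>E2 | tree (V - U) E2. A U c E1 E2) =
      (\<Sum>\<alpha>\<in>UNIV. \<Sum>E1 | tree U E1. \<Sum>E2 | tree (V - U) E2.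
         amp \<tau> U E1 (add_leg c \<alpha> x) * amp \<tau> (V - U) E2 (add_leg r \<alpha> x))"
      unfolding A_def
      by (rule trans[OF sum.cong[OF refl] sum.swap]) (rule sum.swap)
    then show "(\<Sum>E1 | tree U E1. \<Sum>E2 | tree (V - U) E2. A U c E1 E2) =
      (\<Sum>\<alpha>\<in>UNIV. tree_sum \<tau> U (add_leg c \<alpha> x) * tree_sum \<tau> (V - U) (add_leg r \<alpha> x))"
      by (simp only: tree_sum_def sum_product)
  qed
  finally show ?thesis .
qed

section \<open>Relabelling of vertices\<close>

lemma tree_relabel:
  assumes "tree V E" "inj_on \<pi> V" "\<And>v. v \<in> V \<Longrightarrow> sgn (\<pi> v) = sgn v"
  shows "tree (\<pi> ` V) (map_prod \<pi> \<pi> ` E)"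
  using assms
proof (induction rule: tree.induct)
  case (single v)
  then show ?case using tree.single by simp
next
  case (join V1 E1 V2 E2 b w)
  have "sgn (\<pi> b) = sgn b" "sgn (\<pi> w) = sgn w" using join by auto
  then have "\<pi> b > 0" "\<pi> w < 0" using join.hyps(6,7) by (auto simp: sgn_if split: if_splits)
  moreover have "\<pi> ` V1 \<inter> \<pi> ` V2 = {}"
    using join inj_on_image_Int[of \<pi> "V1 \<union> V2" V1 V2] by simp
  moreover have "tree (\<pi> ` V1) (map_prod \<pi> \<pi> ` E1)" "tree (\<pi> ` V2) (map_prod \<pi> \<pi> ` E2)"
    using join by (auto simp: inj_on_Un)
  ultimately have "tree (\<pi> ` V1 \<union> \<pi> ` V2) (insert (\<pi> b, \<pi> w) (map_prod \<pi> \<pi> ` E1 \<union> map_prod \<pi> \<pi> ` E2))"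
    using join.hyps by (intro tree.join) auto
  then show ?case by (simp add: image_Un)
qed

lemma tree_relabel_inj:
  assumes t: "tree V E" and inj: "inj_on \<pi> V"
  shows "inj_on (map_prod \<pi> \<pi>) E"
  using map_prod_inj_on[OF inj inj] by (rule inj_on_subset) (use tree_edges'[OF t] in auto)

lemma edges_touching_relabel:
  assumes t: "tree V E" and inj: "inj_on \<pi> V" and v: "v \<in> V"
  shows "edges_touching (map_prod \<pi> \<pi> ` E) (\<pi> v) = map_prod \<pi> \<pi> ` edges_touching E v"
proof -
  let ?\<pi> = "map_prod \<pi> \<pi>"
  have "fst (?\<pi> e) = \<pi> v \<or> snd (?\<pi> e) = \<pi> v \<longleftrightarrow> fst e = v \<or> snd e = v" if "e \<in> E" for e
    using tree_edges[OF t that] inj_on_eq_iff[OF inj _ v] by (cases e) simp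
  then show ?thesis
    unfolding edges_touching_def Compr_image_eq by (metis (no_types, lifting) Collect_cong)
qed

lemma sum_PiE_reindex:
  fixes P :: "'a \<Rightarrow> 'b" and f :: "('a \<Rightarrow> 'c) \<Rightarrow> real"
  assumes inj: "inj_on P E"
  shows "(\<Sum>b\<in>P ` E \<rightarrow>\<^sub>E (UNIV :: 'c set). f (restrict (b \<circ> P) E)) = (\<Sum>a\<in>E \<rightarrow>\<^sub>E UNIV. f a)"
proof (rule sum.reindex_bij_witness[where j = "\<lambda>b. restrict (b \<circ> P) E" and
      i = "\<lambda>a. restrict (a \<circ> the_inv_into E P) (P ` E)"])
  note inv = the_inv_into_f_f[OF inj]
  fix b :: "'b \<Rightarrow> 'c" assume b: "b \<in> P ` E \<rightarrow>\<^sub>E UNIV"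
  show "restrict (restrict (b \<circ> P) E \<circ> the_inv_into E P) (P ` E) = b"
  proof (rule extensionalityI[OF restrict_extensional])
    show "b \<in> extensional (P ` E)" using b by (simp add: PiE_iff)
    fix y assume "y \<in> P ` E"
    then show "restrict (restrict (b \<circ> P) E \<circ> the_inv_into E P) (P ` E) y = b y"
      by (elim imageE) (simp add: inv)
  qed
  show "restrict (b \<circ> P) E \<in> E \<rightarrow>\<^sub>E UNIV" by simp
  show "f (restrict (b \<circ> P) E) = f (restrict (b \<circ> P) E)" ..
next
  note inv = the_inv_into_f_f[OF inj]
  fix a :: "'a \<Rightarrow> 'c" assume a: "a \<in> E \<rightarrow>\<^sub>E UNIV"
  show "restrict (restrict (a \<circ> the_inv_into E P) (P ` E) \<circ> P) E = a"
  proof (rule extensionalityI[OF restrict_extensional])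
    show "a \<in> extensional E" using a by (simp add: PiE_iff)
    fix y assume "y \<in> E"
    then show "restrict (restrict (a \<circ> the_inv_into E P) (P ` E) \<circ> P) E y = a y"
      by (simp add: inv)
  qed
  show "restrict (a \<circ> the_inv_into E P) (P ` E) \<in> P ` E \<rightarrow>\<^sub>E UNIV" by simp
qed

lemma amp_relabel:
  fixes \<tau> :: "int \<Rightarrow> 'd::finite multiset \<Rightarrow> real"
  assumes t: "tree V E" and inj: "inj_on \<pi> V"
    and \<tau>: "\<And>v. v \<in> V \<Longrightarrow> \<tau> (\<pi> v) = \<tau> v" and x: "\<And>v. v \<in> V \<Longrightarrow> x' (\<pi> v) = x v"
  shows "amp \<tau> (\<pi> ` V) (map_prod \<pi> \<pi> ` E) x' = amp \<tau> V E x"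
proof -
  let ?\<pi> = "map_prod \<pi> \<pi>"
  have injE: "inj_on ?\<pi> E" by (rule tree_relabel_inj[OF t inj])
  have legs: "legs b (?\<pi> ` E) (\<pi> v) = legs (b \<circ> ?\<pi>) E v" if "v \<in> V" for b :: "int \<times> int \<Rightarrow> 'd" and v
  proof -
    have "inj_on ?\<pi> (edges_touching E v)"
      using injE by (rule inj_on_subset) (auto simp: edges_touching_def)
    then show ?thesis
      by (simp add: legs_def edges_touching_relabel[OF t inj that] image_mset_mset_set[symmetric]
          multiset.map_comp)
  qed
  have "legs (b \<circ> ?\<pi>) E v = legs (restrict (b \<circ> ?\<pi>) E) E v" for b :: "int \<times> int \<Rightarrow> 'd" and v
    by (rule legs_cong) simp
  with legs have "amp \<tau> (\<pi> ` V) (?\<pi> ` E) x' =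
      (\<Sum>b\<in>?\<pi> ` E \<rightarrow>\<^sub>E UNIV. \<Prod>v\<in>V. \<tau> v (x v + legs (restrict (b \<circ> ?\<pi>) E) E v))"
    unfolding amp_def by (intro sum.cong refl) (simp add: prod.reindex[OF inj] \<tau> x)
  then show ?thesis
    unfolding amp_def sum_PiE_reindex[OF injE, of "\<lambda>a. \<Prod>v\<in>V. \<tau> v (x v + legs a E v)"] .
qed

theorem tree_sum_relabel:
  fixes \<tau> :: "int \<Rightarrow> 'd::finite multiset \<Rightarrow> real"
  assumes inj: "inj_on \<pi> V" and sgn: "\<And>v. v \<in> V \<Longrightarrow> sgn (\<pi> v) = sgn v"
    and \<tau>: "\<And>v. v \<in> V \<Longrightarrow> \<tau> (\<pi> v) = \<tau> v" and x: "\<And>v. v \<in> V \<Longrightarrow> x' (\<pi> v) = x v"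
  shows "tree_sum \<tau> (\<pi> ` V) x' = tree_sum \<tau> V x"
proof -
  let ?\<pi> = "map_prod \<pi> \<pi>" and ?\<rho> = "the_inv_into V \<pi>"
  have \<rho>: "?\<rho> (\<pi> v) = v" if "v \<in> V" for v using the_inv_into_f_f[OF inj that] .
  have \<rho>\<pi>: "map_prod ?\<rho> ?\<rho> ` ?\<pi> ` E = E" if t: "tree V E" for E
  proof -
    have "map_prod ?\<rho> ?\<rho> (?\<pi> e) = e" if "e \<in> E" for e
      using tree_edges[OF t that] \<rho> by (cases e) simp
    then show ?thesis by (simp add: image_image cong: image_cong_simp)
  qed
  have \<pi>\<rho>: "?\<pi> ` map_prod ?\<rho> ?\<rho> ` F = F" if t: "tree (\<pi> ` V) F" for F
  proof -
    have "?\<pi> (map_prod ?\<rho> ?\<rho> e) = e" if "e \<in> F" for e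
      using tree_edges[OF t that] f_the_inv_into_f[OF inj] by (cases e) simp
    then show ?thesis by (simp add: image_image cong: image_cong_simp)
  qed
  show ?thesis unfolding tree_sum_def
  proof (rule sum.reindex_bij_witness[where i = "\<lambda>E. ?\<pi> ` E" and j = "\<lambda>F. map_prod ?\<rho> ?\<rho> ` F"])
    fix F assume "F \<in> {F. tree (\<pi> ` V) F}"
    then have F: "tree (\<pi> ` V) F" by simp
    show "?\<pi> ` map_prod ?\<rho> ?\<rho> ` F = F" by (rule \<pi>\<rho>[OF F])
    have "tree (?\<rho> ` \<pi> ` V) (map_prod ?\<rho> ?\<rho> ` F)"
      by (rule tree_relabel[OF F]) (use \<rho> sgn inj in \<open>auto simp: inj_on_def\<close>)
    moreover have "?\<rho> ` \<pi> ` V = V" using \<rho> by force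
    ultimately have E: "tree V (map_prod ?\<rho> ?\<rho> ` F)" by simp
    then show "map_prod ?\<rho> ?\<rho> ` F \<in> {E. tree V E}" by simp
    show "amp \<tau> V (map_prod ?\<rho> ?\<rho> ` F) x = amp \<tau> (\<pi> ` V) F x'"
      using amp_relabel[of V "map_prod ?\<rho> ?\<rho> ` F" \<pi> \<tau> x' x, OF E inj \<tau> x] \<pi>\<rho>[OF F] by simp
  next
    fix E assume "E \<in> {E. tree V E}"
    then have E: "tree V E" by simp
    then show "map_prod ?\<rho> ?\<rho> ` ?\<pi> ` E = E" "?\<pi> ` E \<in> {F. tree (\<pi> ` V) F}"
      using \<rho>\<pi> tree_relabel[OF E inj sgn] by auto
  qed
qed

section \<open>Rooted trees with given numbers of vertices\<close>

definition vertex_weight ::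
  "('d multiset \<Rightarrow> real) \<Rightarrow> ('d multiset \<Rightarrow> real) \<Rightarrow> int \<Rightarrow> 'd multiset \<Rightarrow> real" where
  "vertex_weight \<sigma> \<delta> v = (if v > 0 then \<sigma> else \<delta>)"

definition rooted_sum ::
  "('d multiset \<Rightarrow> real) \<Rightarrow> ('d multiset \<Rightarrow> real) \<Rightarrow> int \<Rightarrow> int set \<Rightarrow> 'd multiset \<Rightarrow> real" where
  "rooted_sum \<sigma> \<delta> r V M = tree_sum (vertex_weight \<sigma> \<delta>) V ((\<lambda>_. {#})(r := M))"

lemma bij_betw_with_root:
  assumes "finite A" "finite B" "card A = card B" "r \<in> A \<longleftrightarrow> r' \<in> B"
  obtains f where "bij_betw f A B" "r \<in> A \<longrightarrow> f r = r'"
proof (cases "r \<in> A")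
  case True
  with assms have "card (A - {r}) = card (B - {r'})" by simp
  then obtain f where f: "bij_betw f (A - {r}) (B - {r'})"
    using assms finite_same_card_bij[of "A - {r}" "B - {r'}"] by auto
  have "bij_betw (f(r := r')) (A - {r}) (B - {r'})"
    using f by (rule bij_betw_cong[THEN iffD1, rotated]) auto
  moreover have "bij_betw (f(r := r')) {r} {r'}" by simp
  ultimately have "bij_betw (f(r := r')) ((A - {r}) \<union> {r}) ((B - {r'}) \<union> {r'})"
    by (rule bij_betw_combine) auto
  moreover have "(A - {r}) \<union> {r} = A" "(B - {r'}) \<union> {r'} = B" using True assms by auto
  ultimately show ?thesis using that[of "f(r := r')"] by simp
next
  case False
  then show ?thesis using that finite_same_card_bij assms by metis
qed

text \<open>
  A bijection of the vertices that respects colours and roots carries trees to trees and preserves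
  amplitudes.
\<close>

lemma rooted_sum_card_cong:
  fixes \<sigma> \<delta> :: "'d::finite multiset \<Rightarrow> real"
  assumes fin: "finite V" "finite V'" and 0: "0 \<notin> V" "0 \<notin> V'" and r: "r \<in> V" "r' \<in> V'" "sgn r = sgn r'"
    and neg: "card {v \<in> V. v < 0} = card {v \<in> V'. v < 0}"
    and pos: "card {v \<in> V. v > 0} = card {v \<in> V'. v > 0}"
  shows "rooted_sum \<sigma> \<delta> r V M = rooted_sum \<sigma> \<delta> r' V' M"
proof -
  have sgn: "r < 0 \<longleftrightarrow> r' < 0" "r > 0 \<longleftrightarrow> r' > 0"
    using r(3) by (metis sgn_less sgn_greater)+
  obtain f where f: "bij_betw f {v \<in> V. v < 0} {v \<in> V'. v < 0}" "r < 0 \<longrightarrow> f r = r'"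
    using bij_betw_with_root[OF _ _ neg, of r r'] fin r sgn by auto
  obtain g where g: "bij_betw g {v \<in> V. v > 0} {v \<in> V'. v > 0}" "r > 0 \<longrightarrow> g r = r'"
    using bij_betw_with_root[OF _ _ pos, of r r'] fin r sgn by auto
  define \<pi> where "\<pi> v = (if v < 0 then f v else g v)" for v
  have "bij_betw \<pi> ({v \<in> V. v < 0} \<union> {v \<in> V. v > 0}) ({v \<in> V'. v < 0} \<union> {v \<in> V'. v > 0})"
  proof (rule bij_betw_combine)
    show "bij_betw \<pi> {v \<in> V. v < 0} {v \<in> V'. v < 0}"
      using f(1) by (rule bij_betw_cong[THEN iffD1, rotated]) (auto simp: \<pi>_def)
    show "bij_betw \<pi> {v \<in> V. v > 0} {v \<in> V'. v > 0}"
      using g(1) by (rule bij_betw_cong[THEN iffD1, rotated]) (auto simp: \<pi>_def)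
  qed auto
  moreover have "{v \<in> V. v < 0} \<union> {v \<in> V. v > 0} = V" "{v \<in> V'. v < 0} \<union> {v \<in> V'. v > 0} = V'"
    using 0 by (auto simp: not_less order_le_less)
  ultimately have bij: "bij_betw \<pi> V V'" by simp
  have \<pi>_sgn: "\<pi> v < 0 \<longleftrightarrow> v < 0" "\<pi> v > 0 \<longleftrightarrow> v > 0" if "v \<in> V" for v
  proof -
    have "v < 0 \<or> v > 0" using 0 that by (metis linorder_neqE)
    then have "(v < 0 \<and> \<pi> v < 0) \<or> (v > 0 \<and> \<pi> v > 0)"
      using bij_betwE[OF f(1)] bij_betwE[OF g(1)] that by (auto simp: \<pi>_def)
    then show "\<pi> v < 0 \<longleftrightarrow> v < 0" "\<pi> v > 0 \<longleftrightarrow> v > 0" by auto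
  qed
  have \<pi>r: "\<pi> r = r'"
    using f(2) g(2) 0 r by (auto simp: \<pi>_def not_less order_le_less)
  have inj: "inj_on \<pi> V" and img: "\<pi> ` V = V'" using bij by (auto simp: bij_betw_def)
  have "tree_sum (vertex_weight \<sigma> \<delta>) (\<pi> ` V) ((\<lambda>_. {#})(r' := M)) =
      tree_sum (vertex_weight \<sigma> \<delta>) V ((\<lambda>_. {#})(r := M))"
  proof (rule tree_sum_relabel[OF inj])
    fix v assume v: "v \<in> V"
    show "sgn (\<pi> v) = sgn v" using \<pi>_sgn[OF v] by (auto simp: sgn_if)
    show "vertex_weight \<sigma> \<delta> (\<pi> v) = vertex_weight \<sigma> \<delta> v"
      using \<pi>_sgn[OF v] by (simp add: vertex_weight_def)
    show "((\<lambda>_. {#})(r' := M)) (\<pi> v) = ((\<lambda>_. {#})(r := M)) v"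
      using inj_on_eq_iff[OF inj v r(1)] \<pi>r by simp
  qed
  then show ?thesis by (simp add: rooted_sum_def img)
qed

text \<open>
  The external legs \<open>M\<close> stay with the root \<open>r\<close>; the part \<open>U\<close> becomes a tree with root \<open>c\<close> and the single
  leg \<open>\<alpha>\<close>.
\<close>

lemma rooted_sum_cut:
  fixes \<sigma> \<delta> :: "'d::finite multiset \<Rightarrow> real"
  assumes "finite V" "r \<in> V" "v \<in> V" "v \<noteq> r"
  shows "rooted_sum \<sigma> \<delta> r V M = (\<Sum>U | U \<subseteq> V - {r} \<and> v \<in> U. \<Sum>c | c \<in> U \<and> r * c < 0. \<Sum>\<alpha>\<in>UNIV.
    rooted_sum \<sigma> \<delta> c U {#\<alpha>#} * rooted_sum \<sigma> \<delta> r (V - U) (add_mset \<alpha> M))"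
proof -
  let ?x = "(\<lambda>_. {#})(r := M)"
  have 1: "tree_sum \<tau> U (add_leg c \<alpha> ?x) = tree_sum \<tau> U ((\<lambda>_. {#})(c := {#\<alpha>#}))"
    if "U \<subseteq> V - {r}" for \<tau> :: "int \<Rightarrow> 'd multiset \<Rightarrow> real" and U c \<alpha>
    using that by (intro tree_sum_cong) auto
  have 2: "add_leg r \<alpha> ?x = (\<lambda>_. {#})(r := add_mset \<alpha> M)" for \<alpha> by auto
  show ?thesis
    unfolding rooted_sum_def tree_sum_cut[OF assms] 2
    by (intro sum.cong refl arg_cong2[where f = times] 1) auto
qed

lemma sum_Pow_card:
  fixes f :: "nat \<Rightarrow> real"
  assumes "finite A"
  shows "(\<Sum>I\<in>Pow A. f (card I)) = (\<Sum>i\<le>card A. real (card A choose i) * f i)"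
proof -
  have "(\<Sum>I\<in>Pow A. f (card I)) = (\<Sum>i\<le>card A. \<Sum>I | I \<in> Pow A \<and> card I = i. f (card I))"
    using assms by (intro sum.group[symmetric]) (auto simp: card_mono)
  also have "\<dots> = (\<Sum>i\<le>card A. real (card A choose i) * f i)"
    using assms by (intro sum.cong refl) (simp add: n_subsets)
  finally show ?thesis .
qed

lemma sum_subsets_by_card:
  fixes f :: "int set \<Rightarrow> real"
  assumes fin: "finite N" "finite B" and disj: "N \<inter> B = {}" "v \<notin> N \<union> B"
    and f: "\<And>I J. I \<subseteq> N \<Longrightarrow> J \<subseteq> B \<Longrightarrow> f (insert v (I \<union> J)) = h (card I) (card J)"
  shows "(\<Sum>U | U \<subseteq> insert v (N \<union> B) \<and> v \<in> U. f U) =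
    (\<Sum>i\<le>card N. \<Sum>j\<le>card B. real (card N choose i) * real (card B choose j) * h i j)"
proof -
  have "(\<Sum>U | U \<subseteq> insert v (N \<union> B) \<and> v \<in> U. f U) =
      (\<Sum>(I, J)\<in>Pow N \<times> Pow B. h (card I) (card J))"
  proof (rule sum.reindex_bij_witness[where i = "\<lambda>(I, J). insert v (I \<union> J)" and
        j = "\<lambda>U. (U \<inter> N, U \<inter> B)"])
    fix U assume U: "U \<in> {U. U \<subseteq> insert v (N \<union> B) \<and> v \<in> U}"
    then show eq: "(case (U \<inter> N, U \<inter> B) of (I, J) \<Rightarrow> insert v (I \<union> J)) = U" by auto
    show "(U \<inter> N, U \<inter> B) \<in> Pow N \<times> Pow B" by auto
    show "(case (U \<inter> N, U \<inter> B) of (I, J) \<Rightarrow> h (card I) (card J)) = f U"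
      using f[of "U \<inter> N" "U \<inter> B"] eq by simp
  next
    fix p assume "p \<in> Pow N \<times> Pow B"
    then obtain I J where p: "p = (I, J)" "I \<subseteq> N" "J \<subseteq> B" by auto
    have "insert v (I \<union> J) \<inter> N = I" "insert v (I \<union> J) \<inter> B = J" using p disj by auto
    then show "((case p of (I, J) \<Rightarrow> insert v (I \<union> J)) \<inter> N, (case p of (I, J) \<Rightarrow> insert v (I \<union> J)) \<inter> B) = p"
      by (simp add: p)
    show "(case p of (I, J) \<Rightarrow> insert v (I \<union> J)) \<in> {U. U \<subseteq> insert v (N \<union> B) \<and> v \<in> U}"
      using p by auto
  qed
  also have "\<dots> = (\<Sum>I\<in>Pow N. \<Sum>J\<in>Pow B. h (card I) (card J))"
    by (simp add: sum.cartesian_product)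
  also have "\<dots> = (\<Sum>I\<in>Pow N. \<Sum>j\<le>card B. real (card B choose j) * h (card I) j)"
    by (intro sum.cong refl sum_Pow_card fin)
  also have "\<dots> = (\<Sum>i\<le>card N. real (card N choose i) * (\<Sum>j\<le>card B. real (card B choose j) * h i j))"
    by (rule sum_Pow_card[OF fin(1)])
  finally show ?thesis by (simp add: sum_distrib_left mult_ac)
qed

text \<open>
  The root is not counted: it is accompanied by \<open>m\<close> white and \<open>n\<close> black vertices.
\<close>

definition white_rooted ::
  "('d multiset \<Rightarrow> real) \<Rightarrow> ('d multiset \<Rightarrow> real) \<Rightarrow> nat \<Rightarrow> nat \<Rightarrow> 'd multiset \<Rightarrow> real" where
  "white_rooted \<sigma> \<delta> m n M = rooted_sum \<sigma> \<delta> (-1) ({- int (Suc m)..-1} \<union> {1..int n}) M"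

definition black_rooted ::
  "('d multiset \<Rightarrow> real) \<Rightarrow> ('d multiset \<Rightarrow> real) \<Rightarrow> nat \<Rightarrow> nat \<Rightarrow> 'd multiset \<Rightarrow> real" where
  "black_rooted \<sigma> \<delta> m n M = rooted_sum \<sigma> \<delta> 1 ({- int m..-1} \<union> {1..int (Suc n)}) M"

lemma canonical_parts:
  "{v \<in> {- int m..-1} \<union> {1..int n}. v < 0} = {- int m..-1}"
  "{v \<in> {- int m..-1} \<union> {1..int n}. v > 0} = {1..int n}"
  by auto

lemma rooted_sum_white:
  fixes \<sigma> \<delta> :: "'d::finite multiset \<Rightarrow> real"
  assumes "finite N" "finite B" "\<And>v. v \<in> N \<Longrightarrow> v < 0" "\<And>v. v \<in> B \<Longrightarrow> v > 0" "r < 0" "r \<notin> N"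
  shows "rooted_sum \<sigma> \<delta> r (insert r (N \<union> B)) M = white_rooted \<sigma> \<delta> (card N) (card B) M"
proof -
  have *: "{v \<in> insert r (N \<union> B). v < 0} = insert r N" "{v \<in> insert r (N \<union> B). v > 0} = B"
    using assms(3-5) by force+
  show ?thesis unfolding white_rooted_def
  proof (rule rooted_sum_card_cong)
    show "card {v \<in> insert r (N \<union> B). v < 0} = card {v \<in> {- int (Suc (card N))..-1} \<union> {1..int (card B)}. v < 0}"
      "card {v \<in> insert r (N \<union> B). v > 0} = card {v \<in> {- int (Suc (card N))..-1} \<union> {1..int (card B)}. v > 0}"
      unfolding * canonical_parts using assms by simp_all
  qed (use assms in auto)
qed

lemma rooted_sum_black:
  fixes \<sigma> \<delta> :: "'d::finite multiset \<Rightarrow> real"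
  assumes "finite N" "finite B" "\<And>v. v \<in> N \<Longrightarrow> v < 0" "\<And>v. v \<in> B \<Longrightarrow> v > 0" "r > 0" "r \<notin> B"
  shows "rooted_sum \<sigma> \<delta> r (insert r (N \<union> B)) M = black_rooted \<sigma> \<delta> (card N) (card B) M"
proof -
  have *: "{v \<in> insert r (N \<union> B). v < 0} = N" "{v \<in> insert r (N \<union> B). v > 0} = insert r B"
    using assms(3-5) by force+
  show ?thesis unfolding black_rooted_def
  proof (rule rooted_sum_card_cong)
    show "card {v \<in> insert r (N \<union> B). v < 0} = card {v \<in> {- int (card N)..-1} \<union> {1..int (Suc (card B))}. v < 0}"
      "card {v \<in> insert r (N \<union> B). v > 0} = card {v \<in> {- int (card N)..-1} \<union> {1..int (Suc (card B))}. v > 0}"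
      unfolding * canonical_parts using assms by simp_all
  qed (use assms in auto)
qed

text \<open>
  The part that is cut off contains the marked white vertex \<open>-2\<close>, \<open>i\<close> further white vertices and \<open>j\<close>
  black ones. Its root \<open>c\<close> is one of these \<open>j\<close> black vertices, so it is a black-rooted tree with \<open>i + 1\<close> white
  and \<open>j - 1\<close> other black vertices. For \<open>j = 0\<close> the truncated subtraction is harmless because
  of the factor \<open>j\<close>.
\<close>

lemma white_rooted_rec:
  fixes \<sigma> \<delta> :: "'d::finite multiset \<Rightarrow> real"
  shows "white_rooted \<sigma> \<delta> (Suc m) n M = (\<Sum>i\<le>m. \<Sum>j\<le>n. real (m choose i) * real (n choose j) *
    (real j * (\<Sum>\<alpha>\<in>UNIV. black_rooted \<sigma> \<delta> (Suc i) (j - 1) {#\<alpha>#} *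
      white_rooted \<sigma> \<delta> (m - i) (n - j) (add_mset \<alpha> M))))"
proof -
  define N where "N = {- int (Suc (Suc m))..-3}"
  define B where "B = {1..int n}"
  define V where "V = insert (-1) (insert (-2) N \<union> B)"
  have NB: "finite N" "finite B" "card N = m" "card B = n" "N \<inter> B = {}" "-2 \<notin> N \<union> B" "-1 \<notin> N \<union> B"
    "\<And>v. v \<in> N \<Longrightarrow> v < 0" "\<And>v. v \<in> B \<Longrightarrow> v > 0"
    by (auto simp: N_def B_def)
  let ?f = "\<lambda>U. \<Sum>c | c \<in> U \<and> (-1) * c < 0. \<Sum>\<alpha>\<in>UNIV.
    rooted_sum \<sigma> \<delta> c U {#\<alpha>#} * rooted_sum \<sigma> \<delta> (-1) (V - U) (add_mset \<alpha> M)"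
  have "rooted_sum \<sigma> \<delta> (-1) V M = white_rooted \<sigma> \<delta> (card (insert (-2) N)) (card B) M"
    unfolding V_def by (rule rooted_sum_white) (use NB in auto)
  then have "white_rooted \<sigma> \<delta> (Suc m) n M = rooted_sum \<sigma> \<delta> (-1) V M"
    using NB by simp
  also have "\<dots> = (\<Sum>U | U \<subseteq> V - {-1} \<and> -2 \<in> U. ?f U)"
    by (rule rooted_sum_cut) (use NB in \<open>auto simp: V_def\<close>)
  also have "V - {-1} = insert (-2) (N \<union> B)" using NB by (auto simp: V_def)
  also have "(\<Sum>U | U \<subseteq> insert (-2) (N \<union> B) \<and> -2 \<in> U. ?f U) =
    (\<Sum>i\<le>card N. \<Sum>j\<le>card B. real (card N choose i) * real (card B choose j) *
      (real j * (\<Sum>\<alpha>\<in>UNIV. black_rooted \<sigma> \<delta> (Suc i) (j - 1) {#\<alpha>#} *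
      white_rooted \<sigma> \<delta> (m - i) (n - j) (add_mset \<alpha> M))))"
  proof (rule sum_subsets_by_card)
    fix I J assume I: "I \<subseteq> N" and J: "J \<subseteq> B"
    have fin: "finite I" "finite J" using I J NB finite_subset by auto
    let ?U = "insert (-2) (I \<union> J)"
    have "{c. c \<in> ?U \<and> (-1) * c < 0} = J" using I J NB by force
    moreover have "rooted_sum \<sigma> \<delta> c ?U {#\<alpha>#} = black_rooted \<sigma> \<delta> (Suc (card I)) (card J - 1) {#\<alpha>#}"
      if "c \<in> J" for c \<alpha>
    proof -
      have U: "?U = insert c (insert (-2) I \<union> (J - {c}))" using that by auto
      have "-2 \<notin> I" using I NB by auto
      then show ?thesis unfolding U using fin I J NB that
        by (subst rooted_sum_black) (auto simp: subset_iff)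
    qed
    moreover have "rooted_sum \<sigma> \<delta> (-1) (V - ?U) M' = white_rooted \<sigma> \<delta> (m - card I) (n - card J) M'" for M'
    proof -
      have U: "V - ?U = insert (-1) ((N - I) \<union> (B - J))"
        using I J NB by (auto simp: V_def)
      show ?thesis unfolding U using fin I J NB
        by (subst rooted_sum_white) (auto simp: card_Diff_subset)
    qed
    ultimately show "?f ?U = real (card J) * (\<Sum>\<alpha>\<in>UNIV. black_rooted \<sigma> \<delta> (Suc (card I)) (card J - 1) {#\<alpha>#} *
      white_rooted \<sigma> \<delta> (m - card I) (n - card J) (add_mset \<alpha> M))" by simp
  qed (use NB in auto)
  finally show ?thesis using NB by simp
qed

text \<open>
  The part that is cut off contains the marked white vertex \<open>-1\<close>, \<open>i\<close> further white vertices and \<open>j\<close>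
  black ones; its root is one of the \<open>i + 1\<close> white vertices.
\<close>

lemma black_rooted_rec:
  fixes \<sigma> \<delta> :: "'d::finite multiset \<Rightarrow> real"
  shows "black_rooted \<sigma> \<delta> (Suc m) n M = (\<Sum>i\<le>m. \<Sum>j\<le>n. real (m choose i) * real (n choose j) *
    (real (Suc i) * (\<Sum>\<alpha>\<in>UNIV. white_rooted \<sigma> \<delta> i j {#\<alpha>#} *
      black_rooted \<sigma> \<delta> (m - i) (n - j) (add_mset \<alpha> M))))"
proof -
  define N where "N = {- int (Suc m)..-2}"
  define B where "B = {2..int (Suc n)}"
  define V where "V = insert 1 (insert (-1) N \<union> B)"
  have NB: "finite N" "finite B" "card N = m" "card B = n" "N \<inter> B = {}" "-1 \<notin> N \<union> B" "1 \<notin> N \<union> B"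
    "\<And>v. v \<in> N \<Longrightarrow> v < 0" "\<And>v. v \<in> B \<Longrightarrow> v > 0"
    by (auto simp: N_def B_def)
  let ?f = "\<lambda>U. \<Sum>c | c \<in> U \<and> 1 * c < 0. \<Sum>\<alpha>\<in>UNIV.
    rooted_sum \<sigma> \<delta> c U {#\<alpha>#} * rooted_sum \<sigma> \<delta> 1 (V - U) (add_mset \<alpha> M)"
  have "rooted_sum \<sigma> \<delta> 1 V M = black_rooted \<sigma> \<delta> (card (insert (-1) N)) (card B) M"
    unfolding V_def by (rule rooted_sum_black) (use NB in auto)
  then have "black_rooted \<sigma> \<delta> (Suc m) n M = rooted_sum \<sigma> \<delta> 1 V M"
    using NB by simp
  also have "\<dots> = (\<Sum>U | U \<subseteq> V - {1} \<and> -1 \<in> U. ?f U)"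
    by (rule rooted_sum_cut) (use NB in \<open>auto simp: V_def\<close>)
  also have "V - {1} = insert (-1) (N \<union> B)" using NB by (auto simp: V_def)
  also have "(\<Sum>U | U \<subseteq> insert (-1) (N \<union> B) \<and> -1 \<in> U. ?f U) =
    (\<Sum>i\<le>card N. \<Sum>j\<le>card B. real (card N choose i) * real (card B choose j) *
      (real (Suc i) * (\<Sum>\<alpha>\<in>UNIV. white_rooted \<sigma> \<delta> i j {#\<alpha>#} *
      black_rooted \<sigma> \<delta> (m - i) (n - j) (add_mset \<alpha> M))))"
  proof (rule sum_subsets_by_card)
    fix I J assume I: "I \<subseteq> N" and J: "J \<subseteq> B"
    have fin: "finite I" "finite J" using I J NB finite_subset by auto
    have I1: "-1 \<notin> I" using I NB by auto
    let ?U = "insert (-1) (I \<union> J)"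
    have "{c. c \<in> ?U \<and> 1 * c < 0} = insert (-1) I" using I J NB by force
    moreover have "rooted_sum \<sigma> \<delta> c ?U {#\<alpha>#} = white_rooted \<sigma> \<delta> (card I) (card J) {#\<alpha>#}"
      if "c \<in> insert (-1) I" for c \<alpha>
    proof -
      have U: "?U = insert c ((insert (-1) I - {c}) \<union> J)" using that by auto
      have "card (insert (-1) I - {c}) = card I" using that fin I1 by simp
      then show ?thesis unfolding U using fin I J NB that
        by (subst rooted_sum_white) (auto simp: subset_iff)
    qed
    moreover have "rooted_sum \<sigma> \<delta> 1 (V - ?U) M' = black_rooted \<sigma> \<delta> (m - card I) (n - card J) M'" for M'
    proof -
      have U: "V - ?U = insert 1 ((N - I) \<union> (B - J))"
        using I J NB by (auto simp: V_def)
      show ?thesis unfolding U using fin I J NB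
        by (subst rooted_sum_black) (auto simp: card_Diff_subset)
    qed
    ultimately show "?f ?U = real (Suc (card I)) * (\<Sum>\<alpha>\<in>UNIV. white_rooted \<sigma> \<delta> (card I) (card J) {#\<alpha>#} *
      black_rooted \<sigma> \<delta> (m - card I) (n - card J) (add_mset \<alpha> M))" using fin I1 by simp
  qed (use NB in auto)
  finally show ?thesis using NB by simp
qed

section \<open>Generating series of rooted trees\<close>

definition kills_leaves :: "('d multiset \<Rightarrow> real) \<Rightarrow> bool" where
  "kills_leaves \<sigma> \<longleftrightarrow> (\<forall>\<alpha>. \<sigma> {#\<alpha>#} = 0)"

lemma kills_leavesD: "kills_leaves \<sigma> \<Longrightarrow> \<sigma> {#\<alpha>#} = 0"
  by (simp add: kills_leaves_def)

text \<open>
  Every edge has exactly one black end, so the degrees of black vertices add up to at most the number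
  of edges, which is one less than the number of vertices.
\<close>

lemma tree_black_degree_bound:
  assumes t: "tree V E" and K: "K \<subseteq> V" "\<And>v. v \<in> K \<Longrightarrow> v > 0"
    and deg: "\<And>v. v \<in> K \<Longrightarrow> card (edges_touching E v) \<ge> 2"
  shows "2 * card K < card V"
proof -
  have fin: "finite E" "finite K" using tree_finite[OF t] K finite_subset by auto
  have "2 * card K \<le> (\<Sum>v\<in>K. card (edges_touching E v))"
    using sum_bounded_below[of K 2 "\<lambda>v. card (edges_touching E v)"] deg by (simp add: mult.commute)
  also have "\<dots> = card (\<Union>v\<in>K. edges_touching E v)"
  proof (rule card_UN_disjoint[symmetric])
    show "\<forall>v\<in>K. \<forall>w\<in>K. v \<noteq> w \<longrightarrow> edges_touching E v \<inter> edges_touching E w = {}"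
      using K(2) tree_edges[OF t] by (fastforce simp: edges_touching_def)
  qed (use fin in \<open>auto simp: edges_touching_def\<close>)
  also have "\<dots> \<le> card E"
    using fin by (intro card_mono) (auto simp: edges_touching_def)
  finally show ?thesis using tree_card[OF t] by simp
qed

lemma tree_degree_pos:
  assumes "tree V E" "v \<in> V" "V \<noteq> {v}"
  shows "card (edges_touching E v) \<ge> 1"
proof -
  have "edges_touching E v \<noteq> {}" using tree_incident[OF assms(1,2)] assms(3) unfolding edges_touching_def by blast
  moreover have "finite (edges_touching E v)" using tree_finite[OF assms(1)] by (simp add: edges_touching_def)
  ultimately show ?thesis by (simp add: Suc_le_eq card_gt_0_iff)
qed

lemma amp_black_leaf:
  assumes t: "tree V E" "v \<in> V" "v > 0" "card (edges_touching E v) = 1" "x v = {#}"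
    and \<sigma>: "kills_leaves \<sigma>"
  shows "amp (vertex_weight \<sigma> \<delta>) V E x = 0"
  unfolding amp_def
proof (rule sum.neutral, rule ballI)
  fix a
  obtain e where "edges_touching E v = {e}" using t(4) by (auto simp: card_1_singleton_iff)
  then have "vertex_weight \<sigma> \<delta> v (x v + legs a E v) = 0"
    using t kills_leavesD[OF \<sigma>] by (simp add: legs_def vertex_weight_def)
  then show "(\<Prod>v\<in>V. vertex_weight \<sigma> \<delta> v (x v + legs a E v)) = 0"
    using t(2) tree_finite[OF t(1)] by (intro prod_zero) blast+
qed

text \<open>
  In a tree with this many black vertices some black vertex other than the root is a leaf, and
  its weight vanishes. In the generating series this makes the sum over the number of black
  vertices finite at each order in \<open>\<epsilon>\<close>.
\<close>

lemma rooted_sum_eq_0: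
  assumes \<sigma>: "kills_leaves \<sigma>" and r: "r \<in> V" and many: "card V \<le> 2 * card {v \<in> V - {r}. v > 0}"
  shows "rooted_sum \<sigma> \<delta> r V M = 0"
  unfolding rooted_sum_def tree_sum_def
proof (rule sum.neutral, rule ballI)
  fix E assume "E \<in> {E. tree V E}"
  then have t: "tree V E" by simp
  obtain v where v: "v \<in> V" "v \<noteq> r" "v > 0" "card (edges_touching E v) < 2"
    using tree_black_degree_bound[OF t, of "{v \<in> V - {r}. v > 0}"] many by fastforce
  then have "card (edges_touching E v) \<ge> 1" using tree_degree_pos[OF t v(1)] r by blast
  with v show "amp (vertex_weight \<sigma> \<delta>) V E ((\<lambda>_. {#})(r := M)) = 0"
    by (intro amp_black_leaf[OF t v(1,3)] \<sigma>) auto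
qed

lemma white_rooted_eq_0:
  assumes "kills_leaves \<sigma>" "n > m"
  shows "white_rooted \<sigma> \<delta> m n M = 0"
  unfolding white_rooted_def
proof (rule rooted_sum_eq_0[OF assms(1)])
  have "{v \<in> {- int (Suc m)..-1} \<union> {1..int n} - {-1}. v > 0} = {1..int n}" by auto
  then show "card ({- int (Suc m)..-1} \<union> {1..int n}) \<le> 2 * card {v \<in> {- int (Suc m)..-1} \<union> {1..int n} - {-1}. v > 0}"
    using assms(2) by (simp add: card_Un_disjoint ivl_disj_int_two)
qed simp

lemma black_rooted_eq_0:
  assumes "kills_leaves \<sigma>" "n > m"
  shows "black_rooted \<sigma> \<delta> m n M = 0"
  unfolding black_rooted_def
proof (rule rooted_sum_eq_0[OF assms(1)])
  have "{v \<in> {- int m..-1} \<union> {1..int (Suc n)} - {1}. v > 0} = {2..int (Suc n)}" by auto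
  then show "card ({- int m..-1} \<union> {1..int (Suc n)}) \<le> 2 * card {v \<in> {- int m..-1} \<union> {1..int (Suc n)} - {1}. v > 0}"
    using assms(2) by (simp add: card_Un_disjoint ivl_disj_int_two)
qed simp

text \<open>
  The number of black vertices is recorded by the exponent of an auxiliary variable, so that binomial
  convolutions over it become products of polynomials. The variable is finally set to \<open>1\<close>.
\<close>

definition white_poly ::
  "('d multiset \<Rightarrow> real) \<Rightarrow> ('d multiset \<Rightarrow> real) \<Rightarrow> nat \<Rightarrow> 'd multiset \<Rightarrow> real poly" where
  "white_poly \<sigma> \<delta> m M = (\<Sum>n\<le>m. monom (white_rooted \<sigma> \<delta> m n M / (fact m * fact n)) n)"

definition black_poly ::
  "('d multiset \<Rightarrow> real) \<Rightarrow> ('d multiset \<Rightarrow> real) \<Rightarrow> nat \<Rightarrow> 'd multiset \<Rightarrow> real poly" where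
  "black_poly \<sigma> \<delta> m M = (\<Sum>n\<le>m. monom (black_rooted \<sigma> \<delta> m n M / (fact m * fact n)) n)"

lemma coeff_white_poly:
  assumes "kills_leaves \<sigma>"
  shows "coeff (white_poly \<sigma> \<delta> m M) n = white_rooted \<sigma> \<delta> m n M / (fact m * fact n)"
proof -
  have "coeff (white_poly \<sigma> \<delta> m M) n =
      (\<Sum>k\<le>m. if k = n then white_rooted \<sigma> \<delta> m k M / (fact m * fact k) else 0)"
    by (simp add: white_poly_def coeff_sum)
  then show ?thesis using white_rooted_eq_0[of \<sigma> m n \<delta> M] assms by auto
qed

lemma coeff_black_poly:
  assumes "kills_leaves \<sigma>"
  shows "coeff (black_poly \<sigma> \<delta> m M) n = black_rooted \<sigma> \<delta> m n M / (fact m * fact n)"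
proof -
  have "coeff (black_poly \<sigma> \<delta> m M) n =
      (\<Sum>k\<le>m. if k = n then black_rooted \<sigma> \<delta> m k M / (fact m * fact k) else 0)"
    by (simp add: black_poly_def coeff_sum)
  then show ?thesis using black_rooted_eq_0[of \<sigma> m n \<delta> M] assms by auto
qed

text \<open>
  The factor \<open>j\<close> in the recursion, for the choice of \<open>c\<close>, turns \<open>j!\<close> into \<open>(j - 1)!\<close>, and \<open>pCons 0\<close> accounts
  for the black vertex \<open>c\<close> itself.
\<close>

lemma white_poly_rec:
  fixes \<sigma> \<delta> :: "'d::finite multiset \<Rightarrow> real"
  assumes \<sigma>: "kills_leaves \<sigma>"
  shows "smult (real (Suc m)) (white_poly \<sigma> \<delta> (Suc m) M) =
    (\<Sum>i\<le>m. \<Sum>\<alpha>\<in>UNIV. smult (real (Suc i)) (pCons 0 (black_poly \<sigma> \<delta> (Suc i) {#\<alpha>#})) *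
       white_poly \<sigma> \<delta> (m - i) (add_mset \<alpha> M))"
proof (rule poly_eqI)
  fix n
  note coeffs = coeff_white_poly[OF \<sigma>] coeff_black_poly[OF \<sigma>]
  have summand: "real (m choose i) * real (n choose j) * (real j * (X * Y)) / (fact m * fact n) =
     real (Suc i) * (if j = 0 then 0 else X / (fact (Suc i) * fact (j - 1))) * (Y / (fact (m - i) * fact (n - j)))"
    if "i \<le> m" "j \<le> n" for i j and X Y :: real
  proof (cases j)
    case (Suc k)
    then show ?thesis using that
      by (simp add: binomial_fact field_simps del: of_nat_Suc)
  qed simp
  have "coeff (smult (real (Suc m)) (white_poly \<sigma> \<delta> (Suc m) M)) n =
      white_rooted \<sigma> \<delta> (Suc m) n M / (fact m * fact n)"
    by (simp add: coeffs fact_Suc del: of_nat_Suc)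
  also have "\<dots> = (\<Sum>i\<le>m. \<Sum>j\<le>n. \<Sum>\<alpha>\<in>UNIV. real (m choose i) * real (n choose j) *
    (real j * (black_rooted \<sigma> \<delta> (Suc i) (j - 1) {#\<alpha>#} *
      white_rooted \<sigma> \<delta> (m - i) (n - j) (add_mset \<alpha> M))) / (fact m * fact n))"
    by (simp only: white_rooted_rec sum_divide_distrib sum_distrib_left)
  also have "\<dots> = (\<Sum>i\<le>m. \<Sum>j\<le>n. \<Sum>\<alpha>\<in>UNIV.
      coeff (smult (real (Suc i)) (pCons 0 (black_poly \<sigma> \<delta> (Suc i) {#\<alpha>#}))) j *
      coeff (white_poly \<sigma> \<delta> (m - i) (add_mset \<alpha> M)) (n - j))"
    by (intro sum.cong refl, subst summand)
      (auto simp: coeffs coeff_pCons split: nat.split)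
  also have "\<dots> = (\<Sum>i\<le>m. \<Sum>\<alpha>\<in>UNIV. \<Sum>j\<le>n.
      coeff (smult (real (Suc i)) (pCons 0 (black_poly \<sigma> \<delta> (Suc i) {#\<alpha>#}))) j *
      coeff (white_poly \<sigma> \<delta> (m - i) (add_mset \<alpha> M)) (n - j))"
    by (intro sum.cong refl sum.swap)
  finally show "coeff (smult (real (Suc m)) (white_poly \<sigma> \<delta> (Suc m) M)) n =
    coeff (\<Sum>i\<le>m. \<Sum>\<alpha>\<in>UNIV. smult (real (Suc i)) (pCons 0 (black_poly \<sigma> \<delta> (Suc i) {#\<alpha>#})) *
       white_poly \<sigma> \<delta> (m - i) (add_mset \<alpha> M)) n"
    by (simp only: coeff_sum coeff_mult)
qed

lemma black_poly_rec:
  fixes \<sigma> \<delta> :: "'d::finite multiset \<Rightarrow> real"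
  assumes \<sigma>: "kills_leaves \<sigma>"
  shows "smult (real (Suc m)) (black_poly \<sigma> \<delta> (Suc m) M) =
    (\<Sum>i\<le>m. \<Sum>\<alpha>\<in>UNIV. smult (real (Suc i)) (white_poly \<sigma> \<delta> i {#\<alpha>#}) *
       black_poly \<sigma> \<delta> (m - i) (add_mset \<alpha> M))"
proof (rule poly_eqI)
  fix n
  note coeffs = coeff_white_poly[OF \<sigma>] coeff_black_poly[OF \<sigma>]
  have summand: "real (m choose i) * real (n choose j) * (real (Suc i) * (X * Y)) / (fact m * fact n) =
     real (Suc i) * (X / (fact i * fact j)) * (Y / (fact (m - i) * fact (n - j)))"
    if "i \<le> m" "j \<le> n" for i j and X Y :: real
    using that by (simp add: binomial_fact field_simps del: of_nat_Suc)
  have "coeff (smult (real (Suc m)) (black_poly \<sigma> \<delta> (Suc m) M)) n =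
      black_rooted \<sigma> \<delta> (Suc m) n M / (fact m * fact n)"
    by (simp add: coeffs fact_Suc del: of_nat_Suc)
  also have "\<dots> = (\<Sum>i\<le>m. \<Sum>j\<le>n. \<Sum>\<alpha>\<in>UNIV. real (m choose i) * real (n choose j) *
    (real (Suc i) * (white_rooted \<sigma> \<delta> i j {#\<alpha>#} *
      black_rooted \<sigma> \<delta> (m - i) (n - j) (add_mset \<alpha> M))) / (fact m * fact n))"
    by (simp only: black_rooted_rec sum_divide_distrib sum_distrib_left)
  also have "\<dots> = (\<Sum>i\<le>m. \<Sum>j\<le>n. \<Sum>\<alpha>\<in>UNIV.
      coeff (smult (real (Suc i)) (white_poly \<sigma> \<delta> i {#\<alpha>#})) j *
      coeff (black_poly \<sigma> \<delta> (m - i) (add_mset \<alpha> M)) (n - j))"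
    by (intro sum.cong refl, subst summand) (auto simp: coeffs)
  also have "\<dots> = (\<Sum>i\<le>m. \<Sum>\<alpha>\<in>UNIV. \<Sum>j\<le>n.
      coeff (smult (real (Suc i)) (white_poly \<sigma> \<delta> i {#\<alpha>#})) j *
      coeff (black_poly \<sigma> \<delta> (m - i) (add_mset \<alpha> M)) (n - j))"
    by (intro sum.cong refl sum.swap)
  finally show "coeff (smult (real (Suc m)) (black_poly \<sigma> \<delta> (Suc m) M)) n =
    coeff (\<Sum>i\<le>m. \<Sum>\<alpha>\<in>UNIV. smult (real (Suc i)) (white_poly \<sigma> \<delta> i {#\<alpha>#}) *
       black_poly \<sigma> \<delta> (m - i) (add_mset \<alpha> M)) n"
    by (simp only: coeff_sum coeff_mult)
qed

definition white_series ::
  "('d multiset \<Rightarrow> real) \<Rightarrow> ('d multiset \<Rightarrow> real) \<Rightarrow> 'd multiset \<Rightarrow> real fps" where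
  "white_series \<sigma> \<delta> M = Abs_fps (\<lambda>m. \<Sum>n\<le>m. white_rooted \<sigma> \<delta> m n M / (fact m * fact n))"

definition black_series ::
  "('d multiset \<Rightarrow> real) \<Rightarrow> ('d multiset \<Rightarrow> real) \<Rightarrow> 'd multiset \<Rightarrow> real fps" where
  "black_series \<sigma> \<delta> M = Abs_fps (\<lambda>m. \<Sum>n\<le>m. black_rooted \<sigma> \<delta> m n M / (fact m * fact n))"

lemma white_series_nth_poly: "fps_nth (white_series \<sigma> \<delta> M) m = poly (white_poly \<sigma> \<delta> m M) 1"
  by (simp add: white_series_def white_poly_def poly_sum poly_monom)

lemma black_series_nth_poly: "fps_nth (black_series \<sigma> \<delta> M) m = poly (black_poly \<sigma> \<delta> m M) 1"
  by (simp add: black_series_def black_poly_def poly_sum poly_monom)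

text \<open>
  Differentiation marks a white vertex other than the root, and the cut splits off the black-rooted tree that
  contains it. In that tree the marked vertex is again one of the counted white vertices, hence
  the derivative on \<open>black_series\<close>.
\<close>

lemma fps_deriv_white_series:
  fixes \<sigma> \<delta> :: "'d::finite multiset \<Rightarrow> real"
  assumes \<sigma>: "kills_leaves \<sigma>"
  shows "fps_deriv (white_series \<sigma> \<delta> M) =
    (\<Sum>\<alpha>\<in>UNIV. fps_deriv (black_series \<sigma> \<delta> {#\<alpha>#}) * white_series \<sigma> \<delta> (add_mset \<alpha> M))"
proof (rule fps_ext)
  fix m
  have "fps_nth (fps_deriv (white_series \<sigma> \<delta> M)) m = poly (smult (real (Suc m)) (white_poly \<sigma> \<delta> (Suc m) M)) 1"
    by (simp add: white_series_nth_poly)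
  also have "\<dots> = (\<Sum>i\<le>m. \<Sum>\<alpha>\<in>UNIV. fps_nth (fps_deriv (black_series \<sigma> \<delta> {#\<alpha>#})) i *
      fps_nth (white_series \<sigma> \<delta> (add_mset \<alpha> M)) (m - i))"
    unfolding white_poly_rec[OF \<sigma>]
    by (simp add: poly_sum white_series_nth_poly black_series_nth_poly mult.assoc)
  also have "\<dots> = (\<Sum>\<alpha>\<in>UNIV. \<Sum>i\<le>m. fps_nth (fps_deriv (black_series \<sigma> \<delta> {#\<alpha>#})) i *
      fps_nth (white_series \<sigma> \<delta> (add_mset \<alpha> M)) (m - i))"
    by (rule sum.swap)
  finally show "fps_nth (fps_deriv (white_series \<sigma> \<delta> M)) m =
    fps_nth (\<Sum>\<alpha>\<in>UNIV. fps_deriv (black_series \<sigma> \<delta> {#\<alpha>#}) * white_series \<sigma> \<delta> (add_mset \<alpha> M)) m"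
    by (simp only: fps_sum_nth fps_mult_nth atLeast0AtMost)
qed

text \<open>
  The tree that is split off has a white root which the exponent in \<open>white_series\<close> omits; the factor
  \<open>fps_X\<close> restores it.
\<close>

lemma fps_deriv_black_series:
  fixes \<sigma> \<delta> :: "'d::finite multiset \<Rightarrow> real"
  assumes \<sigma>: "kills_leaves \<sigma>"
  shows "fps_deriv (black_series \<sigma> \<delta> M) =
    (\<Sum>\<alpha>\<in>UNIV. fps_deriv (fps_X * white_series \<sigma> \<delta> {#\<alpha>#}) * black_series \<sigma> \<delta> (add_mset \<alpha> M))"
proof (rule fps_ext)
  fix m
  have nth: "fps_nth (fps_deriv (fps_X * white_series \<sigma> \<delta> {#\<alpha>#})) i =
      real (Suc i) * poly (white_poly \<sigma> \<delta> i {#\<alpha>#}) 1" for i \<alpha>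
    by (simp add: white_series_nth_poly del: fps_deriv_mult)
  have "fps_nth (fps_deriv (black_series \<sigma> \<delta> M)) m = poly (smult (real (Suc m)) (black_poly \<sigma> \<delta> (Suc m) M)) 1"
    by (simp add: black_series_nth_poly)
  also have "\<dots> = (\<Sum>i\<le>m. \<Sum>\<alpha>\<in>UNIV. fps_nth (fps_deriv (fps_X * white_series \<sigma> \<delta> {#\<alpha>#})) i *
      fps_nth (black_series \<sigma> \<delta> (add_mset \<alpha> M)) (m - i))"
    unfolding black_poly_rec[OF \<sigma>] nth
    by (simp add: poly_sum black_series_nth_poly mult.assoc)
  also have "\<dots> = (\<Sum>\<alpha>\<in>UNIV. \<Sum>i\<le>m. fps_nth (fps_deriv (fps_X * white_series \<sigma> \<delta> {#\<alpha>#})) i *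
      fps_nth (black_series \<sigma> \<delta> (add_mset \<alpha> M)) (m - i))"
    by (rule sum.swap)
  finally show "fps_nth (fps_deriv (black_series \<sigma> \<delta> M)) m =
    fps_nth (\<Sum>\<alpha>\<in>UNIV. fps_deriv (fps_X * white_series \<sigma> \<delta> {#\<alpha>#}) * black_series \<sigma> \<delta> (add_mset \<alpha> M)) m"
    by (simp only: fps_sum_nth fps_mult_nth atLeast0AtMost)
qed

lemma tree_singleton_iff: "tree {v} E \<longleftrightarrow> E = {}"
proof
  assume t: "tree {v} E"
  then have "card E = 0" using tree_card by fastforce
  then show "E = {}" using tree_finite[OF t] by simp
qed (simp add: single)

lemma rooted_sum_singleton: "rooted_sum \<sigma> \<delta> r {r} M = vertex_weight \<sigma> \<delta> r M"
proof -
  have "{E. tree {r} E} = {{}}" by (auto simp: tree_singleton_iff)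
  then show ?thesis by (simp add: rooted_sum_def tree_sum_def amp_def legs_def edges_touching_def)
qed

lemma white_series_nth_0: "fps_nth (white_series \<sigma> \<delta> M) 0 = \<delta> M"
proof -
  have "{- int (Suc 0)..-1} \<union> {1..int 0} = {-1}" by auto
  then have "white_rooted \<sigma> \<delta> 0 0 M = \<delta> M"
    by (simp only: white_rooted_def rooted_sum_singleton) (simp add: vertex_weight_def)
  then show ?thesis by (simp add: white_series_def)
qed

lemma black_series_nth_0: "fps_nth (black_series \<sigma> \<delta> M) 0 = \<sigma> M"
proof -
  have "{- int 0..-1} \<union> {1..int (Suc 0)} = {1}" by auto
  then have "black_rooted \<sigma> \<delta> 0 0 M = \<sigma> M"
    by (simp only: black_rooted_def rooted_sum_singleton) (simp add: vertex_weight_def)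
  then show ?thesis by (simp add: black_series_def)
qed

text \<open>
  The equation expresses the coefficient of order \<open>k + 1\<close> for \<open>M\<close> by coefficients of order at most \<open>k\<close>
  for the multisets with one more element.
\<close>

lemma tensor_ode_unique:
  fixes F H :: "'d::finite multiset \<Rightarrow> real fps"
  assumes "\<And>M. fps_nth (F M) 0 = fps_nth (H M) 0"
    and F: "\<And>M. fps_deriv (F M) = (\<Sum>\<alpha>\<in>UNIV. u \<alpha> * F (add_mset \<alpha> M))"
    and H: "\<And>M. fps_deriv (H M) = (\<Sum>\<alpha>\<in>UNIV. u \<alpha> * H (add_mset \<alpha> M))"
  shows "F M = H M"
proof (rule fps_ext)
  fix n show "fps_nth (F M) n = fps_nth (H M) n"
  proof (induction n arbitrary: M rule: less_induct)
    case (less n)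
    show ?case
    proof (cases n)
      case (Suc k)
      have "real (Suc k) * fps_nth (F M) (Suc k) = fps_nth (\<Sum>\<alpha>\<in>UNIV. u \<alpha> * F (add_mset \<alpha> M)) k"
        by (simp flip: F)
      also have "\<dots> = fps_nth (\<Sum>\<alpha>\<in>UNIV. u \<alpha> * H (add_mset \<alpha> M)) k"
        unfolding fps_sum_nth fps_mult_nth using Suc by (intro sum.cong refl) (simp add: less.IH)
      also have "\<dots> = real (Suc k) * fps_nth (H M) (Suc k)"
        by (simp flip: H)
      finally show ?thesis using Suc by simp
    qed (simp add: assms(1))
  qed
qed

text \<open>
  The \<open>M\<close>-th partial derivative, at \<open>u\<close>, of the function whose Taylor coefficients at \<open>0\<close> are the
  tensors \<open>c\<close>.
\<close>

definition tensor_taylor :: "('d multiset \<Rightarrow> real) \<Rightarrow> 'd multiset \<Rightarrow> ('d \<Rightarrow> real fps) \<Rightarrow> real fps" where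
  "tensor_taylor c M u = eval_series (\<lambda>as. c (M + mset as) / fact (length as)) u"

lemma tensor_taylor_nth_0:
  fixes u :: "'d::finite \<Rightarrow> real fps"
  shows "(\<And>\<alpha>. fps_nth (u \<alpha>) 0 = 0) \<Longrightarrow> fps_nth (tensor_taylor c M u) 0 = c M"
  by (simp add: tensor_taylor_def eval_series_nth_0)

lemma fps_deriv_tensor_taylor:
  fixes u :: "'d::finite \<Rightarrow> real fps"
  assumes u: "\<And>\<alpha>. fps_nth (u \<alpha>) 0 = 0"
  shows "fps_deriv (tensor_taylor c M u) =
    (\<Sum>\<alpha>\<in>UNIV. fps_deriv (u \<alpha>) * tensor_taylor c (add_mset \<alpha> M) u)"
proof -
  let ?S = "\<lambda>as. c (M + mset as) / fact (length as)"
  have S: "symmetric_coeffs ?S"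
    unfolding symmetric_coeffs_def by (metis mset_eq_length)
  have "eval_series_deriv \<alpha> ?S u = tensor_taylor c (add_mset \<alpha> M) u" for \<alpha>
    unfolding eval_series_deriv_symmetric[OF S u] tensor_taylor_def
    by (rule arg_cong2[where f = eval_series, OF ext refl]) (simp add: field_simps del: of_nat_Suc)
  then show ?thesis by (simp add: tensor_taylor_def eval_series_chain_rule[OF u])
qed

text \<open>
  A white root with its legs \<open>M\<close> is a derivative of \<open>G\<close>, and the subtrees that hang from it are
  summed by the series \<open>B^\<alpha>\<close>. Instead of decomposing a tree into all these subtrees at once, one compares
  differential equations, for which a single cut suffices.
\<close>

theorem white_series_eq_taylor:
  fixes \<sigma> \<delta> :: "'d::finite multiset \<Rightarrow> real"
  assumes \<sigma>: "kills_leaves \<sigma>"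
  shows "white_series \<sigma> \<delta> M = tensor_taylor \<delta> M (\<lambda>\<alpha>. black_series \<sigma> \<delta> {#\<alpha>#})"
proof (rule tensor_ode_unique[where F = "white_series \<sigma> \<delta>" and
      H = "\<lambda>M. tensor_taylor \<delta> M (\<lambda>\<alpha>. black_series \<sigma> \<delta> {#\<alpha>#})" and u = "\<lambda>\<alpha>. fps_deriv (black_series \<sigma> \<delta> {#\<alpha>#})"])
  have u: "fps_nth (black_series \<sigma> \<delta> {#\<alpha>#}) 0 = 0" for \<alpha>
    by (simp add: black_series_nth_0 kills_leavesD \<sigma>)
  fix M
  show "fps_nth (white_series \<sigma> \<delta> M) 0 = fps_nth (tensor_taylor \<delta> M (\<lambda>\<alpha>. black_series \<sigma> \<delta> {#\<alpha>#})) 0"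
    by (simp add: white_series_nth_0 tensor_taylor_nth_0 u)
qed (simp_all add: fps_deriv_white_series fps_deriv_tensor_taylor black_series_nth_0 kills_leavesD \<sigma>)

theorem black_series_eq_taylor:
  fixes \<sigma> \<delta> :: "'d::finite multiset \<Rightarrow> real"
  assumes \<sigma>: "kills_leaves \<sigma>"
  shows "black_series \<sigma> \<delta> M = tensor_taylor \<sigma> M (\<lambda>\<alpha>. fps_X * white_series \<sigma> \<delta> {#\<alpha>#})"
  by (rule tensor_ode_unique[where F = "black_series \<sigma> \<delta>" and
      H = "\<lambda>M. tensor_taylor \<sigma> M (\<lambda>\<alpha>. fps_X * white_series \<sigma> \<delta> {#\<alpha>#})" and u = "\<lambda>\<alpha>. fps_deriv (fps_X * white_series \<sigma> \<delta> {#\<alpha>#})"])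
    (simp_all add: fps_deriv_black_series fps_deriv_tensor_taylor tensor_taylor_nth_0 black_series_nth_0 \<sigma> 
      del: fps_deriv_mult)

section \<open>The formal system and the value of R\<close>

text \<open>
  The factor \<open>fps_X\<close> makes \<open>q\<close> modulo \<open>\<epsilon>^(n+2)\<close> depend on \<open>u\<close> modulo \<open>\<epsilon>^(n+1)\<close> only, so agreement of two
  solutions propagates from each order to the next.
\<close>

lemma formal_system_unique:
  fixes q u q' u' :: "'d::finite \<Rightarrow> real fps"
  assumes 0: "\<And>\<alpha>. fps_nth (q \<alpha>) 0 = 0" "\<And>\<alpha>. fps_nth (u \<alpha>) 0 = 0"
    "\<And>\<alpha>. fps_nth (q' \<alpha>) 0 = 0" "\<And>\<alpha>. fps_nth (u' \<alpha>) 0 = 0"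
    and q: "\<And>\<alpha>. q \<alpha> = fps_X * eval_series (c \<alpha>) u" "\<And>\<alpha>. q' \<alpha> = fps_X * eval_series (c \<alpha>) u'"
    and u: "\<And>\<alpha>. u \<alpha> = eval_series (e \<alpha>) q" "\<And>\<alpha>. u' \<alpha> = eval_series (e \<alpha>) q'"
  shows "q = q' \<and> u = u'"
proof -
  have "agree n (q \<alpha>) (q' \<alpha>) \<and> agree n (u \<alpha>) (u' \<alpha>)" for n \<alpha>
  proof (induction n arbitrary: \<alpha>)
    case 0
    then show ?case using assms(1-4) by (simp add: agree_def)
  next
    case (Suc n)
    have "agree (Suc n) (q \<alpha>) (q' \<alpha>)" for \<alpha>
    proof -
      have "agree n (eval_series (c \<alpha>) u) (eval_series (c \<alpha>) u')"
        using Suc by (intro eval_series_cong_agree 0) auto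
      then show ?thesis
        unfolding q[of \<alpha>] by (auto simp: agree_def fps_X_mult_nth)
    qed
    moreover from this have "agree (Suc n) (u \<alpha>) (u' \<alpha>)"
      unfolding u[of \<alpha>] by (intro eval_series_cong_agree 0) auto
    ultimately show ?case by simp
  qed
  then show ?thesis by (intro conjI ext fps_eqI_agree) auto
qed

lemma eval_series_split_const:
  fixes q :: "'d::finite \<Rightarrow> real fps"
  assumes "\<And>\<alpha>. fps_nth (q \<alpha>) 0 = 0"
  shows "eval_series c q = fps_const (c []) + eval_series (c([] := 0)) q"
proof (rule fps_eqI_agree)
  fix n
  let ?L = "{as :: 'd list. length as \<le> n}"
  have "(\<Sum>as\<in>?L. fps_const (c as) * monom_of q as) =
      fps_const (c []) + (\<Sum>as\<in>?L - {[]}. fps_const (c as) * monom_of q as)"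
    by (subst sum.remove[of _ "[]"]) (auto simp: finite_short_lists)
  also have "(\<Sum>as\<in>?L - {[]}. fps_const (c as) * monom_of q as) =
      (\<Sum>as\<in>?L. fps_const ((c([] := 0)) as) * monom_of q as)"
    by (subst (2) sum.remove[of _ "[]"]) (auto simp: finite_short_lists intro!: sum.cong)
  finally show "agree n (eval_series c q) (fps_const (c []) + eval_series (c([] := 0)) q)"
    using eval_series_agree[of q n n c, OF assms] eval_series_agree[of q n n "c([] := 0)", OF assms]
    by (simp add: agree_def)
qed

definition on_mset :: "('d list \<Rightarrow> real) \<Rightarrow> 'd multiset \<Rightarrow> real" where
  "on_mset f M = f (SOME as. mset as = M)"

lemma on_mset:
  assumes "symmetric_coeffs f" shows "on_mset f (mset as) = f as"
proof -
  have "mset (SOME bs. mset bs = mset as) = mset as"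
    by (rule someI_ex) blast
  then show ?thesis using assms unfolding on_mset_def symmetric_coeffs_def by blast
qed

definition black_tensor :: "('d list \<Rightarrow> real) \<Rightarrow> 'd multiset \<Rightarrow> real" where
  "black_tensor S M = fact (size M) * on_mset S M"

text \<open>
  Without the linear part of \<open>S\<close>, black leaves have weight zero.
\<close>

definition leafless_tensor :: "('d list \<Rightarrow> real) \<Rightarrow> 'd multiset \<Rightarrow> real" where
  "leafless_tensor S M = (if size M = 1 then 0 else black_tensor S M)"

definition white_tensor :: "('d::finite list \<Rightarrow> real) \<Rightarrow> (real ^ 'd \<Rightarrow> real) \<Rightarrow> 'd multiset \<Rightarrow> real" where
  "white_tensor S G = on_mset (\<lambda>as. partial_derivs as G (base_point S))"

lemma kills_leaves_leafless: "kills_leaves (leafless_tensor S)"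
  by (simp add: kills_leaves_def leafless_tensor_def)

lemma symmetric_partial_derivs: "smooth G \<Longrightarrow> symmetric_coeffs (\<lambda>as. partial_derivs as G x)"
  unfolding symmetric_coeffs_def using smooth_partial_derivs_mset by blast

lemma white_tensor_mset: "smooth G \<Longrightarrow> white_tensor S G (mset as) = partial_derivs as G (base_point S)"
  by (simp add: white_tensor_def on_mset symmetric_partial_derivs)

lemma partial_derivs_snoc: "partial_derivs as (partial_deriv \<alpha> G) = partial_derivs (as @ [\<alpha>]) G"
  by (induction as) simp_all

lemma taylor_eval_eq_tensor_taylor:
  assumes "smooth G"
  shows "taylor_eval G (base_point S) y =
    tensor_taylor (white_tensor S G) {#} (\<lambda>\<alpha>. y \<alpha> - fps_const (base_point S $ \<alpha>))"
  by (simp add: taylor_eval_def tensor_taylor_def white_tensor_mset[OF assms])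

lemma taylor_eval_partial_eq_tensor_taylor:
  assumes "smooth G"
  shows "taylor_eval (partial_deriv \<alpha> G) (base_point S) y =
    tensor_taylor (white_tensor S G) {#\<alpha>#} (\<lambda>\<alpha>. y \<alpha> - fps_const (base_point S $ \<alpha>))"
proof -
  have "white_tensor S G ({#\<alpha>#} + mset as) = partial_derivs (as @ [\<alpha>]) G (base_point S)" for as
    using white_tensor_mset[OF assms, of S "as @ [\<alpha>]"] by (simp add: union_commute)
  then show ?thesis by (simp only: taylor_eval_def tensor_taylor_def partial_derivs_snoc)
qed

text \<open>
  The linear part of \<open>S\<close> contributes precisely the constant \<open>\<phi>^\<alpha>\<close> to the gradient.
\<close>

lemma eval_series_deriv_eq_tensor_taylor:
  fixes q :: "'d::finite \<Rightarrow> real fps"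
  assumes S: "symmetric_coeffs S" and q: "\<And>\<alpha>. fps_nth (q \<alpha>) 0 = 0"
  shows "eval_series_deriv \<alpha> S q = fps_const (base_point S $ \<alpha>) + tensor_taylor (leafless_tensor S) {#\<alpha>#} q"
proof -
  have "(\<lambda>as. leafless_tensor S ({#\<alpha>#} + mset as) / fact (length as)) =
      (\<lambda>as. real (Suc (length as)) * S (\<alpha> # as))([] := 0)"
  proof
    fix as
    show "leafless_tensor S ({#\<alpha>#} + mset as) / fact (length as) =
        ((\<lambda>as. real (Suc (length as)) * S (\<alpha> # as))([] := 0)) as"
      using on_mset[OF S, of "\<alpha> # as"]
      by (simp add: leafless_tensor_def black_tensor_def del: of_nat_Suc)
  qed
  then show ?thesis
    unfolding eval_series_deriv_symmetric[OF S q] tensor_taylor_def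
    by (subst eval_series_split_const[OF q]) (simp add: base_point_def)
qed

definition q_solution ::
  "('d::finite list \<Rightarrow> real) \<Rightarrow> (real ^ 'd \<Rightarrow> real) \<Rightarrow> 'd \<Rightarrow> real fps" where
  "q_solution S G \<alpha> = fps_X * white_series (leafless_tensor S) (white_tensor S G) {#\<alpha>#}"

definition y_solution ::
  "('d::finite list \<Rightarrow> real) \<Rightarrow> (real ^ 'd \<Rightarrow> real) \<Rightarrow> 'd \<Rightarrow> real fps" where
  "y_solution S G \<alpha> = fps_const (base_point S $ \<alpha>) + black_series (leafless_tensor S) (white_tensor S G) {#\<alpha>#}"

lemma y_solution_shift:
  "(\<lambda>\<alpha>. y_solution S G \<alpha> - fps_const (base_point S $ \<alpha>)) =
     (\<lambda>\<alpha>. black_series (leafless_tensor S) (white_tensor S G) {#\<alpha>#})"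
  by (simp add: y_solution_def)

lemma q_solution_nth_0: "fps_nth (q_solution S G \<alpha>) 0 = 0"
  by (simp add: q_solution_def)

lemma tree_series_solve_system:
  fixes S :: "'d::finite list \<Rightarrow> real"
  assumes S: "symmetric_coeffs S" and G: "smooth G"
  shows "solves_system S G (q_solution S G) (y_solution S G)"
  unfolding solves_system_def
proof (intro conjI allI)
  fix \<alpha>
  show "fps_nth (q_solution S G \<alpha>) 0 = 0" by (rule q_solution_nth_0)
  show "fps_nth (y_solution S G \<alpha>) 0 = base_point S $ \<alpha>"
    by (simp add: y_solution_def black_series_nth_0 kills_leavesD[OF kills_leaves_leafless])
  show "q_solution S G \<alpha> = fps_X * taylor_eval (partial_deriv \<alpha> G) (base_point S) (y_solution S G)"
    unfolding taylor_eval_partial_eq_tensor_taylor[OF G] y_solution_shift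
    by (simp only: q_solution_def white_series_eq_taylor[OF kills_leaves_leafless])
  show "y_solution S G \<alpha> = eval_series_deriv \<alpha> S (q_solution S G)"
    unfolding eval_series_deriv_eq_tensor_taylor[OF S q_solution_nth_0]
    by (simp only: y_solution_def q_solution_def[abs_def] black_series_eq_taylor[OF kills_leaves_leafless])
qed

lemma solves_system_unique:
  fixes S :: "'d::finite list \<Rightarrow> real"
  assumes S: "symmetric_coeffs S" and G: "smooth G"
    and "solves_system S G q y" "solves_system S G q' y'"
  shows "q = q' \<and> y = y'"
proof -
  let ?u = "\<lambda>y \<alpha>. y \<alpha> - fps_const (base_point S $ \<alpha>)"
  have u: "fps_nth (q \<alpha>) 0 = 0" "fps_nth (?u y \<alpha>) 0 = 0"
    "q \<alpha> = fps_X * tensor_taylor (white_tensor S G) {#\<alpha>#} (?u y)"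
    "?u y \<alpha> = tensor_taylor (leafless_tensor S) {#\<alpha>#} q"
    if "solves_system S G q y" for q y \<alpha>
  proof -
    show q0: "fps_nth (q \<alpha>) 0 = 0" for \<alpha>
      using that by (simp add: solves_system_def)
    have "fps_nth (y \<alpha>) 0 = base_point S $ \<alpha>"
      using that unfolding solves_system_def by blast
    then show "fps_nth (?u y \<alpha>) 0 = 0" by simp
    have "q \<alpha> = fps_X * taylor_eval (partial_deriv \<alpha> G) (base_point S) y"
      using that by (simp add: solves_system_def)
    then show "q \<alpha> = fps_X * tensor_taylor (white_tensor S G) {#\<alpha>#} (?u y)"
      by (simp only: taylor_eval_partial_eq_tensor_taylor[OF G])
    have "y \<alpha> = eval_series_deriv \<alpha> S q" using that by (simp add: solves_system_def)
    then show "?u y \<alpha> = tensor_taylor (leafless_tensor S) {#\<alpha>#} q"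
      by (simp add: eval_series_deriv_eq_tensor_taylor[OF S q0])
  qed
  note uv = u[OF assms(3)] u[OF assms(4)]
  have "q = q' \<and> ?u y = ?u y'"
    by (rule formal_system_unique[OF uv(1,2,5,6) uv(3)[unfolded tensor_taylor_def]
          uv(7)[unfolded tensor_taylor_def] uv(4)[unfolded tensor_taylor_def]
          uv(8)[unfolded tensor_taylor_def]])
  then show ?thesis by (auto simp: fun_eq_iff)
qed

text \<open>
  \<open>R\<close> is stationary: by the two equations of the system, the terms with derivatives of \<open>q\<close> and \<open>y\<close> cancel, and
  what is left is the derivative of the explicit factor \<open>\<epsilon>\<close> in front of \<open>G\<close>.
\<close>

lemma fps_deriv_R_value:
  fixes S :: "'d::finite list \<Rightarrow> real"
  assumes S: "symmetric_coeffs S" and G: "smooth G"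
  shows "fps_deriv (R_value S G (q_solution S G) (y_solution S G)) =
    white_series (leafless_tensor S) (white_tensor S G) {#}"
proof -
  let ?q = "q_solution S G" and ?y = "y_solution S G"
  let ?A = "white_series (leafless_tensor S) (white_tensor S G)"
  let ?B = "black_series (leafless_tensor S) (white_tensor S G)"
  have sys: "eval_series_deriv \<alpha> S ?q = ?y \<alpha>" for \<alpha>
    using tree_series_solve_system[OF assms] by (simp add: solves_system_def)
  have G': "taylor_eval G (base_point S) ?y = ?A {#}"
    unfolding taylor_eval_eq_tensor_taylor[OF G] y_solution_shift
    by (simp only: white_series_eq_taylor[OF kills_leaves_leafless])
  have dA: "fps_deriv (fps_X * ?A {#}) = ?A {#} + (\<Sum>\<alpha>\<in>UNIV. fps_deriv (?y \<alpha>) * ?q \<alpha>)"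
    by (simp add: fps_deriv_white_series[OF kills_leaves_leafless] y_solution_def q_solution_def
        sum_distrib_left mult_ac)
  have dyq: "fps_deriv (\<Sum>\<alpha>\<in>UNIV. ?y \<alpha> * ?q \<alpha>) =
      (\<Sum>\<alpha>\<in>UNIV. ?y \<alpha> * fps_deriv (?q \<alpha>)) + (\<Sum>\<alpha>\<in>UNIV. fps_deriv (?y \<alpha>) * ?q \<alpha>)"
    by (simp add: fps_deriv_sum sum.distrib)
  have dS: "fps_deriv (eval_series S ?q) = (\<Sum>\<alpha>\<in>UNIV. ?y \<alpha> * fps_deriv (?q \<alpha>))"
    by (simp add: eval_series_chain_rule[OF q_solution_nth_0] sys mult.commute)
  show ?thesis
    unfolding R_value_def G' fps_deriv_add fps_deriv_sub dS dA dyq by simp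
qed

lemma R_value_nth_0:
  fixes S :: "'d::finite list \<Rightarrow> real"
  shows "fps_nth (R_value S G (q_solution S G) (y_solution S G)) 0 = S []"
  by (simp add: R_value_def eval_series_nth_0[OF q_solution_nth_0] fps_sum_nth q_solution_nth_0)

lemma R_value_nth_Suc:
  fixes S :: "'d::finite list \<Rightarrow> real"
  assumes "symmetric_coeffs S" "smooth G"
  shows "fps_nth (R_value S G (q_solution S G) (y_solution S G)) (Suc m) =
    (\<Sum>n\<le>m. white_rooted (leafless_tensor S) (white_tensor S G) m n {#} / (fact (Suc m) * fact n))"
proof -
  have "real (Suc m) * fps_nth (R_value S G (q_solution S G) (y_solution S G)) (Suc m) =
     (\<Sum>n\<le>m. white_rooted (leafless_tensor S) (white_tensor S G) m n {#} / (fact m * fact n))"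
    using fps_deriv_nth[of "R_value S G (q_solution S G) (y_solution S G)" m]
    by (simp add: fps_deriv_R_value[OF assms] white_series_def)
  then have "fps_nth (R_value S G (q_solution S G) (y_solution S G)) (Suc m) =
     (\<Sum>n\<le>m. white_rooted (leafless_tensor S) (white_tensor S G) m n {#} / (fact m * fact n)) / real (Suc m)"
    by (simp add: field_simps del: of_nat_Suc)
  then show ?thesis
    by (simp add: sum_divide_distrib fact_Suc mult_ac del: of_nat_Suc)
qed

section \<open>Sums over labelled trees\<close>

text \<open>
  Every tree in the sense of \<open>bipartite_tree\<close> has this form, as its edges are not repeated.
\<close>

definition tree_graph :: "nat \<Rightarrow> nat \<Rightarrow> (int \<times> int) set \<Rightarrow> bgraph" where
  "tree_graph n m E = BGraph n m (mset_set E)"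

lemma bipartite_treeE:
  assumes "bipartite_tree t"
  obtains E where "tree (verts t) E" "t = tree_graph (nblack t) (nwhite t) E"
  using assms that unfolding bipartite_tree_iff tree_graph_def by (cases t) auto

lemma edges_at_tree_graph:
  assumes "finite E"
  shows "edge_occs (tree_graph n m E) = (\<lambda>e. (e, 0)) ` E"
    and "edges_at (tree_graph n m E) v = (\<lambda>e. (e, 0)) ` edges_touching E v"
    and "vdegree (tree_graph n m E) v = card (edges_touching E v)"
proof -
  show occs: "edge_occs (tree_graph n m E) = (\<lambda>e. (e, 0)) ` E"
    using assms by (auto simp: edge_occs_def tree_graph_def count_mset_set' split: if_splits)
  show at: "edges_at (tree_graph n m E) v = (\<lambda>e. (e, 0)) ` edges_touching E v"
    unfolding edges_at_def occs edges_touching_def by auto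
  show "vdegree (tree_graph n m E) v = card (edges_touching E v)"
    unfolding vdegree_def at by (rule card_image) (auto simp: inj_on_def)
qed

lemma mset_edge_list:
  assumes "finite (edges_at t v)"
  shows "mset (edge_list t v) = mset_set (edges_at t v)"
proof -
  have "\<exists>es. distinct es \<and> set es = edges_at t v" using finite_distinct_list[OF assms] by auto
  then have "distinct (edge_list t v) \<and> set (edge_list t v) = edges_at t v"
    unfolding edge_list_def by (rule someI_ex)
  then show ?thesis by (metis mset_set_set)
qed

lemma amplitude_eq_amp:
  fixes S :: "'d::finite list \<Rightarrow> real"
  assumes S: "symmetric_coeffs S" and G: "smooth G" and E: "finite E" "t = tree_graph n m E"
  shows "amplitude S G t = amp (vertex_weight (black_tensor S) (white_tensor S G)) (verts t) E (\<lambda>_. {#})"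
proof -
  let ?\<tau> = "vertex_weight (black_tensor S) (white_tensor S G)"
  let ?P = "\<lambda>e :: int \<times> int. (e, 0 :: nat)"
  have inj: "inj_on ?P A" for A by (auto simp: inj_on_def)
  have fin: "finite (edges_touching E v)" for v using E(1) by (simp add: edges_touching_def)
  have at: "edges_at t v = ?P ` edges_touching E v" for v
    unfolding E(2) by (rule edges_at_tree_graph(2)[OF E(1)])
  have legs: "mset (map b (edge_list t v)) = legs (b \<circ> ?P) E v" for b :: "_ \<Rightarrow> 'd" and v
  proof -
    have "mset (map b (edge_list t v)) = image_mset b (mset_set (?P ` edges_touching E v))"
      using mset_edge_list[of t v] fin by (simp add: at)
    also have "\<dots> = legs (b \<circ> ?P) E v"
      by (simp add: legs_def image_mset_mset_set[OF inj, symmetric] multiset.map_comp)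
    finally show ?thesis .
  qed
  have black: "fact (vdegree t v) * S (map b (edge_list t v)) = ?\<tau> v (legs (b \<circ> ?P) E v)"
    if "v \<in> blacks t" for b :: "_ \<Rightarrow> 'd" and v
  proof -
    have "v > 0" using that by (simp add: blacks_def)
    moreover have "vdegree t v = size (legs (b \<circ> ?P) E v)"
      unfolding E(2) edges_at_tree_graph(3)[OF E(1)] by (simp add: legs_def)
    ultimately show ?thesis
      using on_mset[OF S, of "map b (edge_list t v)"]
      by (simp only: vertex_weight_def black_tensor_def legs if_True)
  qed
  have white: "partial_derivs (map b (edge_list t v)) G (base_point S) = ?\<tau> v (legs (b \<circ> ?P) E v)"
    if "v \<in> whites t" for b :: "_ \<Rightarrow> 'd" and v
  proof -
    have "\<not> v > 0" using that by (simp add: whites_def)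
    then show ?thesis
      using white_tensor_mset[OF G, of S "map b (edge_list t v)"]
      by (simp only: vertex_weight_def legs if_False)
  qed
  have disj: "blacks t \<inter> whites t = {}" "finite (blacks t)" "finite (whites t)"
    by (auto simp: blacks_def whites_def)
  have "amplitude S G t = (\<Sum>b\<in>?P ` E \<rightarrow>\<^sub>E UNIV. \<Prod>v\<in>verts t. ?\<tau> v (legs (b \<circ> ?P) E v))"
    unfolding amplitude_def E(2) edges_at_tree_graph(1)[OF E(1)] unfolding E(2)[symmetric]
    using disj by (intro sum.cong refl) (simp add: black white prod.union_disjoint)
  also have "\<dots> = (\<Sum>b\<in>?P ` E \<rightarrow>\<^sub>E UNIV. \<Prod>v\<in>verts t. ?\<tau> v (legs (restrict (b \<circ> ?P) E) E v))"
    by (intro sum.cong prod.cong refl arg_cong2[where f = ?\<tau>] legs_cong) simp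
  also have "\<dots> = (\<Sum>a\<in>E \<rightarrow>\<^sub>E UNIV. \<Prod>v\<in>verts t. ?\<tau> v (legs a E v))"
    by (rule sum_PiE_reindex[OF inj])
  finally show ?thesis by (simp add: amp_def)
qed

definition canonical_verts :: "nat \<Rightarrow> nat \<Rightarrow> int set" where
  "canonical_verts n m = {1..int n} \<union> {- int m..-1}"

lemma verts_canonical: "verts t = canonical_verts (nblack t) (nwhite t)"
  by (simp add: canonical_verts_def blacks_def whites_def)

definition leafless :: "int set \<Rightarrow> (int \<times> int) set \<Rightarrow> bool" where
  "leafless V E \<longleftrightarrow> (\<forall>v\<in>V. v > 0 \<longrightarrow> card (edges_touching E v) \<noteq> 1)"

lemma T_white_tree_graph:
  assumes E: "tree (canonical_verts n m) E"
  shows "tree_graph n m E \<in> T_white \<longleftrightarrow> leafless (canonical_verts n m) E"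
proof -
  let ?t = "tree_graph n m E"
  have fin: "finite E" using tree_finite[OF E] by simp
  have V: "verts ?t = canonical_verts n m" by (simp add: verts_canonical tree_graph_def)
  have "bipartite_tree ?t"
    unfolding bipartite_tree_iff V using E by (auto simp: tree_graph_def)
  moreover have "v \<in> whites ?t \<longleftrightarrow> \<not> v > 0" if "v \<in> canonical_verts n m" for v
    using that by (auto simp: canonical_verts_def whites_def tree_graph_def)
  ultimately show ?thesis
    unfolding T_white_def leafless_def mem_Collect_eq V edges_at_tree_graph(3)[OF fin] by auto
qed

lemma T_whiteE:
  assumes "t \<in> T_white"
  obtains E where "tree (canonical_verts (nblack t) (nwhite t)) E"
    "leafless (canonical_verts (nblack t) (nwhite t)) E" "t = tree_graph (nblack t) (nwhite t) E"
proof -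
  have "bipartite_tree t" using assms by (simp add: T_white_def)
  then obtain E where E: "tree (verts t) E" "t = tree_graph (nblack t) (nwhite t) E"
    by (rule bipartite_treeE)
  have tr: "tree (canonical_verts (nblack t) (nwhite t)) E" using E(1) by (simp only: verts_canonical)
  have "tree_graph (nblack t) (nwhite t) E \<in> T_white" using assms E(2) by simp
  then have "leafless (canonical_verts (nblack t) (nwhite t)) E"
    using T_white_tree_graph[OF tr] by simp
  with tr E(2) that show ?thesis by blast
qed

definition trees_of_size :: "nat \<Rightarrow> nat \<Rightarrow> bgraph set" where
  "trees_of_size n m = {t \<in> T_white. nblack t = n \<and> nwhite t = m}"

lemma tree_graph_inj: "finite E \<Longrightarrow> finite E' \<Longrightarrow> tree_graph n m E = tree_graph n m E' \<longleftrightarrow> E = E'"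
  by (auto simp: tree_graph_def)

lemma trees_of_size_eq:
  "trees_of_size n m = tree_graph n m ` {E. tree (canonical_verts n m) E \<and> leafless (canonical_verts n m) E}"
proof (intro equalityI subsetI)
  fix t assume "t \<in> trees_of_size n m"
  then have "t \<in> T_white" "nblack t = n" "nwhite t = m" by (auto simp: trees_of_size_def)
  then show "t \<in> tree_graph n m ` {E. tree (canonical_verts n m) E \<and> leafless (canonical_verts n m) E}"
    by (elim T_whiteE) auto
next
  fix t assume "t \<in> tree_graph n m ` {E. tree (canonical_verts n m) E \<and> leafless (canonical_verts n m) E}"
  then show "t \<in> trees_of_size n m"
    using T_white_tree_graph by (auto simp: trees_of_size_def tree_graph_def)
qed

lemma finite_trees_of_size: "finite (trees_of_size n m)"
  unfolding trees_of_size_eq using finite_trees[of "canonical_verts n m"] by simp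

text \<open>
  On \<open>T_white\<close> the weights with and without the linear part of \<open>S\<close> coincide, and the trees outside
  \<open>T_white\<close> contribute nothing to the sum with \<open>leafless_tensor\<close>.
\<close>

lemma sum_amplitude_trees_of_size:
  fixes S :: "'d::finite list \<Rightarrow> real"
  assumes S: "symmetric_coeffs S" and G: "smooth G"
  shows "(\<Sum>t\<in>trees_of_size n m. amplitude S G t) =
    tree_sum (vertex_weight (leafless_tensor S) (white_tensor S G)) (canonical_verts n m) (\<lambda>_. {#})"
proof -
  let ?V = "canonical_verts n m"
  let ?\<sigma> = "vertex_weight (leafless_tensor S) (white_tensor S G)"
  have inj: "inj_on (tree_graph n m) {E. tree ?V E \<and> leafless ?V E}"
    using tree_graph_inj tree_finite by (auto simp: inj_on_def)
  have "(\<Sum>t\<in>trees_of_size n m. amplitude S G t) =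
      (\<Sum>E | tree ?V E \<and> leafless ?V E. amplitude S G (tree_graph n m E))"
    unfolding trees_of_size_eq by (rule sum.reindex[OF inj, unfolded o_def])
  also have "\<dots> = (\<Sum>E | tree ?V E \<and> leafless ?V E. amp ?\<sigma> ?V E (\<lambda>_. {#}))"
  proof (rule sum.cong[OF refl])
    fix E assume "E \<in> {E. tree ?V E \<and> leafless ?V E}"
    then have E: "tree ?V E" "leafless ?V E" by auto
    have fin: "finite E" using tree_finite[OF E(1)] by simp
    have V: "verts (tree_graph n m E) = ?V" by (simp add: verts_canonical tree_graph_def)
    have "amplitude S G (tree_graph n m E) =
        amp (vertex_weight (black_tensor S) (white_tensor S G)) ?V E (\<lambda>_. {#})"
      using amplitude_eq_amp[OF S G fin refl] by (simp only: V)
    also have "\<dots> = amp ?\<sigma> ?V E (\<lambda>_. {#})"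
      unfolding amp_def
    proof (intro sum.cong prod.cong refl)
      fix v and a :: "int \<times> int \<Rightarrow> 'd" assume "v \<in> ?V"
      then have "v > 0 \<Longrightarrow> size (legs a E v) \<noteq> 1" using E(2) by (simp add: leafless_def legs_def)
      then show "vertex_weight (black_tensor S) (white_tensor S G) v ({#} + legs a E v) =
          ?\<sigma> v ({#} + legs a E v)"
        by (simp add: vertex_weight_def leafless_tensor_def)
    qed
    finally show "amplitude S G (tree_graph n m E) = amp ?\<sigma> ?V E (\<lambda>_. {#})" .
  qed
  also have "\<dots> = tree_sum ?\<sigma> ?V (\<lambda>_. {#})"
    unfolding tree_sum_def
  proof (rule sum.mono_neutral_left[OF finite_trees])
    show "\<forall>E\<in>{E. tree ?V E} - {E. tree ?V E \<and> leafless ?V E}. amp ?\<sigma> ?V E (\<lambda>_. {#}) = 0"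
    proof
      fix E assume "E \<in> {E. tree ?V E} - {E. tree ?V E \<and> leafless ?V E}"
      then obtain v where "tree ?V E" "v \<in> ?V" "v > 0" "card (edges_touching E v) = 1"
        by (auto simp: leafless_def)
      then show "amp ?\<sigma> ?V E (\<lambda>_. {#}) = 0"
        by (rule amp_black_leaf) (simp_all add: kills_leaves_leafless)
    qed
  qed auto
  finally show ?thesis .
qed

lemma T_white_black_bound:
  assumes "t \<in> T_white"
  shows "nblack t \<le> Suc (nwhite t)"
proof -
  let ?n = "nblack t" and ?m = "nwhite t"
  let ?V = "canonical_verts ?n ?m"
  from assms obtain E where E: "tree ?V E" "leafless ?V E" by (rule T_whiteE)
  have card: "card ?V = ?n + ?m" unfolding canonical_verts_def by (subst card_Un_disjoint) auto
  show ?thesis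
  proof (cases "card ?V = 1")
    case False
    have "2 * card {1..int ?n} < card ?V"
    proof (rule tree_black_degree_bound[OF E(1)])
      show "{1..int ?n} \<subseteq> ?V" by (simp add: canonical_verts_def)
      fix v assume "v \<in> {1..int ?n}"
      then have v: "v \<in> ?V" "v > 0" by (auto simp: canonical_verts_def)
      have "?V \<noteq> {v}" using False by auto
      then have "card (edges_touching E v) \<ge> 1" by (rule tree_degree_pos[OF E(1) v(1)])
      moreover have "card (edges_touching E v) \<noteq> 1" using E(2) v by (simp add: leafless_def)
      ultimately show "card (edges_touching E v) \<ge> 2" by simp
    qed simp
    then show ?thesis using card by simp
  qed (use card in simp)
qed

definition trees_of_order :: "nat \<Rightarrow> bgraph set" where
  "trees_of_order m = {t \<in> T_white. nwhite t = m}"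

lemma trees_of_order_eq: "trees_of_order m = (\<Union>n\<le>Suc m. trees_of_size n m)"
  using T_white_black_bound by (auto simp: trees_of_order_def trees_of_size_def)

lemma finite_trees_of_order: "finite (trees_of_order m)"
  unfolding trees_of_order_eq using finite_trees_of_size by blast

lemma tree_sum_no_vertices: "tree_sum \<tau> {} x = 0"
  using tree_nonempty by (auto simp: tree_sum_def intro!: sum.neutral)

text \<open>
  At positive order, a sum over labelled trees can be rooted at the white vertex \<open>-1\<close> for
  free, as no legs are attached. At order zero only the one-vertex tree exists.
\<close>

lemma R_value_nth:
  fixes S :: "'d::finite list \<Rightarrow> real"
  assumes S: "symmetric_coeffs S" and G: "smooth G"
  shows "fps_nth (R_value S G (q_solution S G) (y_solution S G)) m =
    (\<Sum>t\<in>trees_of_order m. amplitude S G t / (fact (nwhite t) * fact (nblack t)))"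
proof -
  let ?\<sigma> = "leafless_tensor S" and ?\<delta> = "white_tensor S G"
  let ?Z = "\<lambda>n m. tree_sum (vertex_weight ?\<sigma> ?\<delta>) (canonical_verts n m) (\<lambda>_. {#})"
  have "(\<Sum>t\<in>trees_of_order m. amplitude S G t / (fact (nwhite t) * fact (nblack t))) =
      (\<Sum>n\<le>Suc m. \<Sum>t\<in>trees_of_size n m. amplitude S G t / (fact (nwhite t) * fact (nblack t)))"
    unfolding trees_of_order_eq
    by (rule sum.UNION_disjoint) (auto simp: finite_trees_of_size, auto simp: trees_of_size_def)
  also have "\<dots> = (\<Sum>n\<le>Suc m. (\<Sum>t\<in>trees_of_size n m. amplitude S G t) / (fact m * fact n))"
    unfolding sum_divide_distrib by (intro sum.cong refl) (simp add: trees_of_size_def)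
  also have "\<dots> = (\<Sum>n\<le>Suc m. ?Z n m / (fact m * fact n))"
    by (simp only: sum_amplitude_trees_of_size[OF S G])
  also have "\<dots> = fps_nth (R_value S G (q_solution S G) (y_solution S G)) m"
  proof (cases m)
    case 0
    have V: "canonical_verts 0 0 = {}" "canonical_verts (Suc 0) 0 = {1}"
      by (auto simp: canonical_verts_def)
    have "(\<lambda>_. {#})(1 := {#}) = (\<lambda>_ :: int. {#} :: 'd multiset)" by auto
    then have "?Z (Suc 0) 0 = ?\<sigma> {#}"
      using rooted_sum_singleton[of ?\<sigma> ?\<delta> 1 "{#}"] by (simp add: V rooted_sum_def vertex_weight_def)
    also have "\<dots> = S []"
      using on_mset[OF S, of "[]"] by (simp add: leafless_tensor_def black_tensor_def)
    finally show ?thesis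
      unfolding 0 R_value_nth_0 by (simp add: V tree_sum_no_vertices)
  next
    case (Suc k)
    have "(\<lambda>_. {#})(-1 := {#}) = (\<lambda>_ :: int. {#} :: 'd multiset)" by auto
    then have Z: "?Z n (Suc k) = white_rooted ?\<sigma> ?\<delta> k n {#}" for n
      by (simp only: white_rooted_def rooted_sum_def canonical_verts_def Un_commute)
    have "(\<Sum>n\<le>Suc m. ?Z n m / (fact m * fact n)) = (\<Sum>n\<le>k. ?Z n m / (fact m * fact n))"
    proof (rule sum.mono_neutral_right)
      show "\<forall>n\<in>{..Suc m} - {..k}. ?Z n m / (fact m * fact n) = 0"
        unfolding Suc Z by (simp add: white_rooted_eq_0[OF kills_leaves_leafless])
    qed (use Suc in auto)
    then show ?thesis by (simp only: Suc Z R_value_nth_Suc[OF S G])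
  qed
  finally show ?thesis by simp
qed

section \<open>Isomorphism classes\<close>

definition relabellings :: "nat \<Rightarrow> nat \<Rightarrow> ((int \<Rightarrow> int) \<times> (int \<Rightarrow> int)) set" where
  "relabellings n m = {\<beta>. \<beta> permutes {1..int n}} \<times> {\<omega>. \<omega> permutes {- int m..-1}}"

definition relabel :: "(int \<Rightarrow> int) \<times> (int \<Rightarrow> int) \<Rightarrow> bgraph \<Rightarrow> bgraph" where
  "relabel p t = BGraph (nblack t) (nwhite t) (image_mset (map_prod (fst p) (snd p)) (bedges t))"

lemma relabel_size [simp]: "nblack (relabel p t) = nblack t" "nwhite (relabel p t) = nwhite t"
  by (simp_all add: relabel_def)

lemma is_iso_iff: "is_iso t t' p \<longleftrightarrow> p \<in> relabellings (nblack t) (nwhite t) \<and> t' = relabel p t"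
  by (cases p; cases t') (auto simp: is_iso_def relabellings_def relabel_def blacks_def whites_def)

lemma card_relabellings: "card (relabellings n m) = fact n * fact m"
  using card_permutations[of "{1..int n}" n] card_permutations[of "{- int m..-1}" m]
  by (simp add: relabellings_def card_cartesian_product)

lemma finite_relabellings: "finite (relabellings n m)"
  by (simp add: relabellings_def finite_permutations)

definition relabel_comp ::
  "(int \<Rightarrow> int) \<times> (int \<Rightarrow> int) \<Rightarrow> (int \<Rightarrow> int) \<times> (int \<Rightarrow> int) \<Rightarrow> (int \<Rightarrow> int) \<times> (int \<Rightarrow> int)" where
  "relabel_comp p q = (fst p \<circ> fst q, snd p \<circ> snd q)"

definition relabel_inv :: "(int \<Rightarrow> int) \<times> (int \<Rightarrow> int) \<Rightarrow> (int \<Rightarrow> int) \<times> (int \<Rightarrow> int)" where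
  "relabel_inv p = (inv (fst p), inv (snd p))"

lemma relabel_comp: "relabel p (relabel q t) = relabel (relabel_comp p q) t"
  by (simp add: relabel_def relabel_comp_def multiset.map_comp map_prod.comp)

lemma relabel_id: "relabel (id, id) t = t"
  by (cases t) (simp add: relabel_def map_prod.id)

lemma relabel_comp_mem:
  "p \<in> relabellings n m \<Longrightarrow> q \<in> relabellings n m \<Longrightarrow> relabel_comp p q \<in> relabellings n m"
  by (auto simp: relabellings_def relabel_comp_def permutes_compose)

lemma relabel_inv_mem: "p \<in> relabellings n m \<Longrightarrow> relabel_inv p \<in> relabellings n m"
  by (auto simp: relabellings_def relabel_inv_def permutes_inv)

lemma relabel_inv_left: "p \<in> relabellings n m \<Longrightarrow> relabel_comp (relabel_inv p) p = (id, id)"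
  and relabel_inv_right: "p \<in> relabellings n m \<Longrightarrow> relabel_comp p (relabel_inv p) = (id, id)"
  by (auto simp: relabellings_def relabel_comp_def relabel_inv_def permutes_inv_o)

lemma relabel_comp_assoc: "relabel_comp p (relabel_comp q r) = relabel_comp (relabel_comp p q) r"
  by (simp add: relabel_comp_def o_assoc)

lemma relabel_comp_id [simp]: "relabel_comp (id, id) p = p" "relabel_comp p (id, id) = p"
  by (simp_all add: relabel_comp_def)

lemma relabel_tree_graph:
  assumes p: "p \<in> relabellings n m" and E: "tree (canonical_verts n m) E"
  defines "V \<equiv> canonical_verts n m"
  obtains \<pi> where "inj_on \<pi> V" "\<And>v. v \<in> V \<Longrightarrow> sgn (\<pi> v) = sgn v" "\<pi> ` V = V"
    "relabel p (tree_graph n m E) = tree_graph n m (map_prod \<pi> \<pi> ` E)"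
proof -
  define \<pi> where "\<pi> v = (if v > 0 then fst p v else snd p v)" for v
  have perm: "fst p permutes {1..int n}" "snd p permutes {- int m..-1}"
    using p by (auto simp: relabellings_def)
  have "bij_betw \<pi> {1..int n} {1..int n}"
    using permutes_imp_bij[OF perm(1)] by (rule bij_betw_cong[THEN iffD1, rotated]) (simp add: \<pi>_def)
  moreover have "bij_betw \<pi> {- int m..-1} {- int m..-1}"
    using permutes_imp_bij[OF perm(2)] by (rule bij_betw_cong[THEN iffD1, rotated]) (simp add: \<pi>_def)
  ultimately have "bij_betw \<pi> V V"
    unfolding V_def canonical_verts_def by (rule bij_betw_combine) auto
  then have inj: "inj_on \<pi> V" and img: "\<pi> ` V = V" by (auto simp: bij_betw_def)
  have "\<pi> v \<in> {1..int n}" if "v \<in> {1..int n}" for v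
    using that permutes_in_image[OF perm(1)] by (simp add: \<pi>_def)
  moreover have "\<pi> v \<in> {- int m..-1}" if "v \<in> {- int m..-1}" for v
    using that permutes_in_image[OF perm(2)] by (simp add: \<pi>_def)
  ultimately have sgn: "sgn (\<pi> v) = sgn v" if "v \<in> V" for v
    using that unfolding V_def canonical_verts_def by (fastforce simp: sgn_if)
  have "image_mset (map_prod (fst p) (snd p)) (mset_set E) = image_mset (map_prod \<pi> \<pi>) (mset_set E)"
  proof (rule image_mset_cong)
    fix e assume "e \<in># mset_set E"
    then have "e \<in> E" using tree_finite[OF E] by simp
    then show "map_prod (fst p) (snd p) e = map_prod \<pi> \<pi> e"
      using tree_edges[OF E \<open>e \<in> E\<close>] by (cases e) (auto simp: \<pi>_def)
  qed
  also have "\<dots> = mset_set (map_prod \<pi> \<pi> ` E)"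
    by (rule image_mset_mset_set[OF tree_relabel_inj[OF E inj[unfolded V_def]]])
  finally have "relabel p (tree_graph n m E) = tree_graph n m (map_prod \<pi> \<pi> ` E)"
    by (simp add: relabel_def tree_graph_def)
  with inj sgn img that show ?thesis by blast
qed

text \<open>
  The pair of permutations combines into one bijection of the vertices that preserves colours.
\<close>

lemma relabel_T_white_and_amplitude:
  fixes S :: "'d::finite list \<Rightarrow> real"
  assumes t: "t \<in> T_white" and p: "p \<in> relabellings (nblack t) (nwhite t)"
  shows "relabel p t \<in> T_white"
    and "symmetric_coeffs S \<Longrightarrow> smooth G \<Longrightarrow> amplitude S G (relabel p t) = amplitude S G t"
proof -
  let ?n = "nblack t" and ?m = "nwhite t"
  let ?V = "canonical_verts ?n ?m"
  from t obtain E where E: "tree ?V E" "leafless ?V E" and tE: "t = tree_graph ?n ?m E"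
    by (rule T_whiteE)
  from relabel_tree_graph[OF p E(1)] obtain \<pi> where inj: "inj_on \<pi> ?V"
    and sgn: "\<And>v. v \<in> ?V \<Longrightarrow> sgn (\<pi> v) = sgn v" and img: "\<pi> ` ?V = ?V"
    and rel: "relabel p (tree_graph ?n ?m E) = tree_graph ?n ?m (map_prod \<pi> \<pi> ` E)" by blast
  let ?E' = "map_prod \<pi> \<pi> ` E"
  have rel: "relabel p t = tree_graph ?n ?m ?E'" using rel tE by simp
  have tree': "tree ?V ?E'" using tree_relabel[OF E(1) inj sgn] img by simp
  have "leafless ?V ?E'"
    unfolding leafless_def
  proof (intro ballI impI)
    fix v' assume "v' \<in> ?V" "v' > 0"
    then obtain v where v: "v \<in> ?V" "v' = \<pi> v" using img by blast
    have "v > 0" using sgn[OF v(1)] v(2) \<open>v' > 0\<close> by (simp add: sgn_if split: if_splits)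
    have "card (edges_touching ?E' v') = card (edges_touching E v)"
      unfolding v(2) edges_touching_relabel[OF E(1) inj v(1)]
      by (intro card_image inj_on_subset[OF tree_relabel_inj[OF E(1) inj]])
        (auto simp: edges_touching_def)
    then show "card (edges_touching ?E' v') \<noteq> 1"
      using E(2) v \<open>v > 0\<close> by (simp add: leafless_def)
  qed
  then show "relabel p t \<in> T_white" unfolding rel T_white_tree_graph[OF tree'] .
  assume SG: "symmetric_coeffs S" "smooth G"
  let ?\<tau> = "vertex_weight (black_tensor S) (white_tensor S G)"
  have fin: "finite E" "finite ?E'" using tree_finite[OF E(1)] by auto
  have V: "verts (tree_graph ?n ?m F) = ?V" for F by (simp add: verts_canonical tree_graph_def)
  have "amplitude S G (relabel p t) = amp ?\<tau> (\<pi> ` ?V) ?E' (\<lambda>_. {#})"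
    unfolding rel amplitude_eq_amp[OF SG fin(2) refl] V img ..
  also have "\<dots> = amp ?\<tau> ?V E (\<lambda>_. {#})"
  proof (rule amp_relabel[OF E(1) inj])
    fix v assume "v \<in> ?V"
    then show "?\<tau> (\<pi> v) = ?\<tau> v"
      using sgn[of v] by (auto simp: vertex_weight_def sgn_if split: if_splits)
  qed simp
  also have "\<dots> = amplitude S G t"
    using amplitude_eq_amp[OF SG fin(1) tE] by (simp only: verts_canonical)
  finally show "amplitude S G (relabel p t) = amplitude S G t" .
qed

lemma iso_rel_iff:
  "(t, t') \<in> iso_rel \<longleftrightarrow> t \<in> T_white \<and> (\<exists>p\<in>relabellings (nblack t) (nwhite t). t' = relabel p t)"
  unfolding iso_rel_def using relabel_T_white_and_amplitude(1) by (auto simp: is_iso_iff)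

lemma equiv_iso_rel: "equiv T_white iso_rel"
proof (rule equivI)
  show "iso_rel \<subseteq> T_white \<times> T_white" by (auto simp: iso_rel_def)
  show "refl_on T_white iso_rel"
    unfolding refl_on_def
  proof (intro conjI ballI)
    fix t :: bgraph assume "t \<in> T_white"
    moreover have "(id, id) \<in> relabellings (nblack t) (nwhite t)"
      by (simp add: relabellings_def permutes_id)
    ultimately show "(t, t) \<in> iso_rel" unfolding iso_rel_iff using relabel_id[of t] by metis
  qed
  show "sym iso_rel"
  proof (rule symI)
    fix t t' assume tt: "(t, t') \<in> iso_rel"
    then obtain p where p: "p \<in> relabellings (nblack t) (nwhite t)" "t' = relabel p t"
      by (auto simp: iso_rel_iff)
    have "t = relabel (relabel_inv p) t'"
      by (simp add: p(2) relabel_comp relabel_inv_left[OF p(1)] relabel_id)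
    moreover have "t' \<in> T_white" using tt by (simp add: iso_rel_def)
    ultimately show "(t', t) \<in> iso_rel"
      unfolding iso_rel_iff using relabel_inv_mem[OF p(1)] p(2) by (metis relabel_size)
  qed
  show "trans iso_rel"
  proof (rule transI)
    fix t t' t'' assume 1: "(t, t') \<in> iso_rel" and 2: "(t', t'') \<in> iso_rel"
    from 1 obtain p where p: "p \<in> relabellings (nblack t) (nwhite t)" "t' = relabel p t"
      by (auto simp: iso_rel_iff)
    from 2 obtain q where q: "q \<in> relabellings (nblack t) (nwhite t)" "t'' = relabel q t'"
      by (auto simp: iso_rel_iff p(2))
    have "t \<in> T_white" using 1 by (simp add: iso_rel_def)
    then show "(t, t'') \<in> iso_rel"
      unfolding iso_rel_iff using relabel_comp_mem[OF q(1) p(1)] p(2) q(2) relabel_comp by metis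
  qed
qed

lemma iso_class_eq: "t \<in> T_white \<Longrightarrow> iso_rel `` {t} = (\<lambda>p. relabel p t) ` relabellings (nblack t) (nwhite t)"
  by (auto simp: iso_rel_iff)

text \<open>
  The class is an orbit of the group of pairs of permutations. The pairs that carry \<open>t\<close> to a given \<open>t'\<close>
  form a coset of the automorphism group.
\<close>

lemma card_iso_class:
  assumes t: "t \<in> T_white"
  shows "card (iso_rel `` {t}) * card (sym_group t) = fact (nblack t) * fact (nwhite t)"
proof -
  let ?P = "relabellings (nblack t) (nwhite t)"
  have sym: "sym_group t = {p \<in> ?P. relabel p t = t}"
    by (auto simp: sym_group_def is_iso_iff)
  have fiber: "card {p \<in> ?P. relabel p t = t'} = card (sym_group t)" if t': "t' \<in> iso_rel `` {t}" for t'
  proof -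
    obtain p0 where p0: "p0 \<in> ?P" "t' = relabel p0 t" using t' by (auto simp: iso_rel_iff)
    have "bij_betw (relabel_comp p0) (sym_group t) {p \<in> ?P. relabel p t = t'}"
    proof (rule bij_betw_byWitness[where f' = "relabel_comp (relabel_inv p0)"])
      show "\<forall>p\<in>sym_group t. relabel_comp (relabel_inv p0) (relabel_comp p0 p) = p"
        "\<forall>p\<in>{p \<in> ?P. relabel p t = t'}. relabel_comp p0 (relabel_comp (relabel_inv p0) p) = p"
        by (simp_all add: relabel_comp_assoc relabel_inv_left[OF p0(1)] relabel_inv_right[OF p0(1)])
      show "relabel_comp p0 ` sym_group t \<subseteq> {p \<in> ?P. relabel p t = t'}"
        using p0 by (auto simp: sym relabel_comp_mem relabel_comp[symmetric])
      have "relabel (relabel_inv p0) t' = t"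
        by (simp add: p0(2) relabel_comp relabel_inv_left[OF p0(1)] relabel_id)
      then show "relabel_comp (relabel_inv p0) ` {p \<in> ?P. relabel p t = t'} \<subseteq> sym_group t"
        using p0 by (auto simp: sym relabel_comp_mem relabel_inv_mem relabel_comp[symmetric])
    qed
    then show ?thesis by (rule bij_betw_same_card[symmetric])
  qed
  have "fact (nblack t) * fact (nwhite t) = card ?P" by (simp add: card_relabellings)
  also have "\<dots> = (\<Sum>p\<in>?P. 1)" by simp
  also have "\<dots> = (\<Sum>t'\<in>(\<lambda>p. relabel p t) ` ?P. \<Sum>p | p \<in> ?P \<and> relabel p t = t'. 1)"
    by (rule sum.image_gen[OF finite_relabellings])
  also have "\<dots> = (\<Sum>t'\<in>iso_rel `` {t}. card (sym_group t))"
    unfolding iso_class_eq[OF t, symmetric] by (intro sum.cong refl) (simp add: fiber)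
  finally show ?thesis by simp
qed

theorem proposition1p4:
  fixes S :: "'d::finite list \<Rightarrow> real" and G :: "real ^ 'd \<Rightarrow> real"
  assumes "symmetric_coeffs S" and "smooth G"
  shows "\<exists>q y. solves_system S G q y \<and>
           (\<forall>q' y'. solves_system S G q' y' \<longrightarrow> q' = q \<and> y' = y) \<and>
           ((\<lambda>t. fps_const (1 / (fact (nwhite t) * fact (nblack t))) * amplitude_fps S G t)
              has_sum R_value S G q y) T_white \<and>
           (\<forall>rep. (\<forall>c \<in> T_white // iso_rel. rep c \<in> c) \<longrightarrow>
              ((\<lambda>c. fps_const (1 / real (card (sym_group (rep c)))) * amplitude_fps S G (rep c))
                 has_sum R_value S G q y) (T_white // iso_rel))"
proof (intro exI conjI allI impI)
  let ?q = "q_solution S G" and ?y = "y_solution S G"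
  let ?R = "R_value S G ?q ?y"
  show "solves_system S G ?q ?y" by (rule tree_series_solve_system[OF assms])
  fix q' y' assume "solves_system S G q' y'"
  then show "q' = ?q" "y' = ?y"
    using solves_system_unique[OF assms] tree_series_solve_system[OF assms] by blast+
next
  let ?R = "R_value S G (q_solution S G) (y_solution S G)"
  let ?w = "\<lambda>t. amplitude S G t / (fact (nwhite t) * fact (nblack t))"
  let ?f = "\<lambda>t. fps_const (1 / (fact (nwhite t) * fact (nblack t))) * amplitude_fps S G t"
  have nth: "fps_nth (?f t) k = (if nwhite t = k then ?w t else 0)" for t k
    by (simp add: amplitude_fps_def fps_X_power_nth)
  show "(?f has_sum ?R) T_white"
  proof (rule fps_has_sumI)
    fix k
    have sub: "{t \<in> T_white. fps_nth (?f t) k \<noteq> 0} \<subseteq> trees_of_order k"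
      unfolding nth by (auto simp: trees_of_order_def)
    then show "finite {t \<in> T_white. fps_nth (?f t) k \<noteq> 0}"
      by (rule finite_subset[OF _ finite_trees_of_order])
    have "fps_nth ?R k = (\<Sum>t\<in>trees_of_order k. fps_nth (?f t) k)"
      unfolding R_value_nth[OF assms] nth by (intro sum.cong refl) (simp add: trees_of_order_def)
    also have "\<dots> = (\<Sum>t | t \<in> T_white \<and> fps_nth (?f t) k \<noteq> 0. fps_nth (?f t) k)"
      by (rule sum.mono_neutral_right[OF finite_trees_of_order sub]) (auto simp: trees_of_order_def)
    finally show "fps_nth ?R k = (\<Sum>t | t \<in> T_white \<and> fps_nth (?f t) k \<noteq> 0. fps_nth (?f t) k)" .
  qed
  fix rep :: "bgraph set \<Rightarrow> bgraph" assume rep: "\<forall>c\<in>T_white // iso_rel. rep c \<in> c"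
  let ?g = "\<lambda>c. fps_const (1 / real (card (sym_group (rep c)))) * amplitude_fps S G (rep c)"
  have cls: "rep c \<in> T_white" "c = iso_rel `` {rep c}" if c: "c \<in> T_white // iso_rel" for c
  proof -
    obtain t where t: "t \<in> T_white" "c = iso_rel `` {t}" using c by (rule quotientE)
    have "rep c \<in> c" using rep c by blast
    then have rel: "(t, rep c) \<in> iso_rel" using t by blast
    then show "rep c \<in> T_white" by (simp add: iso_rel_def)
    show "c = iso_rel `` {rep c}" using equiv_class_eq[OF equiv_iso_rel rel] t(2) by simp
  qed
  have mem: "t \<in> T_white \<and> nwhite t = nwhite (rep c) \<and> nblack t = nblack (rep c) \<and>
      amplitude S G t = amplitude S G (rep c)" if "c \<in> T_white // iso_rel" "t \<in> c" for c t
  proof -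
    have "(rep c, t) \<in> iso_rel" using cls[OF that(1)] that(2) by blast
    then obtain p where p: "p \<in> relabellings (nblack (rep c)) (nwhite (rep c))" "t = relabel p (rep c)"
      by (auto simp: iso_rel_iff)
    then show ?thesis
      using relabel_T_white_and_amplitude[OF cls(1)[OF that(1)] p(1)] assms by simp
  qed
  have g: "fps_nth (?g c) k = (\<Sum>t\<in>c. fps_nth (?f t) k)" if c: "c \<in> T_white // iso_rel" for c k
  proof -
    have "(\<Sum>t\<in>c. fps_nth (?f t) k) = (\<Sum>t\<in>c. fps_nth (?f (rep c)) k)"
      unfolding nth by (intro sum.cong refl) (simp add: mem[OF c])
    also have "\<dots> = real (card c) * fps_nth (?f (rep c)) k" by simp
    also have "\<dots> = fps_nth (?g c) k"
    proof -
      have "card c * card (sym_group (rep c)) = fact (nblack (rep c)) * fact (nwhite (rep c))"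
        using card_iso_class[OF cls(1)[OF c]] cls(2)[OF c] by simp
      then have eq: "real (card c) * real (card (sym_group (rep c))) =
          fact (nblack (rep c)) * fact (nwhite (rep c))"
        by (metis of_nat_fact of_nat_mult)
      then have "card (sym_group (rep c)) \<noteq> 0" by (intro notI) simp
      with eq have "real (card c) / (fact (nwhite (rep c)) * fact (nblack (rep c))) =
          1 / real (card (sym_group (rep c)))"
        by (simp add: field_simps)
      then have "amplitude S G (rep c) * (real (card c) / (fact (nwhite (rep c)) * fact (nblack (rep c)))) =
          amplitude S G (rep c) * (1 / real (card (sym_group (rep c))))"
        by (rule arg_cong)
      then have w: "real (card c) * ?w (rep c) = amplitude S G (rep c) / real (card (sym_group (rep c)))"
        by (simp add: mult.commute)
      have gk: "fps_nth (?g c) k =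
          (if nwhite (rep c) = k then amplitude S G (rep c) / real (card (sym_group (rep c))) else 0)"
        by (simp add: amplitude_fps_def fps_X_power_nth)
      show ?thesis unfolding nth gk using w by (cases "nwhite (rep c) = k") simp_all
    qed
    finally show ?thesis ..
  qed
  show "(?g has_sum ?R) (T_white // iso_rel)"
  proof (rule fps_has_sumI)
    fix k
    let ?Q = "{c \<in> T_white // iso_rel. c \<subseteq> trees_of_order k}"
    have union: "\<Union>?Q = trees_of_order k"
    proof (intro equalityI subsetI)
      fix t assume t: "t \<in> trees_of_order k"
      then have tT: "t \<in> T_white" by (simp add: trees_of_order_def)
      let ?c = "iso_rel `` {t}"
      have "?c \<in> T_white // iso_rel" using tT by (rule quotientI)
      moreover have "?c \<subseteq> trees_of_order k"
        using t by (auto simp: iso_rel_iff trees_of_order_def relabel_T_white_and_amplitude(1))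
      moreover have "t \<in> ?c" using equiv_class_self[OF equiv_iso_rel tT] .
      ultimately show "t \<in> \<Union>?Q" by blast
    qed blast
    have finQ: "finite ?Q"
      by (rule finite_subset[of _ "Pow (trees_of_order k)"]) (auto simp: finite_trees_of_order)
    have sub: "{c \<in> T_white // iso_rel. fps_nth (?g c) k \<noteq> 0} \<subseteq> ?Q"
    proof
      fix c assume "c \<in> {c \<in> T_white // iso_rel. fps_nth (?g c) k \<noteq> 0}"
      then have c: "c \<in> T_white // iso_rel" "fps_nth (?g c) k \<noteq> 0" by auto
      then have "nwhite (rep c) = k" by (auto simp: amplitude_fps_def fps_X_power_nth split: if_splits)
      then show "c \<in> ?Q" using mem[OF c(1)] c(1) by (auto simp: trees_of_order_def)
    qed
    then show "finite {c \<in> T_white // iso_rel. fps_nth (?g c) k \<noteq> 0}"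
      using finQ by (rule finite_subset)
    have "fps_nth ?R k = (\<Sum>t\<in>trees_of_order k. fps_nth (?f t) k)"
      unfolding R_value_nth[OF assms] nth by (intro sum.cong refl) (simp add: trees_of_order_def)
    also have "\<dots> = (\<Sum>t\<in>\<Union>?Q. fps_nth (?f t) k)" by (simp only: union)
    also have "\<dots> = (\<Sum>c\<in>?Q. \<Sum>t\<in>c. fps_nth (?f t) k)"
    proof (rule sum.Union_disjoint[unfolded o_def])
      show "\<forall>c\<in>?Q. finite c" using finite_subset[OF _ finite_trees_of_order] by blast
      show "\<forall>c\<in>?Q. \<forall>c'\<in>?Q. c \<noteq> c' \<longrightarrow> c \<inter> c' = {}"
        using quotient_disj[OF equiv_iso_rel] by blast
    qed
    also have "\<dots> = (\<Sum>c\<in>?Q. fps_nth (?g c) k)" by (intro sum.cong refl) (simp only: g mem_Collect_eq)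
    also have "\<dots> = (\<Sum>c | c \<in> T_white // iso_rel \<and> fps_nth (?g c) k \<noteq> 0. fps_nth (?g c) k)"
      by (rule sum.mono_neutral_right[OF finQ sub]) auto
    finally show "fps_nth ?R k = (\<Sum>c | c \<in> T_white // iso_rel \<and> fps_nth (?g c) k \<noteq> 0. fps_nth (?g c) k)" .
  qed
qed

end
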